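(* Let $p\ge0$ be an integer, let $q\geq 1$ be an odd integer, let $D\subseteq\mathbb{R}^{p+2}$ be a domain invariant under the reflection $(\boldsymbol{x}_p,r)\mapsto(\boldsymbol{x}_p,-r)$, and let $f:\Omega_D\to\mathbb{R}_{p+q}$ be a generalized partial-slice regular function on the partially symmetric completion $\Omega_D\subseteq\mathbb{R}^{p+q+1}$ of $D$. Then, on $\Omega_D$: (i) $D_{\boldsymbol{x}}\,\Delta_{\boldsymbol{x}}^{\frac{q-1}{2}}f(\boldsymbol{x})=(1-q)\,\Delta_{\boldsymbol{x}}^{\frac{q-1}{2}}f_s'(\boldsymbol{x})=0$, where $f_s'$ is the spherical derivative of $f$. (ii) $\Delta_{\boldsymbol{x}}^{\frac{q+1}{2}}f(\boldsymbol{x})=0$, i.e. every generalized partial-slice regular function is polyharmonic of degree $\frac{q+1}{2}$.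
   Context: Clifford algebra. For $n=p+q$, $\mathbb{R}_{n}$ is the real Clifford algebra generated by $e_1,\dots,e_n$ with $e_ie_j+e_je_i=-2\delta_{ij}$, and $e_0=1$. $\mathbb{R}^{n+1}$ is identified with the paravectors $\sum_{i=0}^n x_ie_i\in\mathbb{R}_n$. Splitting. Each $\boldsymbol{x}\in\mathbb{R}^{p+q+1}$ is written $\boldsymbol{x}=\boldsymbol{x}_p+\underline{\boldsymbol{x}}_q$, with $\boldsymbol{x}_p=\sum_{i=0}^p x_ie_i\in\mathbb{R}^{p+1}$ and $\underline{\boldsymbol{x}}_q=\sum_{i=p+1}^{p+q}x_ie_i\in\mathbb{R}^q$. $\mathbb{S}=\{\underline{\boldsymbol{x}}_q:\ \underline{\boldsymbol{x}}_q^2=-1\}$ is the unit sphere of $\mathbb{R}^q$; write $\underline{\boldsymbol{x}}_q=r\underline{\omega}$ with $r=|\underline{\boldsymbol{x}}_q|\ge 0$, $\underline{\omega}\in\mathbb{S}$. Operators (acting from the left): $D_{\boldsymbol{x}_p}=\sum_{i=0}^pe_i\partial_{x_i}$, $\overline{D}_{\boldsymbol{x}_p}=\partial_{x_0}-\sum_{i=1}^pe_i\partial_{x_i}$, $D_{\boldsymbol{x}}=\sum_{i=0}^{p+q}e_i\partial_{x_i}$, and $\Delta_{\boldsymbol{x}}=\sum_{i=0}^{p+q}\partial_{x_i}^2$. Domains. For $D\subseteq\mathbb{R}^{p+2}$ a domain with $\boldsymbol{x}'=(\boldsymbol{x}_p,r)\in D\Rightarrow \boldsymbol{x}'_\diamond=(\boldsymbol{x}_p,-r)\in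 D$, the partially symmetric completion is $\Omega_D=\{\boldsymbol{x}_p+r\underline{\omega}:\ \underline{\omega}\in\mathbb{S},\ r\ge0,\ (\boldsymbol{x}_p,r)\in D\}\subseteq\mathbb{R}^{p+q+1}$. Generalized partial-slice regular functions. $f:\Omega_D\to\mathbb{R}_{p+q}$ is generalized partial-slice regular if $f(\boldsymbol{x})=F_1(\boldsymbol{x}')+\underline{\omega}F_2(\boldsymbol{x}')$ for $\boldsymbol{x}=\boldsymbol{x}_p+r\underline{\omega}\in\Omega_D$, $\boldsymbol{x}'=(\boldsymbol{x}_p,r)$, where $F_1,F_2\in C^1(D;\mathbb{R}_{p+q})$ satisfy $F_1(\boldsymbol{x}'_\diamond)=F_1(\boldsymbol{x}')$, $F_2(\boldsymbol{x}'_\diamond)=-F_2(\boldsymbol{x}')$ and, on $D$, $D_{\boldsymbol{x}_p}F_1-\partial_rF_2=0$ and $\overline{D}_{\boldsymbol{x}_p}F_2+\partial_rF_1=0$. Spherical derivative. For $\boldsymbol{x}=\boldsymbol{x}_p+\underline{\boldsymbol{x}}_q\in\Omega_D\setminus\mathbb{R}^{p+1}$ and $\boldsymbol{x}_\diamond=\boldsymbol{x}_p-\underline{\boldsymbol{x}}_q$, $f_s'(\boldsymbol{x})=\frac12\underline{\boldsymbol{x}}_q^{-1}\big(f(\boldsymbol{x})-f(\boldsymbol{x}_\diamond)\big)=\frac1rF_2(\boldsymbol{x}_p,r)$; it is extended by continuity to $\Omega_D\cap\mathbb{R}^{p+1}$. *)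

theory Defs
  imports "HOL-Analysis.Analysis"
begin

section \<open>The real Clifford algebra with $n$ generators squaring to $-1$\<close>

text \<open>
  An element of \<open>'n clifford\<close> is the family of its real coordinates with respect to the basis
  \<open>e\<^sub>A = e\<^sub>i\<^sub>1 \<cdots> e\<^sub>i\<^sub>k\<close>, where \<open>A = {i\<^sub>1 < \<dots> < i\<^sub>k} \<subseteq> {1..n}\<close> and \<open>n = CARD('n)\<close>.  The type parameter
  only carries the number of generators; the generators themselves are numbered by naturals.
\<close>

typedef ('n::finite) clifford = "{a :: nat set \<Rightarrow> real. \<forall>A. \<not> A \<subseteq> {1..CARD('n)} \<longrightarrow> a A = 0}"
  morphisms coord Abs_clifford
  by (rule exI[of _ "\<lambda>_. 0"]) simp

setup_lifting type_definition_clifford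

text \<open>
  \<open>e\<^sub>A e\<^sub>B = blade_sign A B e\<^sub>C\<close> with \<open>C\<close> the symmetric difference of \<open>A\<close> and \<open>B\<close>: a pair \<open>i \<in> A\<close>,
  \<open>j \<in> B\<close> contributes a factor \<open>-1\<close> if \<open>j < i\<close> (the two generators have to be interchanged) or
  if \<open>j = i\<close> (because \<open>e\<^sub>i e\<^sub>i = -1\<close>).
\<close>

definition blade_sign :: "nat set \<Rightarrow> nat set \<Rightarrow> real" where
  "blade_sign A B = (\<Prod>i\<in>A. \<Prod>j\<in>B. if j \<le> i then -1 else 1)"

lemma blade_sign_empty [simp]: "blade_sign {} B = 1" "blade_sign A {} = 1"
  by (simp_all add: blade_sign_def)

lemma blade_sign_square [simp]: "blade_sign A B * blade_sign A B = 1"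
proof -
  have "blade_sign A B * blade_sign A B =
      (\<Prod>i\<in>A. \<Prod>j\<in>B. (if j \<le> i then -1 else 1) * (if j \<le> i then -1 else (1::real)))"
    by (simp add: blade_sign_def prod.distrib)
  also have "\<dots> = 1"
    by (intro prod.neutral ballI) auto
  finally show ?thesis .
qed

lemma prod_sym_diff:
  fixes f :: "'a \<Rightarrow> real"
  assumes "finite A" "finite B" and sq: "\<And>x. f x * f x = 1"
  shows "prod f (sym_diff A B) = prod f A * prod f B"
proof -
  have "prod f (sym_diff A B) = prod f (A - B) * prod f (B - A)"
    using assms by (intro prod.union_disjoint) auto
  moreover have "prod f A = prod f (A - B) * prod f (A \<inter> B)"
    using assms(1) by (subst prod.union_disjoint[symmetric]) (auto simp: Un_Diff_Int)
  moreover have "prod f B = prod f (B - A) * prod f (A \<inter> B)"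
    using assms(2) by (subst prod.union_disjoint[symmetric]) (auto simp: Int_commute[of A] Un_Diff_Int)
  moreover have "prod f (A \<inter> B) * prod f (A \<inter> B) = 1"
    by (simp add: prod.distrib[symmetric] sq)
  ultimately show ?thesis
    by (simp add: mult.assoc mult.left_commute)
qed

lemma blade_sign_sym_diff_left:
  assumes "finite A" "finite B" "finite C"
  shows "blade_sign (sym_diff A B) C = blade_sign A C * blade_sign B C"
  unfolding blade_sign_def using assms
  by (intro prod_sym_diff) (auto simp: prod.distrib[symmetric] intro!: prod.neutral)

lemma blade_sign_sym_diff_right:
  assumes "finite A" "finite B" "finite C"
  shows "blade_sign C (sym_diff A B) = blade_sign C A * blade_sign C B"
proof -
  have "blade_sign C (sym_diff A B) = (\<Prod>i\<in>C. (\<Prod>j\<in>A. if j \<le> i then -1 else 1) *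
      (\<Prod>j\<in>B. if j \<le> i then -1 else 1))"
    unfolding blade_sign_def using assms by (intro prod.cong prod_sym_diff) auto
  then show ?thesis
    by (simp add: blade_sign_def prod.distrib)
qed

lemma blade_sign_cocycle:
  assumes "finite A" "finite C" "finite D"
  shows "blade_sign A (sym_diff A D) * blade_sign (sym_diff A C) (sym_diff C D) =
    blade_sign A (sym_diff A C) * blade_sign C (sym_diff C D)"
proof -
  have *: "blade_sign A D * (blade_sign A D * x) = x" for x
    by (simp flip: mult.assoc)
  show ?thesis
    using assms by (simp add: blade_sign_sym_diff_left blade_sign_sym_diff_right mult_ac *)
qed

lift_definition blade :: "nat set \<Rightarrow> 'n::finite clifford" is
  "\<lambda>A B. if A = B \<and> A \<subseteq> {1..CARD('n)} then 1 else 0"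
  by auto

lemma coord_outside: "\<not> A \<subseteq> {1..CARD('n)} \<Longrightarrow> coord (a :: 'n::finite clifford) A = 0"
  by transfer auto

lemma clifford_eqI:
  fixes a b :: "'n::finite clifford"
  assumes "\<And>A. A \<subseteq> {1..CARD('n)} \<Longrightarrow> coord a A = coord b A"
  shows "a = b"
  by (metis assms coord_inject coord_outside ext)

instantiation clifford :: (finite) real_vector
begin

lift_definition zero_clifford :: "'a clifford" is "\<lambda>_. 0" by simp
lift_definition plus_clifford :: "'a clifford \<Rightarrow> 'a clifford \<Rightarrow> 'a clifford" is "\<lambda>a b A. a A + b A"
  by simp
lift_definition minus_clifford :: "'a clifford \<Rightarrow> 'a clifford \<Rightarrow> 'a clifford" is "\<lambda>a b A. a A - b A"
  by simp
lift_definition uminus_clifford :: "'a clifford \<Rightarrow> 'a clifford" is "\<lambda>a A. - a A" by simp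
lift_definition scaleR_clifford :: "real \<Rightarrow> 'a clifford \<Rightarrow> 'a clifford" is "\<lambda>r a A. r * a A" by simp

instance
  by standard (transfer; auto simp: algebra_simps)+

end

lemma coord_simps [simp]:
  "coord 0 A = 0" "coord (a + b) A = coord a A + coord b A" "coord (a - b) A = coord a A - coord b A"
  "coord (- a) A = - coord a A" "coord (r *\<^sub>R a) A = r * coord a A"
  by (transfer; simp)+

lemma coord_sum [simp]: "coord (sum f I) A = (\<Sum>i\<in>I. coord (f i) A)"
  by (induction I rule: infinite_finite_induct) auto

lemma coord_blade: "coord (blade A :: 'n::finite clifford) B = (if A = B \<and> A \<subseteq> {1..CARD('n)} then 1 else 0)"
  by transfer auto

text \<open>
  In the product, the coordinate at \<open>C\<close> collects the terms \<open>e\<^sub>A e\<^sub>B\<close> whose \<open>B\<close> is the symmetric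
  difference of \<open>A\<close> and \<open>C\<close>, that is, those for which \<open>C\<close> is the symmetric difference of \<open>A\<close> and \<open>B\<close>.
\<close>

lemma product_supported:
  fixes a b :: "nat set \<Rightarrow> real" and N :: "nat set"
  assumes b: "\<And>A. \<not> A \<subseteq> N \<Longrightarrow> b A = 0" and C: "\<not> C \<subseteq> N"
  shows "(\<Sum>A\<in>Pow N. blade_sign A (sym_diff A C) * a A * b (sym_diff A C)) = 0"
proof (intro sum.neutral ballI)
  fix A
  assume "A \<in> Pow N"
  with C have "\<not> sym_diff A C \<subseteq> N" by blast
  then show "blade_sign A (sym_diff A C) * a A * b (sym_diff A C) = 0" by (simp add: b)
qed

instantiation clifford :: (finite) real_algebra_1
begin

definition one_clifford :: "'a clifford" where "one_clifford = blade {}"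

lift_definition times_clifford :: "'a clifford \<Rightarrow> 'a clifford \<Rightarrow> 'a clifford" is
  "\<lambda>a b C. \<Sum>A\<in>Pow {1..CARD('a)}. blade_sign A (sym_diff A C) * a A * b (sym_diff A C)"
  by (rule product_supported) simp_all

lemma coord_times:
  "coord (a * b :: 'a clifford) C =
    (\<Sum>A\<in>Pow {1..CARD('a)}. blade_sign A (sym_diff A C) * coord a A * coord b (sym_diff A C))"
  by transfer simp

instance
proof
  fix a b c :: "'a clifford" and r :: real
  let ?N = "{1..CARD('a)}"
  show "a * b * c = a * (b * c)"
  proof (rule clifford_eqI)
    fix D assume "D \<subseteq> ?N"
    then have fD: "finite D" by (rule finite_subset) simp
    have "coord (a * b * c) D = (\<Sum>C\<in>Pow ?N. \<Sum>A\<in>Pow ?N. blade_sign C (sym_diff C D) *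
        (blade_sign A (sym_diff A C) * coord a A * coord b (sym_diff A C)) * coord c (sym_diff C D))"
      by (simp add: coord_times sum_distrib_left sum_distrib_right)
    also have "\<dots> = (\<Sum>A\<in>Pow ?N. \<Sum>C\<in>Pow ?N. blade_sign C (sym_diff C D) *
        (blade_sign A (sym_diff A C) * coord a A * coord b (sym_diff A C)) * coord c (sym_diff C D))"
      by (rule sum.swap)
    also have "\<dots> = (\<Sum>A\<in>Pow ?N. \<Sum>B\<in>Pow ?N. blade_sign A (sym_diff A D) * coord a A *
        (blade_sign B (sym_diff B (sym_diff A D)) * coord b B * coord c (sym_diff B (sym_diff A D))))"
    proof (rule sum.cong[OF refl])
      fix A assume A: "A \<in> Pow ?N"
      then have fA: "finite A" by (auto intro: finite_subset)
      show "(\<Sum>C\<in>Pow ?N. blade_sign C (sym_diff C D) *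
          (blade_sign A (sym_diff A C) * coord a A * coord b (sym_diff A C)) * coord c (sym_diff C D)) =
        (\<Sum>B\<in>Pow ?N. blade_sign A (sym_diff A D) * coord a A *
        (blade_sign B (sym_diff B (sym_diff A D)) * coord b B * coord c (sym_diff B (sym_diff A D))))"
      proof (rule sum.reindex_bij_witness[of _ "\<lambda>B. sym_diff A B" "\<lambda>C. sym_diff A C"])
        fix C assume C: "C \<in> Pow ?N"
        then have fC: "finite C" by (auto intro: finite_subset)
        have eq: "sym_diff (sym_diff A C) (sym_diff A D) = sym_diff C D" by blast
        show "blade_sign A (sym_diff A D) * coord a A * (blade_sign (sym_diff A C)
            (sym_diff (sym_diff A C) (sym_diff A D)) * coord b (sym_diff A C) *
            coord c (sym_diff (sym_diff A C) (sym_diff A D))) =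
          blade_sign C (sym_diff C D) * (blade_sign A (sym_diff A C) * coord a A *
            coord b (sym_diff A C)) * coord c (sym_diff C D)"
          unfolding eq using blade_sign_cocycle[OF fA fC fD] by (simp add: mult_ac)
      qed (use A in auto)
    qed
    also have "\<dots> = coord (a * (b * c)) D"
      by (simp add: coord_times sum_distrib_left)
    finally show "coord (a * b * c) D = coord (a * (b * c)) D" .
  qed
  show "1 * a = a"
  proof (rule clifford_eqI)
    fix C
    have "coord (1 * a) C = (\<Sum>A\<in>Pow ?N. if A = {} then coord a C else 0)"
      unfolding coord_times one_clifford_def by (intro sum.cong) (auto simp: coord_blade)
    then show "coord (1 * a) C = coord a C" by simp
  qed
  show "a * 1 = a"
  proof (rule clifford_eqI)
    fix C assume C: "C \<subseteq> ?N"
    have "coord (a * 1) C = (\<Sum>A\<in>Pow ?N. if A = C then coord a C else 0)"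
      unfolding coord_times one_clifford_def by (intro sum.cong) (auto simp: coord_blade)
    then show "coord (a * 1) C = coord a C" using C by simp
  qed
  show "(a + b) * c = a * c + b * c" "a * (b + c) = a * b + a * c"
    by (rule clifford_eqI, simp add: coord_times algebra_simps sum.distrib)+
  show "r *\<^sub>R a * b = r *\<^sub>R (a * b)" "a * r *\<^sub>R b = r *\<^sub>R (a * b)"
    by (rule clifford_eqI, simp add: coord_times algebra_simps sum_distrib_left)+
  have "coord (1 :: 'a clifford) {} \<noteq> coord (0 :: 'a clifford) {}"
    by (simp add: one_clifford_def coord_blade)
  then show "(0 :: 'a clifford) \<noteq> 1" by metis
qed

end

text \<open>The Euclidean structure in which the basis \<open>e\<^sub>A\<close> is orthonormal.\<close>

instantiation clifford :: (finite) real_inner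
begin

definition inner_clifford :: "'a clifford \<Rightarrow> 'a clifford \<Rightarrow> real" where
  "inner_clifford a b = (\<Sum>A\<in>Pow {1..CARD('a)}. coord a A * coord b A)"
definition norm_clifford :: "'a clifford \<Rightarrow> real" where
  "norm_clifford a = sqrt (inner a a)"
definition sgn_clifford :: "'a clifford \<Rightarrow> 'a clifford" where
  "sgn_clifford a = a /\<^sub>R norm a"
definition dist_clifford :: "'a clifford \<Rightarrow> 'a clifford \<Rightarrow> real" where
  "dist_clifford a b = norm (a - b)"
definition uniformity_clifford :: "('a clifford \<times> 'a clifford) filter" where
  "uniformity_clifford = (INF e\<in>{0<..}. principal {(x, y). dist x y < e})"
definition open_clifford :: "'a clifford set \<Rightarrow> bool" where
  "open_clifford U = (\<forall>x\<in>U. eventually (\<lambda>(x', y). x' = x \<longrightarrow> y \<in> U) uniformity)"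

instance
proof
  fix a b c :: "'a clifford" and r :: real
  show "inner a a = 0 \<longleftrightarrow> a = 0"
    by (auto simp: inner_clifford_def sum_nonneg_eq_0_iff intro: clifford_eqI)
qed (simp_all add: inner_clifford_def norm_clifford_def sgn_clifford_def dist_clifford_def
    uniformity_clifford_def open_clifford_def algebra_simps sum.distrib sum_distrib_left sum_nonneg)

end

instantiation clifford :: (finite) euclidean_space
begin

definition Basis_clifford :: "'a clifford set" where
  "Basis_clifford = blade ` Pow {1..CARD('a)}"

instance
proof
  let ?N = "{1..CARD('a)}"
  have inner_blade: "inner a (blade A) = coord a A" if "A \<subseteq> ?N" for A and a :: "'a clifford"
  proof -
    have "inner a (blade A) = (\<Sum>B\<in>Pow ?N. if B = A then coord a B else 0)"
      unfolding inner_clifford_def using that by (intro sum.cong) (auto simp: coord_blade)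
    then show ?thesis using that by simp
  qed
  show "(Basis :: 'a clifford set) \<noteq> {}" "finite (Basis :: 'a clifford set)"
    by (auto simp: Basis_clifford_def)
  show "inner u v = (if u = v then 1 else 0)" if uv: "u \<in> Basis" "v \<in> Basis" for u v :: "'a clifford"
  proof -
    obtain A B where AB: "A \<subseteq> ?N" "B \<subseteq> ?N" "u = blade A" "v = blade B"
      using uv by (auto simp: Basis_clifford_def)
    have "inner u v = (if A = B then 1 else 0)"
      using AB by (simp add: inner_blade coord_blade)
    moreover have "u = v \<longleftrightarrow> A = B"
      using AB by (metis coord_blade zero_neq_one)
    ultimately show ?thesis by simp
  qed
  show "(\<forall>u\<in>Basis. inner a u = 0) \<longleftrightarrow> a = 0" for a :: "'a clifford"
    by (auto simp: Basis_clifford_def inner_blade intro: clifford_eqI)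
qed

end

text \<open>The paravector units: \<open>e\<^sub>0 = 1\<close>, and \<open>e\<^sub>1, \<dots>, e\<^sub>n\<close> are the generators.\<close>

definition cunit :: "nat \<Rightarrow> 'n::finite clifford" (\<open>\<e>\<close>) where
  "\<e> i = (if i = 0 then 1 else blade {i})"

lemma blade_times:
  fixes A B :: "nat set"
  assumes A: "A \<subseteq> {1..CARD('n)}" and B: "B \<subseteq> {1..CARD('n)}"
  shows "(blade A * blade B :: 'n::finite clifford) = blade_sign A B *\<^sub>R blade (sym_diff A B)"
proof (rule clifford_eqI)
  fix C
  let ?N = "{1..CARD('n)}"
  have "coord (blade A * blade B :: 'n clifford) C =
      (\<Sum>A'\<in>Pow ?N. if A' = A then blade_sign A (sym_diff A C) * (if B = sym_diff A C then 1 else 0) else 0)"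
    unfolding coord_times using A B by (intro sum.cong) (auto simp: coord_blade)
  also have "\<dots> = (if B = sym_diff A C then blade_sign A B else 0)"
    using A by simp
  also have "B = sym_diff A C \<longleftrightarrow> sym_diff A B = C" by blast
  also have "(if sym_diff A B = C then blade_sign A B else 0) =
      coord (blade_sign A B *\<^sub>R blade (sym_diff A B) :: 'n clifford) C"
    using A B by (auto simp: coord_blade)
  finally show "coord (blade A * blade B :: 'n clifford) C =
      coord (blade_sign A B *\<^sub>R blade (sym_diff A B) :: 'n clifford) C" .
qed

lemma clifford_relations:
  assumes "i \<in> {1..CARD('n)}" "j \<in> {1..CARD('n)}"
  shows "(\<e> i * \<e> j + \<e> j * \<e> i :: 'n::finite clifford) = (if i = j then -2 else 0)"
proof -
  have *: "(\<e> i * \<e> j :: 'n clifford) = (if j \<le> i then -1 else 1) *\<^sub>R blade (sym_diff {i} {j})"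
    if "i \<in> {1..CARD('n)}" "j \<in> {1..CARD('n)}" for i j
    using that blade_times[of "{i}" "{j}", where 'n = 'n] by (auto simp: cunit_def blade_sign_def)
  show ?thesis
  proof (cases "i = j")
    case True
    with assms *[of i i] have "(\<e> i * \<e> j :: 'n clifford) = - 1"
      by (simp add: one_clifford_def)
    with True show ?thesis by simp
  next
    case False
    have "sym_diff {i} {j} = sym_diff {j} {i}" by blast
    with False assms *[of i j] *[of j i] show ?thesis by (cases "j \<le> i") auto
  qed
qed

lemma blade_insert:
  assumes "i \<in> {1..CARD('n)}" "A \<subseteq> {1..CARD('n)}" "\<And>j. j \<in> A \<Longrightarrow> i < j"
  shows "(blade (insert i A) :: 'n::finite clifford) = \<e> i * blade A"
proof -
  have "sym_diff {i} A = insert i A" using assms(3) by blast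
  moreover have "blade_sign {i} A = 1"
    using assms(3) by (auto simp: blade_sign_def not_le intro!: prod.neutral)
  ultimately show ?thesis
    using assms(1,2) blade_times[of "{i}" A, where 'n = 'n] by (simp add: cunit_def)
qed

text \<open>Two-sided inverse of an invertible element (the algebra is in general not a division ring).\<close>

definition cinverse :: "'n::finite clifford \<Rightarrow> 'n clifford" where
  "cinverse a = (THE b. a * b = 1 \<and> b * a = 1)"


section \<open>Partial derivatives and differential operators\<close>

definition partial :: "'a::real_normed_vector \<Rightarrow> ('a \<Rightarrow> 'b::real_normed_vector) \<Rightarrow> 'a \<Rightarrow> 'b" where
  "partial v f x = vector_derivative (\<lambda>t. f (x + t *\<^sub>R v)) (at 0)"

text \<open>
  \<open>Ck_on k B S f\<close>: all iterated partial derivatives of \<open>f\<close> of order at most \<open>k\<close> in the coordinate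
  directions \<open>B\<close> exist and are continuous on \<open>S\<close>.  When \<open>S\<close> is relatively open in the span of \<open>B\<close>,
  this is the usual notion \<open>f \<in> C\<^sup>k(S)\<close>.
\<close>

primrec Ck_on :: "nat \<Rightarrow> 'a::real_normed_vector set \<Rightarrow> 'a set \<Rightarrow> ('a \<Rightarrow> 'b::real_normed_vector) \<Rightarrow> bool" where
  "Ck_on 0 B S f \<longleftrightarrow> continuous_on S f"
| "Ck_on (Suc k) B S f \<longleftrightarrow> continuous_on S f \<and>
     (\<forall>v\<in>B. (\<forall>x\<in>S. (\<lambda>t. f (x + t *\<^sub>R v)) differentiable (at 0)) \<and> Ck_on k B S (partial v f))"

definition dirac :: "nat \<Rightarrow> ('n::finite clifford \<Rightarrow> 'n clifford) \<Rightarrow> 'n clifford \<Rightarrow> 'n clifford" where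
  "dirac m f x = (\<Sum>i=0..m. \<e> i * partial (\<e> i) f x)"

definition dirac_conj :: "nat \<Rightarrow> ('n::finite clifford \<Rightarrow> 'n clifford) \<Rightarrow> 'n clifford \<Rightarrow> 'n clifford" where
  "dirac_conj m f x = partial (\<e> 0) f x - (\<Sum>i=1..m. \<e> i * partial (\<e> i) f x)"

definition laplace :: "nat \<Rightarrow> ('n::finite clifford \<Rightarrow> 'n clifford) \<Rightarrow> 'n clifford \<Rightarrow> 'n clifford" where
  "laplace m f x = (\<Sum>i=0..m. partial (\<e> i) (partial (\<e> i) f) x)"


section \<open>Generalized partial-slice functions\<close>

text \<open>
  Throughout, \<open>p + q = CARD('n)\<close>.  As in the usual identification with paravectors,
  \<open>\<real>\<^sup>p\<^sup>+\<^sup>1 = span {e\<^sub>0, \<dots>, e\<^sub>p}\<close>, \<open>\<real>\<^sup>q = span {e\<^sub>p\<^sub>+\<^sub>1, \<dots>, e\<^sub>p\<^sub>+\<^sub>q}\<close>, and \<open>\<real>\<^sup>p\<^sup>+\<^sup>2\<close> is the space of pairs \<open>(x\<^sub>p, r)\<close>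
  with \<open>x\<^sub>p \<in> \<real>\<^sup>p\<^sup>+\<^sup>1\<close> and \<open>r\<close> real.
\<close>

definition space_p :: "nat \<Rightarrow> 'n::finite clifford set" where
  "space_p p = span (\<e> ` {0..p})"

definition space_q :: "nat \<Rightarrow> nat \<Rightarrow> 'n::finite clifford set" where
  "space_q p q = span (\<e> ` {p+1..p+q})"

definition part_p :: "nat \<Rightarrow> 'n::finite clifford \<Rightarrow> 'n clifford" where
  "part_p p x = (\<Sum>i=0..p. (x \<bullet> \<e> i) *\<^sub>R \<e> i)"

definition part_q :: "nat \<Rightarrow> nat \<Rightarrow> 'n::finite clifford \<Rightarrow> 'n clifford" where
  "part_q p q x = (\<Sum>i=p+1..p+q. (x \<bullet> \<e> i) *\<^sub>R \<e> i)"

definition sphere_q :: "nat \<Rightarrow> nat \<Rightarrow> 'n::finite clifford set" where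
  "sphere_q p q = {\<omega> \<in> space_q p q. \<omega> * \<omega> = - 1}"

definition symmetric_domain :: "nat \<Rightarrow> ('n::finite clifford \<times> real) set \<Rightarrow> bool" where
  "symmetric_domain p D \<longleftrightarrow>
     openin (top_of_set (space_p p \<times> UNIV)) D \<and> connected D \<and>
     (\<forall>(xp, r)\<in>D. (xp, - r) \<in> D)"

definition slice_completion :: "nat \<Rightarrow> nat \<Rightarrow> ('n::finite clifford \<times> real) set \<Rightarrow> 'n clifford set" where
  "slice_completion p q D = {xp + r *\<^sub>R \<omega> | xp r \<omega>. \<omega> \<in> sphere_q p q \<and> r \<ge> 0 \<and> (xp, r) \<in> D}"

definition coord_dirs :: "nat \<Rightarrow> ('n::finite clifford \<times> real) set" where
  "coord_dirs p = (\<lambda>i. (\<e> i, 0)) ` {0..p} \<union> {(0, 1)}"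

definition partial_slice_regular ::
    "nat \<Rightarrow> nat \<Rightarrow> ('n::finite clifford \<times> real) set \<Rightarrow> ('n clifford \<Rightarrow> 'n clifford) \<Rightarrow> bool" where
  "partial_slice_regular p q D f \<longleftrightarrow> (\<exists>F1 F2 :: 'n clifford \<times> real \<Rightarrow> 'n clifford.
     Ck_on 1 (coord_dirs p) D F1 \<and> Ck_on 1 (coord_dirs p) D F2 \<and>
     (\<forall>(xp, r)\<in>D. F1 (xp, - r) = F1 (xp, r) \<and> F2 (xp, - r) = - F2 (xp, r)) \<and>
     (\<forall>(xp, r)\<in>D.
        dirac p (\<lambda>y. F1 (y, r)) xp - partial 1 (\<lambda>s. F2 (xp, s)) r = 0 \<and>
        dirac_conj p (\<lambda>y. F2 (y, r)) xp + partial 1 (\<lambda>s. F1 (xp, s)) r = 0) \<and>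
     (\<forall>xp r \<omega>. (xp, r) \<in> D \<and> r \<ge> 0 \<and> \<omega> \<in> sphere_q p q \<longrightarrow>
        f (xp + r *\<^sub>R \<omega>) = F1 (xp, r) + \<omega> * F2 (xp, r)))"

text \<open>
  The spherical derivative of \<open>f\<close> on \<open>\<Omega>\<close>; at the points with vanishing \<open>q\<close>-part it is the limit of
  the values at the remaining points of \<open>\<Omega>\<close>.  (\<open>Lim\<close> is total: the value is meaningful only if the
  limit exists, i.e. if the resulting function is continuous on \<open>\<Omega>\<close>.)
\<close>

definition spherical_quotient ::
    "nat \<Rightarrow> nat \<Rightarrow> ('n::finite clifford \<Rightarrow> 'n clifford) \<Rightarrow> 'n clifford \<Rightarrow> 'n clifford" where
  "spherical_quotient p q f x =
     (1/2) *\<^sub>R (cinverse (part_q p q x) * (f x - f (part_p p x - part_q p q x)))"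

definition spherical_derivative ::
    "nat \<Rightarrow> nat \<Rightarrow> 'n::finite clifford set \<Rightarrow> ('n clifford \<Rightarrow> 'n clifford) \<Rightarrow> 'n clifford \<Rightarrow> 'n clifford" where
  "spherical_derivative p q \<Omega> f x =
     (if part_q p q x \<noteq> 0 then spherical_quotient p q f x
      else Lim (at x within {y \<in> \<Omega>. part_q p q y \<noteq> 0}) (spherical_quotient p q f))"

end

theory Submission
  imports Defs
begin

text \<open>
  The stem functions \<open>F\<^sub>1\<close>, \<open>F\<^sub>2\<close> solve a first-order system that factorizes the Laplacian of \<open>\<real>\<^sup>p\<^sup>+\<^sup>2\<close>;
  tested against radial kernels this gives a mean value property for \<open>C\<^sup>1\<close> solutions, so they are
  smooth and harmonic.  By parity \<open>A = F\<^sub>1\<close> and \<open>B = F\<^sub>2 / r\<close> are smooth and even in \<open>r\<close>, hence \<open>f = A + x\<^sub>q B\<close> and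
  \<open>f\<^sub>s = B\<close> (evaluated at \<open>(x\<^sub>p, |x\<^sub>q|)\<close>) are smooth across \<open>x\<^sub>q = 0\<close>, and a direct computation gives \<open>D f = (1 - q) B\<close>.

  Let \<open>S = (1/r) \<partial>\<^sub>r\<close> and \<open>L\<^sub>a = \<Delta> + a S\<close> on \<open>\<real>\<^sup>p\<^sup>+\<^sup>2\<close>.  The Laplacian of \<open>\<real>\<^sup>p\<^sup>+\<^sup>q\<^sup>+\<^sup>1\<close> acts on functions of \<open>(x\<^sub>p, |x\<^sub>q|)\<close> as
  \<open>L\<^sub>q\<^sub>-\<^sub>1\<close>, harmonicity of \<open>F\<^sub>2\<close> says \<open>L\<^sub>2 B = 0\<close>, and \<open>S L\<^sub>a = L\<^sub>a\<^sub>+\<^sub>2 S\<close>.  Hence the \<open>j\<close>-th iterated Laplacian of \<open>B\<close> is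
  \<open>(q - 3) (q - 5) \<cdots> (q - 1 - 2 j) S\<^sup>j B\<close>, which vanishes for \<open>j = (q - 1) / 2 > 0\<close>.  Finally \<open>D\<close> commutes with the
  Laplacian, which is \<open>D\<close> followed by its conjugate operator.
\<close>

section \<open>Functions with iterated directional derivatives\<close>

text \<open>Three obstacles shape the proof. The stem functions are only C1, so the second
  derivatives that would show harmonicity do not exist at the start; first moments of the first
  derivatives take their place, because integration by parts makes them symmetric. At r = 0 the norm
  |x_q| is not differentiable and B is a quotient by r. Evenness in r is therefore carried along as
  an invariant: the x_p derivatives and S preserve it, and it makes functions of |x_q| smooth.
  Partial derivatives are taken in the whole Clifford algebra, where the paravectors in general have
  empty interior. Analysis is done on open extensions of D and Omega; on Omega itself only stability
  under small steps along the coordinate directions is available, and \<open>dir_open\<close>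
  records it. The index 2 in L_2 B = 0 comes from d_r d_r (r B) = r d_r d_r B + 2 d_r B. Since q is
  odd, a factor q - 3 - 2 k is zero once q >= 3; for q = 1 the product is empty and 1 - q vanishes
  instead.\<close>

definition dir_open :: "'a::real_normed_vector set \<Rightarrow> 'a set \<Rightarrow> bool" where
  "dir_open B S \<longleftrightarrow> (\<forall>x\<in>S. \<forall>v\<in>B. \<forall>\<^sub>F t in at 0. x + t *\<^sub>R v \<in> S)"

text \<open>A relation, since \<open>partial\<close> is total and its value alone does not say that
  the derivative exists. The calculus rules are proved for the relation and read off for
  \<open>partial\<close> afterwards.\<close>

definition has_partial ::
    "'a::real_normed_vector \<Rightarrow> ('a \<Rightarrow> 'b::real_normed_vector) \<Rightarrow> 'a \<Rightarrow> 'b \<Rightarrow> bool" where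
  "has_partial v f x d \<longleftrightarrow> ((\<lambda>t. f (x + t *\<^sub>R v)) has_vector_derivative d) (at 0)"

definition smooth_on ::
    "'a::real_normed_vector set \<Rightarrow> 'a set \<Rightarrow> ('a \<Rightarrow> 'b::real_normed_vector) \<Rightarrow> bool" where
  "smooth_on B S f \<longleftrightarrow> (\<forall>k. Ck_on k B S f)"

lemma dir_open_open: "open S \<Longrightarrow> dir_open B S"
proof (unfold dir_open_def, intro ballI)
  fix x v assume "open S" "x \<in> S"
  have "((\<lambda>t. x + t *\<^sub>R v) \<longlongrightarrow> x + 0 *\<^sub>R v) (at 0)"
    by (intro tendsto_intros)
  then show "\<forall>\<^sub>F t in at 0. x + t *\<^sub>R v \<in> S"
    using \<open>open S\<close> \<open>x \<in> S\<close> by (auto dest: topological_tendstoD)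
qed

lemma has_partial_imp_partial: "has_partial v f x d \<Longrightarrow> partial v f x = d"
  unfolding has_partial_def partial_def by (rule vector_derivative_at)

lemma has_partial_partial_iff:
  "has_partial v f x (partial v f x) \<longleftrightarrow> (\<lambda>t. f (x + t *\<^sub>R v)) differentiable (at 0)"
  unfolding has_partial_def partial_def by (rule vector_derivative_works[symmetric])

text \<open>Shifting the parameter turns derivatives at the points of a line into ordinary
  derivatives of one curve, the form that the fundamental theorem and Leibniz' rule expect.\<close>

lemma has_partial_at:
  "has_partial v f (x + s *\<^sub>R v) d \<longleftrightarrow> ((\<lambda>t. f (x + t *\<^sub>R v)) has_vector_derivative d) (at s)"
proof
  assume "has_partial v f (x + s *\<^sub>R v) d"
  then have "((\<lambda>t. f (x + s *\<^sub>R v + t *\<^sub>R v)) has_vector_derivative d) (at (- s + s))"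
    by (simp add: has_partial_def)
  then have "(((\<lambda>t. f (x + s *\<^sub>R v + t *\<^sub>R v)) \<circ> (\<lambda>t. - s + t)) has_vector_derivative 1 *\<^sub>R d) (at s)"
    by (intro vector_diff_chain_at) (auto intro!: derivative_eq_intros)
  then show "((\<lambda>t. f (x + t *\<^sub>R v)) has_vector_derivative d) (at s)"
    by (simp add: o_def algebra_simps)
next
  assume "((\<lambda>t. f (x + t *\<^sub>R v)) has_vector_derivative d) (at s)"
  then have "((\<lambda>t. f (x + t *\<^sub>R v)) has_vector_derivative d) (at (s + 0))" by simp
  then have "(((\<lambda>t. f (x + t *\<^sub>R v)) \<circ> (\<lambda>t. s + t)) has_vector_derivative 1 *\<^sub>R d) (at 0)"
    by (intro vector_diff_chain_at) (auto intro!: derivative_eq_intros)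
  then show "has_partial v f (x + s *\<^sub>R v) d"
    by (simp add: o_def has_partial_def algebra_simps)
qed

lemma has_partial_cong:
  assumes "dir_open B S" "x \<in> S" "v \<in> B" "\<And>y. y \<in> S \<Longrightarrow> f y = g y"
  shows "has_partial v f x d \<longleftrightarrow> has_partial v g x d"
proof -
  have "\<forall>\<^sub>F t in at 0. f (x + t *\<^sub>R v) = g (x + t *\<^sub>R v)"
    by (rule eventually_mono[of "\<lambda>t. x + t *\<^sub>R v \<in> S"])
      (use assms in \<open>auto simp: dir_open_def\<close>)
  then show ?thesis
    unfolding has_partial_def using assms by (intro has_vector_derivative_cong_ev)
      (auto simp: eventually_at_filter elim!: eventually_mono)
qed

text \<open>Both sides apply the choice operator of \<open>vector_derivative\<close> to the same
  predicate, so they agree even where no derivative exists.\<close>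

lemma partial_cong:
  assumes "dir_open B S" "x \<in> S" "v \<in> B" "\<And>y. y \<in> S \<Longrightarrow> f y = g y"
  shows "partial v f x = partial v g x"
  using has_partial_cong[where f = f and g = g, OF assms]
  unfolding has_partial_def partial_def vector_derivative_def by simp

lemma Ck_on_cong:
  assumes "dir_open B S" "\<And>y. y \<in> S \<Longrightarrow> f y = g y"
  shows "Ck_on k B S f \<longleftrightarrow> Ck_on k B S g"
  using assms(2)
proof (induction k arbitrary: f g)
  case 0
  then show ?case by (simp cong: continuous_on_cong)
next
  case (Suc k)
  have eq: "partial v f x = partial v g x" if "v \<in> B" "x \<in> S" for v x
    using partial_cong[OF assms(1) that(2,1) Suc.prems] .
  have "Ck_on k B S (partial v f) \<longleftrightarrow> Ck_on k B S (partial v g)" if "v \<in> B" for v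
    using Suc.IH eq that by blast
  moreover have "(\<lambda>t. f (x + t *\<^sub>R v)) differentiable (at 0) \<longleftrightarrow>
      (\<lambda>t. g (x + t *\<^sub>R v)) differentiable (at 0)" if "v \<in> B" "x \<in> S" for v x
    unfolding has_partial_partial_iff[symmetric] eq[OF that]
    using has_partial_cong[OF assms(1) that(2,1) Suc.prems] .
  ultimately show ?case
    using Suc.prems by (auto cong: continuous_on_cong)
qed

lemma Ck_on_continuous: "Ck_on k B S f \<Longrightarrow> continuous_on S f"
  by (cases k) auto

text \<open>Candidate derivatives \<open>g v\<close> need to agree with \<open>partial v f\<close>
  only on \<open>S\<close>; \<open>dir_open\<close> makes that enough for all higher
  derivatives.\<close>

lemma Ck_on_SucI:
  assumes "dir_open B S" "continuous_on S f"
    and "\<And>v. v \<in> B \<Longrightarrow> (\<forall>x\<in>S. has_partial v f x (g v x)) \<and> Ck_on k B S (g v)"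
  shows "Ck_on (Suc k) B S f"
proof -
  have "partial v f x = g v x" "(\<lambda>t. f (x + t *\<^sub>R v)) differentiable (at 0)" if "v \<in> B" "x \<in> S" for v x
    using assms(3)[OF that(1)] that(2) has_partial_imp_partial
    unfolding has_partial_def by (blast intro: differentiableI_vector)+
  moreover have "Ck_on k B S (partial v f)" if "v \<in> B" for v
    using Ck_on_cong[OF assms(1), of "partial v f" "g v"] calculation(1) that assms(3) by blast
  ultimately show ?thesis using assms(2) by simp
qed

lemma Ck_on_SucD:
  assumes "Ck_on (Suc k) B S f" "v \<in> B"
  shows "Ck_on k B S (partial v f)" "x \<in> S \<Longrightarrow> has_partial v f x (partial v f x)"
  using assms by (auto simp: has_partial_partial_iff)

lemma Ck_on_Suc_imp: "Ck_on (Suc k) B S f \<Longrightarrow> Ck_on k B S f"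
proof (induction k arbitrary: f)
  case (Suc k)
  then show ?case
    by (simp del: Ck_on.simps(2) add: Ck_on.simps(2)[of "Suc k"]) (simp add: Suc.IH)
qed simp

lemma smooth_on_imp_Ck: "smooth_on B S f \<Longrightarrow> Ck_on k B S f"
  by (simp add: smooth_on_def)

lemma smooth_on_continuous: "smooth_on B S f \<Longrightarrow> continuous_on S f"
  by (metis smooth_on_def Ck_on_continuous)

lemma smooth_on_partial: "smooth_on B S f \<Longrightarrow> v \<in> B \<Longrightarrow> smooth_on B S (partial v f)"
  by (metis smooth_on_def Ck_on_SucD(1))

lemma smooth_on_has_partial:
  "smooth_on B S f \<Longrightarrow> v \<in> B \<Longrightarrow> x \<in> S \<Longrightarrow> has_partial v f x (partial v f x)"
  by (metis smooth_on_def Ck_on_SucD(2))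

lemma smooth_on_cong:
  assumes "dir_open B S" "\<And>y. y \<in> S \<Longrightarrow> f y = g y"
  shows "smooth_on B S f \<longleftrightarrow> smooth_on B S g"
  using Ck_on_cong[OF assms] by (simp add: smooth_on_def)

text \<open>Induction on the order, since a derivative of a member is again a member. It turns the
  closure of the mean value property under differentiation into smoothness.\<close>

lemma smooth_on_coinduct:
  assumes "dir_open B S" "f \<in> \<C>"
    and "\<And>f. f \<in> \<C> \<Longrightarrow> continuous_on S f"
    and "\<And>f v. f \<in> \<C> \<Longrightarrow> v \<in> B \<Longrightarrow> \<exists>g\<in>\<C>. \<forall>x\<in>S. has_partial v f x (g x)"
  shows "smooth_on B S f"
proof -
  have "Ck_on k B S f" if "f \<in> \<C>" for k f
    using that
  proof (induction k arbitrary: f)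
    case (Suc k)
    from assms(4)[OF Suc.prems] obtain g where
      "\<And>v. v \<in> B \<Longrightarrow> g v \<in> \<C> \<and> (\<forall>x\<in>S. has_partial v f x (g v x))" by metis
    then show ?case
      using Suc assms(1,3) by (intro Ck_on_SucI[where g = g]) auto
  qed (simp add: assms(3))
  then show ?thesis using assms(2) by (simp add: smooth_on_def)
qed

lemma Ck_on_local:
  assumes "\<And>x. x \<in> S \<Longrightarrow> \<exists>T. open T \<and> x \<in> T \<and> T \<subseteq> S \<and> Ck_on k B T f"
  shows "Ck_on k B S f"
  using assms
proof (induction k arbitrary: f)
  case 0
  then have "continuous (at x) f" if "x \<in> S" for x
    using that by (metis Ck_on.simps(1) continuous_on_eq_continuous_at)
  then show ?case by (simp add: continuous_at_imp_continuous_on)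
next
  case (Suc k)
  have "continuous (at x) f" if "x \<in> S" for x
    using that Suc.prems[OF that] by (metis Ck_on_continuous continuous_on_eq_continuous_at)
  then have "continuous_on S f" by (simp add: continuous_at_imp_continuous_on)
  moreover have "Ck_on k B S (partial v f)" if "v \<in> B" for v
    by (rule Suc.IH) (metis that Suc.prems Ck_on.simps(2))
  ultimately show ?case
    using Suc.prems by (metis Ck_on.simps(2))
qed

lemma smooth_on_local:
  assumes "\<And>x. x \<in> S \<Longrightarrow> \<exists>T. open T \<and> x \<in> T \<and> T \<subseteq> S \<and> smooth_on B T f"
  shows "smooth_on B S f"
  unfolding smooth_on_def using assms by (intro allI Ck_on_local) (metis smooth_on_def)

lemma Ck_on_subset: "Ck_on k B S f \<Longrightarrow> T \<subseteq> S \<Longrightarrow> A \<subseteq> B \<Longrightarrow> Ck_on k A T f"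
proof (induction k arbitrary: f)
  case (Suc k)
  then show ?case by (simp add: subset_iff) (meson continuous_on_subset subsetI)
qed (auto intro: continuous_on_subset)

lemma smooth_on_subset: "smooth_on B S f \<Longrightarrow> T \<subseteq> S \<Longrightarrow> A \<subseteq> B \<Longrightarrow> smooth_on A T f"
  unfolding smooth_on_def by (blast intro: Ck_on_subset)

lemma has_partial_add:
  "has_partial v f x d \<Longrightarrow> has_partial v g x e \<Longrightarrow> has_partial v (\<lambda>x. f x + g x) x (d + e)"
  unfolding has_partial_def by (rule has_vector_derivative_add)

lemma has_partial_sum:
  "(\<And>i. i \<in> I \<Longrightarrow> has_partial v (f i) x (d i)) \<Longrightarrow>
    has_partial v (\<lambda>x. \<Sum>i\<in>I. f i x) x (\<Sum>i\<in>I. d i)"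
  unfolding has_partial_def by (rule has_vector_derivative_sum)

lemma has_partial_linear:
  "bounded_linear h \<Longrightarrow> has_partial v f x d \<Longrightarrow> has_partial v (\<lambda>x. h (f x)) x (h d)"
  unfolding has_partial_def by (rule bounded_linear.has_vector_derivative)

lemma has_partial_bilinear:
  "bounded_bilinear h \<Longrightarrow> has_partial v f x d \<Longrightarrow> has_partial v g x e \<Longrightarrow>
    has_partial v (\<lambda>x. h (f x) (g x)) x (h (f x) e + h d (g x))"
  unfolding has_partial_def
  using bounded_bilinear.has_vector_derivative[of h "\<lambda>t. f (x + t *\<^sub>R v)" d 0 UNIV "\<lambda>t. g (x + t *\<^sub>R v)" e]
  by simp

lemma Ck_on_add:
  assumes "dir_open B S" "Ck_on k B S f" "Ck_on k B S g"
  shows "Ck_on k B S (\<lambda>x. f x + g x)"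
  using assms(2,3)
proof (induction k arbitrary: f g)
  case (Suc k)
  show ?case
  proof (rule Ck_on_SucI[OF assms(1), where g = "\<lambda>v x. partial v f x + partial v g x"])
    show "continuous_on S (\<lambda>x. f x + g x)"
      using Suc.prems by (auto intro: continuous_on_add)
    fix v assume "v \<in> B"
    then show "(\<forall>x\<in>S. has_partial v (\<lambda>x. f x + g x) x (partial v f x + partial v g x)) \<and>
        Ck_on k B S (\<lambda>x. partial v f x + partial v g x)"
      using Ck_on_SucD[OF Suc.prems(1)] Ck_on_SucD[OF Suc.prems(2)] by (auto intro: Suc.IH has_partial_add)
  qed
qed (simp add: continuous_on_add)

lemma Ck_on_linear:
  assumes "dir_open B S" "bounded_linear h" "Ck_on k B S f"
  shows "Ck_on k B S (\<lambda>x. h (f x))"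
  using assms(3)
proof (induction k arbitrary: f)
  case 0
  then show ?case using assms(2) by (simp add: bounded_linear.continuous_on)
next
  case (Suc k)
  show ?case
  proof (rule Ck_on_SucI[OF assms(1), where g = "\<lambda>v x. h (partial v f x)"])
    show "continuous_on S (\<lambda>x. h (f x))"
      using Suc.prems assms(2) by (auto intro: bounded_linear.continuous_on)
    fix v assume "v \<in> B"
    then show "(\<forall>x\<in>S. has_partial v (\<lambda>x. h (f x)) x (h (partial v f x))) \<and>
        Ck_on k B S (\<lambda>x. h (partial v f x))"
      using Ck_on_SucD[OF Suc.prems] by (auto intro: Suc.IH has_partial_linear[OF assms(2)])
  qed
qed

lemma Ck_on_bilinear:
  assumes "dir_open B S" "bounded_bilinear h" "Ck_on k B S f" "Ck_on k B S g"
  shows "Ck_on k B S (\<lambda>x. h (f x) (g x))"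
  using assms(3,4)
proof (induction k arbitrary: f g)
  case 0
  then show ?case using assms(2) by (simp add: bounded_bilinear.continuous_on)
next
  case (Suc k)
  show ?case
  proof (rule Ck_on_SucI[OF assms(1), where g = "\<lambda>v x. h (f x) (partial v g x) + h (partial v f x) (g x)"])
    show "continuous_on S (\<lambda>x. h (f x) (g x))"
      using Suc.prems assms(2) by (auto intro: bounded_bilinear.continuous_on)
    fix v assume "v \<in> B"
    have "Ck_on k B S f" "Ck_on k B S g"
      using Suc.prems Ck_on_Suc_imp by blast+
    then show "(\<forall>x\<in>S. has_partial v (\<lambda>x. h (f x) (g x)) x (h (f x) (partial v g x) + h (partial v f x) (g x))) \<and>
      Ck_on k B S (\<lambda>x. h (f x) (partial v g x) + h (partial v f x) (g x))"
      using Ck_on_SucD[OF Suc.prems(1) \<open>v \<in> B\<close>] Ck_on_SucD[OF Suc.prems(2) \<open>v \<in> B\<close>]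
      by (auto intro!: has_partial_bilinear[OF assms(2)] Ck_on_add[OF assms(1)] Suc.IH)
  qed
qed

lemma Ck_on_const: "Ck_on k B S (\<lambda>x. c)"
proof (induction k arbitrary: c)
  case (Suc k)
  have "partial v (\<lambda>x. c) = (\<lambda>x. 0)" for v :: 'a
    by (rule ext, rule has_partial_imp_partial) (simp add: has_partial_def)
  then show ?case using Suc by simp
qed simp

lemma Ck_on_bounded_linear:
  assumes "dir_open B S" "bounded_linear h"
  shows "Ck_on k B S h"
proof (cases k)
  case 0
  then show ?thesis using linear_continuous_on[OF assms(2)] by simp
next
  case (Suc m)
  interpret bounded_linear h by fact
  have "has_partial v h x (h v)" for v x
  proof -
    have "((\<lambda>t. h x + t *\<^sub>R h v) has_vector_derivative h v) (at 0)"
      by (auto intro!: derivative_eq_intros)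
    then show ?thesis by (simp add: has_partial_def add scaleR)
  qed
  then show ?thesis unfolding Suc
    using linear_continuous_on[OF assms(2)]
    by (intro Ck_on_SucI[OF assms(1), where g = "\<lambda>v x. h v"]) (auto intro: Ck_on_const)
qed

lemma Ck_on_sum:
  assumes "dir_open B S" "\<And>i. i \<in> I \<Longrightarrow> Ck_on k B S (f i)"
  shows "Ck_on k B S (\<lambda>x. \<Sum>i\<in>I. f i x)"
  using assms(2)
  by (induction I rule: infinite_finite_induct) (auto intro: Ck_on_const Ck_on_add[OF assms(1)])

lemma smooth_on_sum:
  assumes "dir_open B S" "\<And>i. i \<in> I \<Longrightarrow> smooth_on B S (f i)"
  shows "smooth_on B S (\<lambda>x. \<Sum>i\<in>I. f i x)"
  unfolding smooth_on_def by (intro allI Ck_on_sum[OF assms(1)] smooth_on_imp_Ck assms(2))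

lemma smooth_on_add:
  assumes "dir_open B S" "smooth_on B S f" "smooth_on B S g"
  shows "smooth_on B S (\<lambda>x. f x + g x)"
  using assms Ck_on_add unfolding smooth_on_def by blast

lemma smooth_on_linear:
  assumes "dir_open B S" "bounded_linear h" "smooth_on B S f"
  shows "smooth_on B S (\<lambda>x. h (f x))"
  using assms Ck_on_linear unfolding smooth_on_def by blast

lemma smooth_on_bilinear:
  assumes "dir_open B S" "bounded_bilinear h" "smooth_on B S f" "smooth_on B S g"
  shows "smooth_on B S (\<lambda>x. h (f x) (g x))"
  using assms Ck_on_bilinear unfolding smooth_on_def by blast

lemma smooth_on_bounded_linear: "dir_open B S \<Longrightarrow> bounded_linear h \<Longrightarrow> smooth_on B S h"
  by (simp add: smooth_on_def Ck_on_bounded_linear)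

text \<open>Integrating \<open>\<partial>\<^sub>v f\<close> along \<open>v\<close> and differentiating in the direction \<open>w\<close> under the integral.\<close>

lemma partial_commute:
  fixes f :: "'a::real_normed_vector \<Rightarrow> 'b::banach"
  assumes "open S" "x \<in> S" "smooth_on B S f" "v \<in> B" "w \<in> B"
  shows "partial v (partial w f) x = partial w (partial v f) x"
proof -
  let ?h = "\<lambda>(s, t). x + s *\<^sub>R v + t *\<^sub>R w"
  have conth: "continuous_on UNIV ?h"
    by (auto simp: split_beta intro!: continuous_intros)
  then have "open (?h -` S)"
    using \<open>open S\<close> by (auto intro: open_vimage)
  moreover have "(0, 0) \<in> ?h -` S" using \<open>x \<in> S\<close> by simp
  ultimately obtain e where "e > 0" and e: "ball (0, 0) e \<subseteq> ?h -` S"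
    using open_contains_ball by metis
  define d where "d = e / 2"
  have "d > 0" using \<open>e > 0\<close> by (simp add: d_def)
  have inS: "x + s *\<^sub>R v + t *\<^sub>R w \<in> S" if "\<bar>s\<bar> < d" "\<bar>t\<bar> < d" for s t
  proof -
    have "norm (s, t) \<le> \<bar>s\<bar> + \<bar>t\<bar>" using norm_Pair_le[of s t] by simp
    then have "norm (s, t) < e" using that by (simp add: d_def)
    then have "(s, t) \<in> ball (0, 0) e" using norm_minus_cancel[of "(s, t)"] by (simp add: dist_norm)
    then show ?thesis using e by auto
  qed
  \<comment> \<open>Integration along \<open>v\<close> starts at \<open>-c\<close> rather than at 0,
    so that 0 is interior to \<open>{-c..c}\<close> and a two-sided derivative at
    \<open>s = 0\<close> results.\<close>
  define c where "c = d / 2"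
  have c: "0 < c" "c < d" using \<open>d > 0\<close> by (auto simp: c_def)
  have Pv: "smooth_on B S (partial v f)" and Pw: "smooth_on B S (partial w f)"
    and Pwv: "smooth_on B S (partial w (partial v f))"
    using assms smooth_on_partial by blast+
  have main: "partial w f (x + s *\<^sub>R v) = partial w f (x - c *\<^sub>R v) +
      integral {-c..s} (\<lambda>\<sigma>. partial w (partial v f) (x + \<sigma> *\<^sub>R v))" if s: "-c \<le> s" "s < d" for s
  proof -
    let ?f = "\<lambda>t \<sigma>. partial v f (x + \<sigma> *\<^sub>R v + t *\<^sub>R w)"
    have contv: "continuous_on ({-d<..<d} \<times> {-c..s}) (\<lambda>(t, \<sigma>). g (x + \<sigma> *\<^sub>R v + t *\<^sub>R w))"
      if "smooth_on B S g" for g :: "'a \<Rightarrow> 'b"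
      unfolding split_beta
      by (rule continuous_on_compose2[OF smooth_on_continuous[OF that]])
        (use s c in \<open>auto intro!: continuous_intros inS\<close>)
    have cont1: "continuous_on {-c..s} (?f t)" if "\<bar>t\<bar> < d" for t
      by (rule continuous_on_compose2[OF smooth_on_continuous[OF Pv]])
        (use s c that in \<open>auto intro!: continuous_intros inS\<close>)
    have ftc: "f (x + s *\<^sub>R v + t *\<^sub>R w) = f (x - c *\<^sub>R v + t *\<^sub>R w) + integral {-c..s} (?f t)"
      if "\<bar>t\<bar> < d" for t
    proof -
      have "((\<lambda>\<sigma>. f (x + \<sigma> *\<^sub>R v + t *\<^sub>R w)) has_vector_derivative ?f t \<sigma>) (at \<sigma> within {-c..s})"
        if "\<sigma> \<in> {-c..s}" for \<sigma>
      proof -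
        have "x + \<sigma> *\<^sub>R v + t *\<^sub>R w \<in> S" using that \<open>\<bar>t\<bar> < d\<close> s c by (intro inS) auto
        then have "has_partial v f ((x + t *\<^sub>R w) + \<sigma> *\<^sub>R v) (?f t \<sigma>)"
          using smooth_on_has_partial[OF assms(3,4)] by (simp add: algebra_simps)
        then show ?thesis
          unfolding has_partial_at by (simp add: algebra_simps has_vector_derivative_at_within)
      qed
      then have "(?f t has_integral (f (x + s *\<^sub>R v + t *\<^sub>R w) - f (x + (-c) *\<^sub>R v + t *\<^sub>R w))) {-c..s}"
        using s by (intro fundamental_theorem_of_calculus) auto
      then show ?thesis by (simp add: integral_unique)
    qed
    have "((\<lambda>t. integral (cbox (-c) s) (?f t)) has_vector_derivative
        integral (cbox (-c) s) (\<lambda>\<sigma>. partial w (partial v f) (x + \<sigma> *\<^sub>R v + 0 *\<^sub>R w))) (at 0 within {-d<..<d})"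
    proof (rule leibniz_rule_vector_derivative)
      fix t \<sigma> assume *: "t \<in> {-d<..<d}" "\<sigma> \<in> cbox (-c) s"
      then have "x + \<sigma> *\<^sub>R v + t *\<^sub>R w \<in> S" using s c by (intro inS) auto
      then have "has_partial w (partial v f) ((x + \<sigma> *\<^sub>R v) + t *\<^sub>R w) (partial w (partial v f) (x + \<sigma> *\<^sub>R v + t *\<^sub>R w))"
        using smooth_on_has_partial[OF Pv assms(5)] by simp
      then show "((\<lambda>t. ?f t \<sigma>) has_vector_derivative partial w (partial v f) (x + \<sigma> *\<^sub>R v + t *\<^sub>R w)) (at t within {-d<..<d})"
        unfolding has_partial_at by (simp add: has_vector_derivative_at_within)
    next
      show "?f t integrable_on cbox (-c) s" if "t \<in> {-d<..<d}" for t
        using cont1[of t] that by (simp add: integrable_continuous_real abs_less_iff)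
    qed (use contv[OF Pwv] \<open>d > 0\<close> in auto)
    moreover have "((\<lambda>t. f (x - c *\<^sub>R v + t *\<^sub>R w)) has_vector_derivative partial w f (x - c *\<^sub>R v)) (at 0 within {-d<..<d})"
    proof -
      have "x - c *\<^sub>R v \<in> S" using inS[of "-c" 0] c by simp
      then show ?thesis using smooth_on_has_partial[OF assms(3,5)]
        unfolding has_partial_def by (simp add: has_vector_derivative_at_within)
    qed
    ultimately have "((\<lambda>t. f (x - c *\<^sub>R v + t *\<^sub>R w) + integral {-c..s} (?f t)) has_vector_derivative
        partial w f (x - c *\<^sub>R v) + integral {-c..s} (\<lambda>\<sigma>. partial w (partial v f) (x + \<sigma> *\<^sub>R v)))
        (at 0 within {-d<..<d})"
      by (intro has_vector_derivative_add) simp_all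
    then have "((\<lambda>t. f (x + s *\<^sub>R v + t *\<^sub>R w)) has_vector_derivative
        partial w f (x - c *\<^sub>R v) + integral {-c..s} (\<lambda>\<sigma>. partial w (partial v f) (x + \<sigma> *\<^sub>R v)))
        (at 0 within {-d<..<d})"
    proof (rule has_vector_derivative_transform[rotated 2])
      show "f (x + s *\<^sub>R v + t *\<^sub>R w) = f (x - c *\<^sub>R v + t *\<^sub>R w) + integral {-c..s} (?f t)"
        if "t \<in> {-d<..<d}" for t
        by (rule ftc) (use that in \<open>simp add: abs_less_iff\<close>)
    qed (use \<open>d > 0\<close> in simp)
    then have "has_partial w f (x + s *\<^sub>R v)
        (partial w f (x - c *\<^sub>R v) + integral {-c..s} (\<lambda>\<sigma>. partial w (partial v f) (x + \<sigma> *\<^sub>R v)))"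
      unfolding has_partial_def using \<open>d > 0\<close> by (simp add: at_within_open[of "0::real" "{-d<..<d}"])
    then show ?thesis by (rule has_partial_imp_partial)
  qed
  have "((\<lambda>s. integral {-c..s} (\<lambda>\<sigma>. partial w (partial v f) (x + \<sigma> *\<^sub>R v))) has_vector_derivative
      partial w (partial v f) (x + 0 *\<^sub>R v)) (at 0 within {-c..c})"
    by (rule integral_has_vector_derivative[OF continuous_on_compose2[OF smooth_on_continuous[OF Pwv]]])
      (use c inS[of _ 0] in \<open>auto intro!: continuous_intros\<close>)
  then have "((\<lambda>s. partial w f (x - c *\<^sub>R v) + integral {-c..s} (\<lambda>\<sigma>. partial w (partial v f) (x + \<sigma> *\<^sub>R v))) has_vector_derivative
      partial w (partial v f) x) (at 0 within {-c..c})"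
    by (auto intro!: derivative_eq_intros)
  then have "((\<lambda>s. partial w f (x + s *\<^sub>R v)) has_vector_derivative partial w (partial v f) x) (at 0 within {-c..c})"
  proof (rule has_vector_derivative_transform[rotated 2])
    show "partial w f (x + s *\<^sub>R v) = partial w f (x - c *\<^sub>R v) +
        integral {-c..s} (\<lambda>\<sigma>. partial w (partial v f) (x + \<sigma> *\<^sub>R v))" if "s \<in> {-c..c}" for s
      by (rule main) (use that c in auto)
  qed (use c in simp)
  moreover have "at 0 within {-c..c} = at (0::real)"
    using c by (intro at_within_interior) auto
  ultimately have "has_partial v (partial w f) x (partial w (partial v f) x)"
    by (simp add: has_partial_def)
  then show ?thesis by (rule has_partial_imp_partial)
qed

section \<open>Mean values imply smoothness\<close>

lemma integral_UNIV_eq_cbox: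
  fixes f :: "'a::euclidean_space \<Rightarrow> 'b::banach"
  assumes "\<And>y. y \<notin> cbox a b \<Longrightarrow> f y = 0"
  shows "integral UNIV f = integral (cbox a b) f"
proof -
  have "f = (\<lambda>x. if x \<in> cbox a b then f x else 0)" using assms by auto
  then show ?thesis using integral_restrict_UNIV[of "cbox a b" f] by simp
qed

lemma cball_subset_cbox_One: "cball (0::'a::euclidean_space) R \<subseteq> cbox (- R *\<^sub>R One) (R *\<^sub>R One)"
proof
  fix y :: 'a assume "y \<in> cball 0 R"
  then have "norm y \<le> R" by simp
  then have "\<bar>y \<bullet> i\<bar> \<le> R" if "i \<in> Basis" for i
    using Basis_le_norm[OF that, of y] by linarith
  then show "y \<in> cbox (- R *\<^sub>R One) (R *\<^sub>R One)"
    by (auto simp: mem_box abs_le_iff minus_le_iff)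
qed

lemma integral_UNIV_eq_One:
  fixes f :: "'a::euclidean_space \<Rightarrow> 'b::banach"
  assumes "\<And>y. R < norm y \<Longrightarrow> f y = 0"
  shows "integral UNIV f = integral (cbox (- R *\<^sub>R One) (R *\<^sub>R One)) f"
proof (rule integral_UNIV_eq_cbox)
  fix y :: 'a assume "y \<notin> cbox (- R *\<^sub>R One) (R *\<^sub>R One)"
  then have "y \<notin> cball 0 R" using cball_subset_cbox_One by blast
  then show "f y = 0" using assms by simp
qed

lemma integrable_on_UNIV_compact_support:
  fixes f :: "'a::euclidean_space \<Rightarrow> 'b::banach"
  assumes "continuous_on UNIV f" "\<And>y. R < norm y \<Longrightarrow> f y = 0"
  shows "f integrable_on UNIV"
proof -
  let ?C = "cbox (- R *\<^sub>R One) (R *\<^sub>R One) :: 'a set"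
  have "f integrable_on ?C"
    using assms(1) by (intro integrable_continuous) (auto intro: continuous_on_subset)
  moreover have "f y = 0" if "y \<notin> ?C" for y
  proof -
    have "y \<notin> cball 0 R" using that cball_subset_cbox_One[of R] by blast
    then show ?thesis using assms(2) by simp
  qed
  then have "f = (\<lambda>x. if x \<in> ?C then f x else 0)" by auto
  ultimately show ?thesis using integrable_restrict_UNIV[of ?C f] by simp
qed

lemma integral_UNIV_translate:
  fixes f :: "'a::euclidean_space \<Rightarrow> 'b::banach"
  assumes "\<And>y. R < norm y \<Longrightarrow> f y = 0"
  shows "integral UNIV (\<lambda>y. f (y + c)) = integral UNIV f"
proof -
  let ?a = "- R *\<^sub>R One :: 'a" and ?b = "R *\<^sub>R One :: 'a"
  have supp: "f y = 0" if "y \<notin> cbox ?a ?b" for y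
  proof -
    have "y \<notin> cball 0 R" using that cball_subset_cbox_One[of R] by blast
    then show ?thesis using assms by simp
  qed
  have "y + c \<notin> cbox ?a ?b" if "y \<notin> cbox (?a - c) (?b - c)" for y
    using that by (auto simp: mem_box algebra_simps)
  then have "integral UNIV (\<lambda>y. f (y + c)) = integral (cbox (?a - c) (?b - c)) (\<lambda>y. f (y + c))"
    using supp by (intro integral_UNIV_eq_cbox) blast
  also have "\<dots> = integral (cbox ?a ?b) f" by (rule integral_shift_cbox)
  also have "\<dots> = integral UNIV f" using supp by (rule integral_UNIV_eq_cbox[symmetric])
  finally show ?thesis .
qed

text \<open>The support bound \<open>R\<close> is uniform in \<open>t\<close>, so all integrals
  reduce to one fixed box.\<close>

lemma leibniz_rule_UNIV:
  fixes g g' :: "real \<Rightarrow> 'a::euclidean_space \<Rightarrow> 'b::banach"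
  assumes "\<And>t y. t \<in> T \<Longrightarrow> ((\<lambda>t. g t y) has_vector_derivative g' t y) (at t within T)"
    and "\<And>t. t \<in> T \<Longrightarrow> continuous_on UNIV (g t)"
    and "continuous_on (T \<times> UNIV) (\<lambda>(t, y). g' t y)"
    and "\<And>t y. t \<in> T \<Longrightarrow> R < norm y \<Longrightarrow> g t y = 0 \<and> g' t y = 0"
    and "t0 \<in> T" "convex T"
  shows "((\<lambda>t. integral UNIV (g t)) has_vector_derivative integral UNIV (g' t0)) (at t0 within T)"
proof -
  let ?C = "cbox (- R *\<^sub>R One) (R *\<^sub>R One) :: 'a set"
  have "((\<lambda>t. integral ?C (g t)) has_vector_derivative integral ?C (g' t0)) (at t0 within T)"
  proof (rule leibniz_rule_vector_derivative)
    show "g t integrable_on ?C" if "t \<in> T" for t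
      by (rule integrable_continuous[OF continuous_on_subset[OF assms(2)[OF that]]]) simp
  qed (use assms in \<open>auto intro: continuous_on_subset[OF assms(3)]\<close>)
  moreover have "integral UNIV (g t) = integral ?C (g t)" "integral UNIV (g' t) = integral ?C (g' t)"
    if "t \<in> T" for t
    using assms(4)[OF that] by (blast intro: integral_UNIV_eq_One)+
  ultimately show ?thesis
    using assms(5) by (auto intro: has_vector_derivative_transform)
qed

text \<open>By translation invariance the integral of \<open>f (y + t *\<^sub>R a)\<close> is
  constant in \<open>t\<close>, and its derivative at 0 is the integral of \<open>f'\<close>. This
  is the integration by parts used below.\<close>

lemma integral_UNIV_partial_eq_0:
  fixes f f' :: "'a::euclidean_space \<Rightarrow> 'b::banach"
  assumes "\<And>y. has_partial a f y (f' y)" "continuous_on UNIV f" "continuous_on UNIV f'"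
    and "\<And>y. R < norm y \<Longrightarrow> f y = 0 \<and> f' y = 0"
  shows "integral UNIV f' = 0"
proof -
  let ?T = "{-1<..<1::real}"
  have "((\<lambda>t. integral UNIV (\<lambda>y. f (y + t *\<^sub>R a))) has_vector_derivative
      integral UNIV (\<lambda>y. f' (y + 0 *\<^sub>R a))) (at 0 within ?T)"
  proof (rule leibniz_rule_UNIV[where R = "R + norm a"])
    show "((\<lambda>t. f (y + t *\<^sub>R a)) has_vector_derivative f' (y + t *\<^sub>R a)) (at t within ?T)" for t y
      using assms(1)[of "y + t *\<^sub>R a"] unfolding has_partial_at by (rule has_vector_derivative_at_within)
    show "continuous_on UNIV (\<lambda>y. f (y + t *\<^sub>R a))" for t
      by (intro continuous_on_compose2[OF assms(2)] continuous_intros) auto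
    show "continuous_on (?T \<times> UNIV) (\<lambda>(t, y). f' (y + t *\<^sub>R a))"
      unfolding split_beta by (intro continuous_on_compose2[OF assms(3)] continuous_intros) auto
    show "f (y + t *\<^sub>R a) = 0 \<and> f' (y + t *\<^sub>R a) = 0" if "t \<in> ?T" "R + norm a < norm y" for t y
    proof -
      have "norm (t *\<^sub>R a) \<le> norm a" using that(1) by (auto simp: mult_left_le_one_le)
      moreover have "norm y \<le> norm (y + t *\<^sub>R a) + norm (t *\<^sub>R a)"
        by (metis add_diff_cancel_right' norm_triangle_sub norm_triangle_ineq4)
      ultimately show ?thesis using that(2) assms(4) by auto
    qed
  qed auto
  then have "((\<lambda>t. integral UNIV f) has_vector_derivative integral UNIV f') (at 0)"
    using integral_UNIV_translate[of R f] assms(4) by (simp add: at_within_open[of "0::real" ?T])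
  then show ?thesis
    using vector_derivative_at has_vector_derivative_const by metis
qed

text \<open>After the substitution the integral is that of \<open>K (y - x) *\<^sub>R v y\<close>,
  so the derivative falls on the kernel (whence the sign) and \<open>v\<close> has to be merely
  continuous.\<close>

lemma convolution_has_partial:
  fixes v :: "'a::euclidean_space \<Rightarrow> 'b::euclidean_space" and K K' :: "'a \<Rightarrow> real"
  assumes "\<And>y. has_partial b K y (K' y)" "continuous_on UNIV K" "continuous_on UNIV K'"
    and "\<And>y. R < norm y \<Longrightarrow> K y = 0 \<and> K' y = 0"
    and "continuous_on UNIV v"
  shows "has_partial b (\<lambda>x. integral UNIV (\<lambda>y. K y *\<^sub>R v (x + y))) x
    (- integral UNIV (\<lambda>y. K' y *\<^sub>R v (x + y)))"
proof -
  let ?T = "{-1<..<1::real}"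
  have shift: "integral UNIV (\<lambda>y. L y *\<^sub>R v (z + y)) = integral UNIV (\<lambda>y. L (y - z) *\<^sub>R v y)"
    if "\<And>y. R < norm y \<Longrightarrow> L y = 0" for L and z
    using integral_UNIV_translate[of R "\<lambda>y. L y *\<^sub>R v (z + y)" "- z"] that by simp
  have "((\<lambda>t. integral UNIV (\<lambda>y. K (y - (x + t *\<^sub>R b)) *\<^sub>R v y)) has_vector_derivative
      integral UNIV (\<lambda>y. - K' (y - (x + 0 *\<^sub>R b)) *\<^sub>R v y)) (at 0 within ?T)"
  proof (rule leibniz_rule_UNIV[where R = "R + norm x + norm b"])
    show "((\<lambda>t. K (y - (x + t *\<^sub>R b)) *\<^sub>R v y) has_vector_derivative
        - K' (y - (x + t *\<^sub>R b)) *\<^sub>R v y) (at t within ?T)" for t y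
    proof -
      have "((\<lambda>s. K ((y - x) + s *\<^sub>R b)) has_vector_derivative K' ((y - x) + (- t) *\<^sub>R b)) (at (- t))"
        using assms(1) has_partial_at by blast
      then have "((\<lambda>s. K ((y - x) + s *\<^sub>R b)) \<circ> uminus has_vector_derivative
          (-1) *\<^sub>R K' ((y - x) + (- t) *\<^sub>R b)) (at t)"
        by (intro vector_diff_chain_at) (auto intro!: derivative_eq_intros)
      then have "((\<lambda>t. K (y - (x + t *\<^sub>R b))) has_real_derivative - K' (y - (x + t *\<^sub>R b))) (at t)"
        by (simp add: o_def algebra_simps has_real_derivative_iff_has_vector_derivative)
      then have "((\<lambda>t. K (y - (x + t *\<^sub>R b)) *\<^sub>R v y) has_vector_derivative
          K (y - (x + t *\<^sub>R b)) *\<^sub>R 0 + - K' (y - (x + t *\<^sub>R b)) *\<^sub>R v y) (at t)"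
        by (intro has_vector_derivative_scaleR) (auto intro!: derivative_eq_intros)
      then show ?thesis by (simp add: has_vector_derivative_at_within)
    qed
    show "continuous_on UNIV (\<lambda>y. K (y - (x + t *\<^sub>R b)) *\<^sub>R v y)" for t
      by (intro continuous_intros assms(5) continuous_on_compose2[OF assms(2)]) auto
    show "continuous_on (?T \<times> UNIV) (\<lambda>(t, y). - K' (y - (x + t *\<^sub>R b)) *\<^sub>R v y)"
      unfolding split_beta
      by (intro continuous_intros continuous_on_compose2[OF assms(5)] continuous_on_compose2[OF assms(3)]) auto
    show "K (y - (x + t *\<^sub>R b)) *\<^sub>R v y = 0 \<and> - K' (y - (x + t *\<^sub>R b)) *\<^sub>R v y = 0"
      if "t \<in> ?T" "R + norm x + norm b < norm y" for t y
    proof -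
      have "norm (t *\<^sub>R b) \<le> norm b" using that(1) by (auto simp: mult_left_le_one_le)
      then have "norm (x + t *\<^sub>R b) \<le> norm x + norm b" using norm_triangle_ineq[of x "t *\<^sub>R b"] by linarith
      moreover have "norm y \<le> norm (y - (x + t *\<^sub>R b)) + norm (x + t *\<^sub>R b)"
        using norm_triangle_sub by (metis add.commute)
      ultimately show ?thesis using that(2) assms(4) by auto
    qed
  qed auto
  then show ?thesis
    unfolding has_partial_def using assms(4) by (simp add: shift at_within_open[of "0::real" ?T])
qed

lemma convolution_continuous:
  fixes v :: "'a::euclidean_space \<Rightarrow> 'b::euclidean_space" and K :: "'a \<Rightarrow> real"
  assumes "continuous_on UNIV K" "\<And>y. R < norm y \<Longrightarrow> K y = 0" "continuous_on UNIV v"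
  shows "continuous_on UNIV (\<lambda>x. integral UNIV (\<lambda>y. K y *\<^sub>R v (x + y)))"
proof -
  have "continuous_on UNIV (\<lambda>x. integral (cbox (- R *\<^sub>R One) (R *\<^sub>R One)) (\<lambda>y. K y *\<^sub>R v (x + y)))"
    by (rule integral_continuous_on_param) (auto simp: split_beta intro!: continuous_intros
      continuous_on_compose2[OF assms(1)] continuous_on_compose2[OF assms(3)])
  then show ?thesis
    using assms(2) by (subst integral_UNIV_eq_One[where R = R]) auto
qed

text \<open>
  A radial \<open>C\<^sup>1\<close> weight with compact support: since it is radial, \<open>y \<mapsto> mean_kernel r y *\<^sub>R y\<close> is the gradient of a
  \<open>C\<^sup>2\<close> function of compact support, and one integration by parts replaces the spherical means of harmonic functions.
\<close>

definition mean_kernel :: "real \<Rightarrow> 'a::euclidean_space \<Rightarrow> real" where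
  "mean_kernel r y = (max 0 (r\<^sup>2 - y \<bullet> y))\<^sup>2"

definition mean_kernel_deriv :: "real \<Rightarrow> 'a::euclidean_space \<Rightarrow> 'a \<Rightarrow> real" where
  "mean_kernel_deriv r b y = - 4 * (y \<bullet> b) * max 0 (r\<^sup>2 - y \<bullet> y)"

text \<open>At 0 the difference quotient is bounded by |h|. Squaring the positive part is what makes
  the kernel C1 across the sphere |y| = r.\<close>

lemma has_real_derivative_max_0_square:
  "((\<lambda>s::real. (max 0 s)\<^sup>2) has_real_derivative 2 * max 0 s) (at s)"
proof -
  consider "s > 0" | "s < 0" | "s = 0" by linarith
  then show ?thesis
  proof cases
    case 1
    have "((\<lambda>s::real. s\<^sup>2) has_real_derivative 2 * max 0 s) (at s)"
      using 1 by (auto intro!: derivative_eq_intros)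
    then show ?thesis
      by (rule DERIV_cong_ev[THEN iffD1, rotated 3])
        (use 1 eventually_nhds_in_open[of "{0<..}" s] in \<open>auto elim!: eventually_mono\<close>)
  next
    case 2
    have "((\<lambda>s::real. 0) has_real_derivative 2 * max 0 s) (at s)"
      using 2 by (auto intro!: derivative_eq_intros)
    then show ?thesis
      by (rule DERIV_cong_ev[THEN iffD1, rotated 3])
        (use 2 eventually_nhds_in_open[of "{..<0}" s] in \<open>auto elim!: eventually_mono\<close>)
  next
    case 3
    have "((\<lambda>h::real. (max 0 h)\<^sup>2 / h) \<longlongrightarrow> 0) (at 0)"
    proof (rule Lim_null_comparison)
      show "\<forall>\<^sub>F h in at 0. norm ((max 0 h)\<^sup>2 / h) \<le> \<bar>h::real\<bar>"
        by (auto simp: max_def power2_eq_square)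
    qed (intro tendsto_eq_intros refl; simp)
    then show ?thesis using 3 by (simp add: DERIV_def)
  qed
qed

lemma mean_kernel_has_partial: "has_partial b (mean_kernel r) y (mean_kernel_deriv r b y)"
proof -
  have "((\<lambda>t. (y + t *\<^sub>R b) \<bullet> (y + t *\<^sub>R b)) has_real_derivative 2 * (y \<bullet> b)) (at 0)"
    unfolding inner_add inner_scaleR_left inner_scaleR_right
    by (auto intro!: derivative_eq_intros simp: inner_commute)
  then have "((\<lambda>t. r\<^sup>2 - (y + t *\<^sub>R b) \<bullet> (y + t *\<^sub>R b)) has_real_derivative - (2 * (y \<bullet> b))) (at 0)"
    by (auto intro!: derivative_eq_intros)
  from DERIV_chain2[OF has_real_derivative_max_0_square this] show ?thesis
    by (simp add: has_partial_def mean_kernel_def mean_kernel_deriv_def has_real_derivative_iff_has_vector_derivative mult_ac)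
qed

lemma mean_kernel_zero: "0 < r \<Longrightarrow> r \<le> norm y \<Longrightarrow> mean_kernel r y = 0"
  by (simp add: mean_kernel_def dot_square_norm max_def)

lemma mean_kernel_deriv_zero: "0 < r \<Longrightarrow> r \<le> norm y \<Longrightarrow> mean_kernel_deriv r b y = 0"
  by (simp add: mean_kernel_deriv_def dot_square_norm max_def)

lemma continuous_on_mean_kernel [continuous_intros]: "continuous_on S (mean_kernel r)"
  unfolding mean_kernel_def by (intro continuous_intros)

lemma continuous_on_mean_kernel_deriv [continuous_intros]: "continuous_on S (mean_kernel_deriv r b)"
  unfolding mean_kernel_deriv_def by (intro continuous_intros)

lemma integral_mean_kernel_pos:
  assumes "0 < r"
  shows "0 < integral UNIV (mean_kernel r :: 'a::euclidean_space \<Rightarrow> real)"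
proof -
  let ?C = "cbox (- r *\<^sub>R One) (r *\<^sub>R One) :: 'a set"
  have eq: "integral UNIV (mean_kernel r :: 'a \<Rightarrow> real) = integral ?C (mean_kernel r)"
    by (intro integral_UNIV_eq_One mean_kernel_zero[OF assms less_imp_le])
  have int: "(mean_kernel r has_integral integral ?C (mean_kernel r)) ?C"
    by (intro integrable_integral integrable_continuous continuous_intros)
  have "integral ?C (mean_kernel r) \<noteq> 0"
  proof
    assume "integral ?C (mean_kernel r) = 0"
    with int have "(mean_kernel r has_integral 0) ?C" by simp
    then have "mean_kernel r (0::'a) = 0"
      by (rule has_integral_0_cbox_imp_0[rotated 2])
        (use assms in \<open>auto simp: mean_kernel_def box_ne_empty mem_box intro!: continuous_intros\<close>)
    then show False using assms by (simp add: mean_kernel_def)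
  qed
  moreover have "0 \<le> integral ?C (mean_kernel r)"
    using int by (rule has_integral_nonneg) (simp add: mean_kernel_def)
  ultimately show ?thesis using eq by simp
qed

text \<open>The ball mean value property of harmonic functions, with a radial C1 weight in place of
  the uniform one, so that the mean is differentiable in \<open>x\<close> for continuous
  \<open>u\<close>.\<close>

definition mean_value :: "'a::euclidean_space set \<Rightarrow> ('a \<Rightarrow> 'b::euclidean_space) \<Rightarrow> bool" where
  "mean_value U u \<longleftrightarrow> (\<forall>x r. 0 < r \<and> cball x r \<subseteq> U \<longrightarrow>
     integral UNIV (\<lambda>y. mean_kernel r y *\<^sub>R u (x + y)) = integral UNIV (mean_kernel r :: 'a \<Rightarrow> real) *\<^sub>R u x)"

text \<open>Locally \<open>u\<close> is its own convolution with one fixed kernel, which gives a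
  continuous derivative. Differentiating the mean value identity in its centre then gives the same
  identity for the derivative.\<close>

lemma mean_value_partial:
  fixes u :: "'a::euclidean_space \<Rightarrow> 'b::euclidean_space"
  assumes "open U" "continuous_on U u" "mean_value U u"
  shows "(\<forall>x\<in>U. has_partial b u x (partial b u x)) \<and> continuous_on U (partial b u) \<and>
    mean_value U (partial b u)"
proof -
  have loc: "\<exists>B. open B \<and> x0 \<in> B \<and> (\<forall>x\<in>B. has_partial b u x (partial b u x)) \<and> continuous_on B (partial b u)"
    if "x0 \<in> U" for x0
  proof -
    obtain d where d: "d > 0" "cball x0 d \<subseteq> U"
      using \<open>open U\<close> \<open>x0 \<in> U\<close> open_contains_cball by blast
    \<comment> \<open>Half the radius: the balls of radius \<open>e\<close> about points of
      \<open>ball x0 e\<close> stay in \<open>cball x0 (2 * e)\<close>.\<close>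
    define e where "e = d / 2"
    have e: "e > 0" "cball x0 (2 * e) \<subseteq> U" using d by (auto simp: e_def)
    define c where "c = integral UNIV (mean_kernel e :: 'a \<Rightarrow> real)"
    have "c > 0" unfolding c_def by (rule integral_mean_kernel_pos) fact
    \<comment> \<open>Tietze's theorem supplies a continuous function on the whole space, as the
      convolution lemmas require; the kernel vanishes where it may differ from \<open>u\<close>. The
      same device recurs below.\<close>
    obtain v where v: "continuous_on UNIV v" "\<And>x. x \<in> cball x0 (2 * e) \<Longrightarrow> v x = u x"
      using Tietze_unbounded[of "cball x0 (2 * e)" u UNIV] continuous_on_subset[OF assms(2) e(2)] by auto
    define V where "V x = (1 / c) *\<^sub>R integral UNIV (\<lambda>y. mean_kernel e y *\<^sub>R v (x + y))" for x
    define W where "W x = (1 / c) *\<^sub>R (- integral UNIV (\<lambda>y. mean_kernel_deriv e b y *\<^sub>R v (x + y)))" for x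
    have VW: "has_partial b V x (W x)" for x
      unfolding V_def W_def using mean_kernel_zero[OF e(1) less_imp_le] mean_kernel_deriv_zero[OF e(1) less_imp_le] v(1)
      by (intro has_partial_linear[OF bounded_linear_scaleR_right]
          convolution_has_partial[where R = e] mean_kernel_has_partial continuous_intros) auto
    have cW: "continuous_on UNIV W"
      unfolding W_def using mean_kernel_zero[OF e(1) less_imp_le] mean_kernel_deriv_zero[OF e(1) less_imp_le] v(1)
      by (intro continuous_intros convolution_continuous[where R = e]) auto
    have uV: "u x = V x" if "x \<in> ball x0 e" for x
    proof -
      have *: "x + y \<in> cball x0 (2 * e)" if "norm y \<le> e" for y
      proof -
        have "dist x0 (x + y) \<le> dist x0 x + dist x (x + y)" by (rule dist_triangle)
        then show ?thesis using that \<open>x \<in> ball x0 e\<close> by (simp add: dist_norm)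
      qed
      have "cball x e \<subseteq> U"
      proof
        fix z assume "z \<in> cball x e"
        then have "x + (z - x) \<in> cball x0 (2 * e)"
          by (intro *) (simp add: dist_norm norm_minus_commute)
        then show "z \<in> U" using e by auto
      qed
      then have "c *\<^sub>R u x = integral UNIV (\<lambda>y. mean_kernel e y *\<^sub>R u (x + y))"
        using assms(3) e(1) by (simp add: mean_value_def c_def)
      also have "\<dots> = integral UNIV (\<lambda>y. mean_kernel e y *\<^sub>R v (x + y))"
      proof -
        have "mean_kernel e y *\<^sub>R u (x + y) = mean_kernel e y *\<^sub>R v (x + y)" for y
          using v(2)[OF *] mean_kernel_zero[OF e(1), of y] by (cases "norm y \<le> e") auto
        then show ?thesis by presburger
      qed
      finally have "c *\<^sub>R u x = c *\<^sub>R V x" using \<open>c > 0\<close> by (simp add: V_def)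
      then show ?thesis using \<open>c > 0\<close> by simp
    qed
    have "has_partial b u x (W x)" if "x \<in> ball x0 e" for x
      using has_partial_cong[OF dir_open_open[OF open_ball] that, of b "{b}" u V] uV VW by auto
    then have "has_partial b u x (partial b u x) \<and> partial b u x = W x" if "x \<in> ball x0 e" for x
      using that has_partial_imp_partial by metis
    moreover from this have "continuous_on (ball x0 e) (partial b u)"
      using continuous_on_subset[OF cW subset_UNIV] continuous_on_cong[OF refl, of "ball x0 e" W "partial b u"]
      by metis
    ultimately show ?thesis using e(1) open_ball centre_in_ball by blast
  qed
  then have hp: "has_partial b u x (partial b u x)" if "x \<in> U" for x using that by blast
  have cp: "continuous_on U (partial b u)"
  proof -
    have "continuous (at x) (partial b u)" if "x \<in> U" for x
      using loc[OF that] by (metis continuous_on_eq_continuous_at)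
    then show ?thesis by (simp add: continuous_at_imp_continuous_on)
  qed
  have "mean_value U (partial b u)"
    unfolding mean_value_def
  proof (intro allI impI)
    fix x r assume xr: "0 < r \<and> cball x r \<subseteq> U"
    let ?c = "integral UNIV (mean_kernel r :: 'a \<Rightarrow> real)"
    \<comment> \<open>The centre has to move along \<open>b\<close>, so a slightly larger concentric
      ball inside \<open>U\<close> is needed.\<close>
    obtain d where d: "d > 0" "(\<Union>z\<in>cball x r. cball z d) \<subseteq> U"
      using compact_subset_open_imp_cball_epsilon_subset[of "cball x r" U] xr \<open>open U\<close> by auto
    have "cball x (r + d) \<subseteq> U"
    proof
      fix z assume z: "z \<in> cball x (r + d)"
      \<comment> \<open>The point dividing the segment from \<open>x\<close> to \<open>z\<close> in
        the ratio r : d; it is within \<open>r\<close> of \<open>x\<close> and within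
        \<open>d\<close> of \<open>z\<close>.\<close>
      define y where "y = x + (r / (r + d)) *\<^sub>R (z - x)"
      have "norm (z - x) \<le> r + d" using z by (simp add: dist_norm norm_minus_commute)
      then have "r / (r + d) * norm (z - x) \<le> r" "d / (r + d) * norm (z - x) \<le> d"
        using xr d(1) mult_left_mono[of "norm (z - x)" "r + d" r] mult_left_mono[of "norm (z - x)" "r + d" d]
        by (auto simp: field_simps)
      moreover have "z - y = (d / (r + d)) *\<^sub>R (z - x)"
      proof -
        have "1 - r / (r + d) = d / (r + d)" using xr d(1) by (simp add: field_simps)
        moreover have "z - y = (1 - r / (r + d)) *\<^sub>R (z - x)" by (simp add: y_def algebra_simps)
        ultimately show ?thesis by simp
      qed
      ultimately have "y \<in> cball x r" "z \<in> cball y d"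
        using xr d(1) by (auto simp: dist_norm norm_minus_commute y_def)
      then show "z \<in> U" using d(2) by blast
    qed
    obtain v where v: "continuous_on UNIV v" "\<And>z. z \<in> cball x (r + d) \<Longrightarrow> v z = u z"
      using Tietze_unbounded[of "cball x (r + d)" u UNIV] continuous_on_subset[OF assms(2) \<open>cball x (r + d) \<subseteq> U\<close>]
      by auto
    obtain w where w: "continuous_on UNIV w" "\<And>z. z \<in> cball x (r + d) \<Longrightarrow> w z = partial b u z"
      using Tietze_unbounded[of "cball x (r + d)" "partial b u" UNIV] continuous_on_subset[OF cp \<open>cball x (r + d) \<subseteq> U\<close>]
      by auto
    \<comment> \<open>Chosen so that |t b| <= d for |t| < \<delta>; the summand 1 covers b =
      0.\<close>
    define \<delta> where "\<delta> = d / (norm b + 1)"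
    have "\<delta> > 0" using d(1) by (simp add: \<delta>_def add_nonneg_pos)
    let ?T = "{-\<delta><..<\<delta>}"
    have small: "norm (t *\<^sub>R b) \<le> d" if "t \<in> ?T" for t
    proof -
      have "norm (t *\<^sub>R b) \<le> \<delta> * (norm b + 1)" unfolding norm_scaleR
        using that by (intro mult_mono) auto
      also have "\<dots> = d" using norm_ge_zero[of b] by (simp add: \<delta>_def add_nonneg_eq_0_iff)
      finally show ?thesis .
    qed
    have inB: "x + t *\<^sub>R b + y \<in> cball x (r + d)" if "t \<in> ?T" "norm y \<le> r" for t y
      using norm_triangle_ineq[of "t *\<^sub>R b" y] small[OF that(1)] that(2) norm_minus_cancel[of "t *\<^sub>R b + y"]
      by (simp add: dist_norm)
    have deriv: "((\<lambda>t. integral UNIV (\<lambda>y. mean_kernel r y *\<^sub>R v (x + t *\<^sub>R b + y))) has_vector_derivative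
        integral UNIV (\<lambda>y. mean_kernel r y *\<^sub>R w (x + 0 *\<^sub>R b + y))) (at 0 within ?T)"
    proof (rule leibniz_rule_UNIV[where R = r])
      show "((\<lambda>t. mean_kernel r y *\<^sub>R v (x + t *\<^sub>R b + y)) has_vector_derivative
          mean_kernel r y *\<^sub>R w (x + t *\<^sub>R b + y)) (at t within ?T)" if "t \<in> ?T" for t y
      proof (cases "norm y \<le> r")
        case True
        have "has_partial b u ((x + y) + t *\<^sub>R b) (partial b u ((x + y) + t *\<^sub>R b))"
          using inB[OF that True] \<open>cball x (r + d) \<subseteq> U\<close> by (intro hp) (auto simp: algebra_simps)
        then have "((\<lambda>t. u ((x + y) + t *\<^sub>R b)) has_vector_derivative w (x + t *\<^sub>R b + y)) (at t within ?T)"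
          using w(2)[OF inB[OF that True]] unfolding has_partial_at
          by (simp add: has_vector_derivative_at_within algebra_simps)
        then have "((\<lambda>t. v (x + t *\<^sub>R b + y)) has_vector_derivative w (x + t *\<^sub>R b + y)) (at t within ?T)"
          by (rule has_vector_derivative_transform[OF that, rotated])
            (use v(2)[OF inB[OF _ True]] in \<open>simp add: algebra_simps\<close>)
        then show ?thesis
          by (rule bounded_linear.has_vector_derivative[OF bounded_linear_scaleR_right])
      next
        case False
        then show ?thesis using mean_kernel_zero[of r y] xr by simp
      qed
      show "continuous_on UNIV (\<lambda>y. mean_kernel r y *\<^sub>R v (x + t *\<^sub>R b + y))" for t
        by (intro continuous_intros continuous_on_compose2[OF v(1)]) auto
      show "continuous_on (?T \<times> UNIV) (\<lambda>(t, y). mean_kernel r y *\<^sub>R w (x + t *\<^sub>R b + y))"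
        unfolding split_beta
        by (intro continuous_intros continuous_on_compose2[OF w(1)]
            continuous_on_compose2[OF continuous_on_mean_kernel[of UNIV]]) auto
    qed (use xr mean_kernel_zero[of r, OF _ less_imp_le] \<open>\<delta> > 0\<close> in auto)
    have mean: "?c *\<^sub>R u (x + t *\<^sub>R b) = integral UNIV (\<lambda>y. mean_kernel r y *\<^sub>R v (x + t *\<^sub>R b + y))" if "t \<in> ?T" for t
    proof -
      have "cball (x + t *\<^sub>R b) r \<subseteq> U"
      proof
        fix z assume "z \<in> cball (x + t *\<^sub>R b) r"
        then have "x + t *\<^sub>R b + (z - (x + t *\<^sub>R b)) \<in> cball x (r + d)"
          using that by (intro inB) (auto simp: dist_norm norm_minus_commute)
        then show "z \<in> U" using \<open>cball x (r + d) \<subseteq> U\<close> by auto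
      qed
      then have "?c *\<^sub>R u (x + t *\<^sub>R b) = integral UNIV (\<lambda>y. mean_kernel r y *\<^sub>R u (x + t *\<^sub>R b + y))"
        using assms(3) xr by (simp add: mean_value_def)
      moreover have "mean_kernel r y *\<^sub>R u (x + t *\<^sub>R b + y) = mean_kernel r y *\<^sub>R v (x + t *\<^sub>R b + y)" for y
        using v(2)[OF inB[OF that, of y]] mean_kernel_zero[of r y] xr by (cases "norm y \<le> r") auto
      ultimately show ?thesis by presburger
    qed
    have "((\<lambda>t. ?c *\<^sub>R u (x + t *\<^sub>R b)) has_vector_derivative
        integral UNIV (\<lambda>y. mean_kernel r y *\<^sub>R w (x + 0 *\<^sub>R b + y))) (at 0 within ?T)"
      by (rule has_vector_derivative_transform[OF _ mean deriv]) (use \<open>\<delta> > 0\<close> in auto)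
    then have "((\<lambda>t. ?c *\<^sub>R u (x + t *\<^sub>R b)) has_vector_derivative
        integral UNIV (\<lambda>y. mean_kernel r y *\<^sub>R w (x + y))) (at 0 within ?T)"
      by simp
    then have "has_partial b (\<lambda>x. ?c *\<^sub>R u x) x (integral UNIV (\<lambda>y. mean_kernel r y *\<^sub>R w (x + y)))"
      using \<open>\<delta> > 0\<close> by (simp add: has_partial_def at_within_open[of "0::real" ?T])
    moreover have "has_partial b (\<lambda>x. ?c *\<^sub>R u x) x (?c *\<^sub>R partial b u x)"
      using xr by (intro has_partial_linear[OF bounded_linear_scaleR_right] hp) auto
    ultimately have "integral UNIV (\<lambda>y. mean_kernel r y *\<^sub>R w (x + y)) = ?c *\<^sub>R partial b u x"
      using has_partial_imp_partial by metis
    moreover have "mean_kernel r y *\<^sub>R partial b u (x + y) = mean_kernel r y *\<^sub>R w (x + y)" for y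
      using w(2)[OF inB[of 0 y]] mean_kernel_zero[of r y] xr \<open>\<delta> > 0\<close> by (cases "norm y \<le> r") auto
    ultimately show "integral UNIV (\<lambda>y. mean_kernel r y *\<^sub>R partial b u (x + y)) = ?c *\<^sub>R partial b u x"
      by presburger
  qed
  with hp cp show ?thesis by blast
qed

lemma mean_value_smooth_on:
  fixes u :: "'a::euclidean_space \<Rightarrow> 'b::euclidean_space"
  assumes "open U" "continuous_on U u" "mean_value U u"
  shows "smooth_on B U u"
  by (rule smooth_on_coinduct[OF dir_open_open[OF assms(1)], where \<C> = "{u. continuous_on U u \<and> mean_value U u}"])
    (use assms mean_value_partial[OF assms(1)] in blast)+

section \<open>From a weak system to mean values\<close>

lemma has_partial_scaleR_dir: "has_partial v f x d \<Longrightarrow> has_partial (c *\<^sub>R v) f x (c *\<^sub>R d)"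
proof -
  assume "has_partial v f x d"
  then have "((\<lambda>t. f (x + t *\<^sub>R v)) has_vector_derivative d) (at (c * 0))"
    by (simp add: has_partial_def)
  then have "((\<lambda>t. f (x + t *\<^sub>R v)) \<circ> (\<lambda>t. c * t) has_vector_derivative c *\<^sub>R d) (at 0)"
    by (intro vector_diff_chain_at) (auto intro!: derivative_eq_intros)
  then show ?thesis by (simp add: has_partial_def o_def mult.commute)
qed

text \<open>Continuity of the derivative along \<open>w\<close> makes (s, t) -> u (x + s v + t w)
  differentiable at the origin; restricting to the diagonal gives the direction
  \<open>v + w\<close>.\<close>

lemma has_partial_add_dir:
  fixes u :: "'a::real_normed_vector \<Rightarrow> 'b::real_normed_vector"
  assumes "open U" "x \<in> U" "\<And>z. z \<in> U \<Longrightarrow> has_partial v u z (V z)"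
    "\<And>z. z \<in> U \<Longrightarrow> has_partial w u z (W z)" "continuous_on U W"
  shows "has_partial (v + w) u x (V x + W x)"
proof -
  let ?h = "\<lambda>(s, t). x + s *\<^sub>R v + t *\<^sub>R w"
  have conth: "continuous_on UNIV ?h"
    by (auto simp: split_beta intro!: continuous_intros)
  then have "open (?h -` U)"
    using \<open>open U\<close> by (auto intro: open_vimage)
  moreover have "(0, 0) \<in> ?h -` U" using \<open>x \<in> U\<close> by simp
  ultimately obtain X Y where XY: "open X" "open Y" "0 \<in> X" "0 \<in> Y" "X \<times> Y \<subseteq> ?h -` U"
    by (auto elim!: open_prod_elim)
  \<comment> \<open>The criterion for joint differentiability asks for a convex second factor, hence
    a ball inside \<open>Y\<close>.\<close>
  obtain d where d: "d > 0" "ball 0 d \<subseteq> Y" using XY(2,4) open_contains_ball by blast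
  have inU: "x + s *\<^sub>R v + t *\<^sub>R w \<in> U" if "s \<in> X" "t \<in> ball 0 d" for s t
    using subsetD[OF XY(5), of "(s, t)"] that d(2) by auto
  have "((\<lambda>(s, t). u (x + s *\<^sub>R v + t *\<^sub>R w)) has_derivative
      (\<lambda>(ts, tt). ts *\<^sub>R V x + blinfun_apply (blinfun_scaleR_left (W (x + 0 *\<^sub>R v + 0 *\<^sub>R w))) tt))
      (at (0, 0) within X \<times> ball 0 d)"
  proof (rule has_derivative_partialsI[where fx = "\<lambda>s. s *\<^sub>R V x" and
        fy = "\<lambda>s t. blinfun_scaleR_left (W (x + s *\<^sub>R v + t *\<^sub>R w))"])
    have "((\<lambda>s. u (x + s *\<^sub>R v)) has_vector_derivative V x) (at 0 within X)"
      using assms(3)[OF assms(2)] by (simp add: has_partial_def has_vector_derivative_at_within)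
    then show "((\<lambda>s. u (x + s *\<^sub>R v + 0 *\<^sub>R w)) has_derivative (\<lambda>s. s *\<^sub>R V x)) (at 0 within X)"
      by (simp add: has_vector_derivative_def)
    show "((\<lambda>t. u (x + s *\<^sub>R v + t *\<^sub>R w)) has_derivative
        blinfun_apply (blinfun_scaleR_left (W (x + s *\<^sub>R v + t *\<^sub>R w)))) (at t within ball 0 d)"
      if "s \<in> X" "t \<in> ball 0 d" for s t
    proof -
      have "has_partial w u ((x + s *\<^sub>R v) + t *\<^sub>R w) (W (x + s *\<^sub>R v + t *\<^sub>R w))"
        using assms(4)[OF inU[OF that]] .
      then have "((\<lambda>t. u (x + s *\<^sub>R v + t *\<^sub>R w)) has_vector_derivative W (x + s *\<^sub>R v + t *\<^sub>R w)) (at t)"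
        unfolding has_partial_at .
      then show ?thesis
        by (simp add: has_vector_derivative_def has_derivative_at_withinI)
    qed
    have "continuous_on (X \<times> ball 0 d) (\<lambda>(s, t). W (x + s *\<^sub>R v + t *\<^sub>R w))"
      unfolding split_beta
      by (rule continuous_on_compose2[OF assms(5)]) (auto intro!: continuous_intros inU)
    then have "continuous_on (X \<times> ball 0 d) (\<lambda>(s, t). blinfun_scaleR_left (W (x + s *\<^sub>R v + t *\<^sub>R w)))"
      unfolding split_beta by (intro continuous_intros)
    then show "continuous (at (0, 0) within X \<times> ball 0 d) (\<lambda>(s, t). blinfun_scaleR_left (W (x + s *\<^sub>R v + t *\<^sub>R w)))"
      using XY(3) d(1) by (simp add: continuous_on_eq_continuous_within)
  qed (use d(1) in auto)
  moreover have "at (0, 0) within X \<times> ball 0 d = at ((0, 0) :: real \<times> real)"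
    using XY(1,3) d(1) by (intro at_within_open open_Times) auto
  ultimately have "((\<lambda>(s, t). u (x + s *\<^sub>R v + t *\<^sub>R w)) has_derivative (\<lambda>(ts, tt). ts *\<^sub>R V x + tt *\<^sub>R W x))
      (at (0, 0))"
    by simp
  then have "((\<lambda>(s, t). u (x + s *\<^sub>R v + t *\<^sub>R w)) \<circ> (\<lambda>t. (t, t)) has_derivative
      (\<lambda>(ts, tt). ts *\<^sub>R V x + tt *\<^sub>R W x) \<circ> (\<lambda>t. (t, t))) (at 0)"
    by (intro diff_chain_at) (auto intro!: derivative_eq_intros)
  then show ?thesis
    by (simp add: has_partial_def has_vector_derivative_def o_def algebra_simps)
qed

text \<open>Needed for \<open>y\<close> expanded in the basis: the derivative along the ray through
  \<open>y\<close> is expressed by the coordinate derivatives.\<close>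

lemma has_partial_sum_dir:
  fixes u :: "'a::real_normed_vector \<Rightarrow> 'b::real_normed_vector"
  assumes "open U" "finite A" "\<And>b z. b \<in> A \<Longrightarrow> z \<in> U \<Longrightarrow> has_partial b u z (w b z)"
    "\<And>b. b \<in> A \<Longrightarrow> continuous_on U (w b)" "x \<in> U"
  shows "has_partial (\<Sum>b\<in>A. c b *\<^sub>R b) u x (\<Sum>b\<in>A. c b *\<^sub>R w b x)"
  using assms(2-5)
proof (induction A arbitrary: x rule: finite_induct)
  case empty
  then show ?case by (simp add: has_partial_def)
next
  case (insert a A)
  have "has_partial ((\<Sum>b\<in>A. c b *\<^sub>R b) + c a *\<^sub>R a) u x ((\<Sum>b\<in>A. c b *\<^sub>R w b x) + c a *\<^sub>R w a x)"
    by (rule has_partial_add_dir[OF assms(1) insert.prems(3)])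
      (use insert in \<open>auto intro!: has_partial_scaleR_dir continuous_intros\<close>)
  then show ?case using insert.hyps by (simp add: add.commute)
qed

text \<open>Differentiating the weighted means over shrinking radii gives the left-hand side of the last assumption.\<close>

lemma mean_valueI:
  fixes u :: "'a::euclidean_space \<Rightarrow> 'b::euclidean_space"
  assumes "open U" "\<And>b z. b \<in> Basis \<Longrightarrow> z \<in> U \<Longrightarrow> has_partial b u z (w b z)"
    "\<And>b. b \<in> Basis \<Longrightarrow> continuous_on U (w b)" "continuous_on U u"
    and weak: "\<And>x r \<delta>. 0 < r \<Longrightarrow> cball x r \<subseteq> U \<Longrightarrow> 0 < \<delta> \<Longrightarrow> \<delta> \<le> 1 \<Longrightarrow>
      (\<Sum>b\<in>Basis. integral UNIV (\<lambda>y. ((y \<bullet> b) * mean_kernel r y) *\<^sub>R w b (x + \<delta> *\<^sub>R y))) = 0"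
  shows "mean_value U u"
  unfolding mean_value_def
proof (intro allI impI)
  fix x r assume xr: "0 < r \<and> cball x r \<subseteq> U"
  obtain v where v: "continuous_on UNIV v" "\<And>z. z \<in> cball x r \<Longrightarrow> v z = u z"
    using Tietze_unbounded[of "cball x r" u UNIV] continuous_on_subset[OF assms(4)] xr by auto
  have "\<exists>\<omega>. continuous_on UNIV \<omega> \<and> (\<forall>z\<in>cball x r. \<omega> z = w b z)" if b: "b \<in> Basis" for b
  proof -
    have "continuous_on (cball x r) (w b)" using continuous_on_subset[OF assms(3)[OF b]] xr by blast
    then obtain g where "continuous_on UNIV g" "\<And>z. z \<in> cball x r \<Longrightarrow> g z = w b z"
      using Tietze_unbounded[of "cball x r" "w b" UNIV] by auto
    then show ?thesis by blast
  qed
  then obtain \<omega> where \<omega>: "\<And>b. b \<in> Basis \<Longrightarrow> continuous_on UNIV (\<omega> b)"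
      "\<And>b z. b \<in> Basis \<Longrightarrow> z \<in> cball x r \<Longrightarrow> \<omega> b z = w b z"
    by metis
  have inB: "x + \<delta> *\<^sub>R y \<in> cball x r" if "\<delta> \<in> {0..1}" "norm y \<le> r" for \<delta> y
  proof -
    have "\<bar>\<delta>\<bar> * norm y \<le> 1 * r" using that by (intro mult_mono) auto
    then show ?thesis by (simp add: dist_norm)
  qed
  let ?h = "\<lambda>\<delta>. integral UNIV (\<lambda>y. mean_kernel r y *\<^sub>R v (x + \<delta> *\<^sub>R y))"
  have der: "(?h has_vector_derivative
      integral UNIV (\<lambda>y. \<Sum>b\<in>Basis. ((y \<bullet> b) * mean_kernel r y) *\<^sub>R \<omega> b (x + \<delta> *\<^sub>R y))) (at \<delta> within {0..1})"
    if \<delta>: "\<delta> \<in> {0..1}" for \<delta>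
  proof (rule leibniz_rule_UNIV[where R = r])
    show "((\<lambda>t. mean_kernel r y *\<^sub>R v (x + t *\<^sub>R y)) has_vector_derivative
        (\<Sum>b\<in>Basis. ((y \<bullet> b) * mean_kernel r y) *\<^sub>R \<omega> b (x + t *\<^sub>R y))) (at t within {0..1})"
      if "t \<in> {0..1}" for t y
    proof (cases "norm y \<le> r")
      case True
      have "x + t *\<^sub>R y \<in> U" using inB[OF that True] xr by blast
      then have "has_partial (\<Sum>b\<in>Basis. (y \<bullet> b) *\<^sub>R b) u (x + t *\<^sub>R y)
          (\<Sum>b\<in>Basis. (y \<bullet> b) *\<^sub>R w b (x + t *\<^sub>R y))"
        using assms(1-3) by (intro has_partial_sum_dir[where U = U]) auto
      also have "(\<Sum>b\<in>Basis. (y \<bullet> b) *\<^sub>R w b (x + t *\<^sub>R y)) = (\<Sum>b\<in>Basis. (y \<bullet> b) *\<^sub>R \<omega> b (x + t *\<^sub>R y))"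
        using \<omega>(2)[OF _ inB[OF that True]] by simp
      finally have "((\<lambda>t. u (x + t *\<^sub>R y)) has_vector_derivative
          (\<Sum>b\<in>Basis. (y \<bullet> b) *\<^sub>R \<omega> b (x + t *\<^sub>R y))) (at t within {0..1})"
        unfolding euclidean_representation has_partial_at by (rule has_vector_derivative_at_within)
      then have "((\<lambda>t. v (x + t *\<^sub>R y)) has_vector_derivative
          (\<Sum>b\<in>Basis. (y \<bullet> b) *\<^sub>R \<omega> b (x + t *\<^sub>R y))) (at t within {0..1})"
        by (rule has_vector_derivative_transform[OF that, rotated]) (use v(2)[OF inB[OF _ True]] in simp)
      then have "((\<lambda>t. mean_kernel r y *\<^sub>R v (x + t *\<^sub>R y)) has_vector_derivative
          mean_kernel r y *\<^sub>R (\<Sum>b\<in>Basis. (y \<bullet> b) *\<^sub>R \<omega> b (x + t *\<^sub>R y))) (at t within {0..1})"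
        by (rule bounded_linear.has_vector_derivative[OF bounded_linear_scaleR_right])
      then show ?thesis by (simp add: scaleR_sum_right mult.commute)
    next
      case False
      then show ?thesis using mean_kernel_zero[of r y] xr by simp
    qed
    show "continuous_on UNIV (\<lambda>y. mean_kernel r y *\<^sub>R v (x + t *\<^sub>R y))" for t
      by (intro continuous_intros continuous_on_compose2[OF v(1)]) auto
    show "continuous_on ({0..1} \<times> UNIV) (\<lambda>(t, y). \<Sum>b\<in>Basis. ((y \<bullet> b) * mean_kernel r y) *\<^sub>R \<omega> b (x + t *\<^sub>R y))"
      unfolding split_beta
      by (intro continuous_intros continuous_on_compose2[OF \<omega>(1)]
          continuous_on_compose2[OF continuous_on_mean_kernel[of UNIV]]) auto
  qed (use xr mean_kernel_zero[of r, OF _ less_imp_le] \<delta> in auto)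
  have zero: "integral UNIV (\<lambda>y. \<Sum>b\<in>Basis. ((y \<bullet> b) * mean_kernel r y) *\<^sub>R \<omega> b (x + \<delta> *\<^sub>R y)) = 0"
    if "0 < \<delta>" "\<delta> \<le> 1" for \<delta>
  proof -
    have "integral UNIV (\<lambda>y. \<Sum>b\<in>Basis. ((y \<bullet> b) * mean_kernel r y) *\<^sub>R \<omega> b (x + \<delta> *\<^sub>R y)) =
        (\<Sum>b\<in>Basis. integral UNIV (\<lambda>y. ((y \<bullet> b) * mean_kernel r y) *\<^sub>R \<omega> b (x + \<delta> *\<^sub>R y)))"
    proof (rule integral_sum)
      show "(\<lambda>y. ((y \<bullet> b) * mean_kernel r y) *\<^sub>R \<omega> b (x + \<delta> *\<^sub>R y)) integrable_on UNIV" if "b \<in> Basis" for b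
        by (rule integrable_on_UNIV_compact_support[where R = r])
          (use xr mean_kernel_zero[of r, OF _ less_imp_le] in
            \<open>auto intro!: continuous_intros continuous_on_compose2[OF \<omega>(1)[OF that]]\<close>)
    qed simp
    also have "\<dots> = (\<Sum>b\<in>Basis. integral UNIV (\<lambda>y. ((y \<bullet> b) * mean_kernel r y) *\<^sub>R w b (x + \<delta> *\<^sub>R y)))"
    proof (rule sum.cong[OF refl])
      fix b :: 'a assume b: "b \<in> Basis"
      have "((y \<bullet> b) * mean_kernel r y) *\<^sub>R \<omega> b (x + \<delta> *\<^sub>R y) = ((y \<bullet> b) * mean_kernel r y) *\<^sub>R w b (x + \<delta> *\<^sub>R y)" for y
        using \<omega>(2)[OF b inB[of \<delta> y]] mean_kernel_zero[of r y] xr that by (cases "norm y \<le> r") auto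
      then show "integral UNIV (\<lambda>y. ((y \<bullet> b) * mean_kernel r y) *\<^sub>R \<omega> b (x + \<delta> *\<^sub>R y)) =
          integral UNIV (\<lambda>y. ((y \<bullet> b) * mean_kernel r y) *\<^sub>R w b (x + \<delta> *\<^sub>R y))" by presburger
    qed
    also have "\<dots> = 0" using weak xr that by blast
    finally show ?thesis .
  qed
  \<comment> \<open>The derivative is known to vanish only for \<delta> > 0, so 0 is the exceptional
    point and continuity there completes the argument.\<close>
  have "?h 1 = ?h 0"
  proof (rule has_derivative_zero_unique_strong_convex[where S = "{0..1}" and K = "{0::real}" and c = 0 and f = ?h])
    show "continuous_on {0..1} ?h"
      unfolding continuous_on_eq_continuous_within using has_vector_derivative_continuous[OF der] by blast
    show "(?h has_derivative (\<lambda>h. 0)) (at \<delta> within {0..1})" if "\<delta> \<in> {0..1} - {0}" for \<delta>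
      using der[of \<delta>] zero[of \<delta>] that by (simp add: has_vector_derivative_def)
  qed auto
  moreover have "?h 0 = integral UNIV (mean_kernel r :: 'a \<Rightarrow> real) *\<^sub>R u x"
  proof -
    have "(mean_kernel r :: 'a \<Rightarrow> real) integrable_on UNIV"
      by (rule integrable_on_UNIV_compact_support[where R = r])
        (use xr mean_kernel_zero[of r, OF _ less_imp_le] in \<open>auto intro!: continuous_intros\<close>)
    then have "((\<lambda>y::'a. mean_kernel r y *\<^sub>R v x) has_integral integral UNIV (mean_kernel r :: 'a \<Rightarrow> real) *\<^sub>R v x) UNIV"
      by (intro has_integral_scaleR_left integrable_integral)
    then show ?thesis using v(2)[of x] xr by (simp add: integral_unique)
  qed
  moreover have "mean_kernel r y *\<^sub>R u (x + y) = mean_kernel r y *\<^sub>R v (x + 1 *\<^sub>R y)" for y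
    using v(2)[OF inB[of 1 y]] mean_kernel_zero[of r y] xr by (cases "norm y \<le> r") auto
  then have "integral UNIV (\<lambda>y. mean_kernel r y *\<^sub>R u (x + y)) = ?h 1" by presburger
  ultimately show "integral UNIV (\<lambda>y. mean_kernel r y *\<^sub>R u (x + y)) = integral UNIV (mean_kernel r :: 'a \<Rightarrow> real) *\<^sub>R u x"
    by simp
qed

text \<open>The difference quotient is (f / t) times a bounded factor, and f vanishes to first
  order. This covers the points on and outside the sphere |y| = r, where the extension of
  \<open>u\<close> need not be differentiable.\<close>

lemma has_partial_scaleR_zero:
  fixes f :: "'a::real_normed_vector \<Rightarrow> real" and g :: "'a \<Rightarrow> 'b::real_normed_vector"
  assumes "has_partial a f y 0" "f y = 0" "continuous_on UNIV g"
  shows "has_partial a (\<lambda>y. f y *\<^sub>R g y) y 0"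
proof -
  have "((\<lambda>t. f (y + t *\<^sub>R a) / t) \<longlongrightarrow> 0) (at 0)"
    using assms(1,2) by (simp add: has_partial_def DERIV_def flip: has_real_derivative_iff_has_vector_derivative)
  moreover have "((\<lambda>t. g (y + t *\<^sub>R a)) \<longlongrightarrow> g (y + 0 *\<^sub>R a)) (at 0)"
    using assms(3) by (intro isCont_tendsto_compose[of _ g] tendsto_intros) (simp add: continuous_on_eq_continuous_at)
  ultimately have "((\<lambda>t. (f (y + t *\<^sub>R a) / t) *\<^sub>R g (y + t *\<^sub>R a)) \<longlongrightarrow> 0 *\<^sub>R g (y + 0 *\<^sub>R a)) (at 0)"
    by (rule tendsto_scaleR)
  then have "((\<lambda>t. norm ((f (y + t *\<^sub>R a) / t) *\<^sub>R g (y + t *\<^sub>R a))) \<longlongrightarrow> 0) (at 0)"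
    by (intro tendsto_norm_zero) simp
  then show ?thesis
    using assms(2) by (simp add: has_partial_def has_vector_derivative_def has_derivative_iff_norm divide_simps)
qed

text \<open>Integration by parts moves d_a to the weight
  \<open>(y \<bullet> b) * mean_kernel r y\<close>. As the kernel is radial, its derivative along
  \<open>a\<close> is y . a times a radial function, so the differentiated weight
  \<open>dpsi a b\<close> is symmetric in \<open>a\<close> and \<open>b\<close>.\<close>

lemma kernel_weighted_partials_commute:
  fixes u :: "'a::euclidean_space \<Rightarrow> 'b::euclidean_space"
  assumes "open U" "continuous_on U u"
    and a: "\<And>z. z \<in> U \<Longrightarrow> has_partial a u z (wa z)" "continuous_on U wa"
    and b: "\<And>z. z \<in> U \<Longrightarrow> has_partial b u z (wb z)" "continuous_on U wb"
    and r: "0 < r" "cball x r \<subseteq> U" and \<delta>: "0 < \<delta>" "\<delta> \<le> 1"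
  shows "integral UNIV (\<lambda>y. ((y \<bullet> b) * mean_kernel r y) *\<^sub>R wa (x + \<delta> *\<^sub>R y)) =
    integral UNIV (\<lambda>y. ((y \<bullet> a) * mean_kernel r y) *\<^sub>R wb (x + \<delta> *\<^sub>R y))"
proof -
  obtain v where v: "continuous_on UNIV v" "\<And>z. z \<in> cball x r \<Longrightarrow> v z = u z"
    using Tietze_unbounded[of "cball x r" u UNIV] continuous_on_subset[OF assms(2) r(2)] by auto
  define dpsi :: "'a \<Rightarrow> 'a \<Rightarrow> 'a \<Rightarrow> real" where
    "dpsi a b y = (a \<bullet> b) * mean_kernel r y + (y \<bullet> b) * mean_kernel_deriv r a y" for a b y
  have inB: "x + \<delta> *\<^sub>R y \<in> cball x r" if "norm y \<le> r" for y
  proof -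
    have "\<bar>\<delta>\<bar> * norm y \<le> 1 * r" using that \<delta> by (intro mult_mono) auto
    then show ?thesis by (simp add: dist_norm)
  qed
  have parts: "\<delta> *\<^sub>R integral UNIV (\<lambda>y. ((y \<bullet> b) * mean_kernel r y) *\<^sub>R w (x + \<delta> *\<^sub>R y)) =
      - integral UNIV (\<lambda>y. dpsi a b y *\<^sub>R v (x + \<delta> *\<^sub>R y))"
    if w: "\<And>z. z \<in> U \<Longrightarrow> has_partial a u z (w z)" "continuous_on U w" for a b w
  proof -
    obtain \<omega> where \<omega>: "continuous_on UNIV \<omega>" "\<And>z. z \<in> cball x r \<Longrightarrow> \<omega> z = w z"
      using Tietze_unbounded[of "cball x r" w UNIV] continuous_on_subset[OF w(2) r(2)] by auto
    let ?f = "\<lambda>y. ((y \<bullet> b) * mean_kernel r y) *\<^sub>R v (x + \<delta> *\<^sub>R y)"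
    let ?g1 = "\<lambda>y. dpsi a b y *\<^sub>R v (x + \<delta> *\<^sub>R y)"
    let ?g2 = "\<lambda>y. \<delta> *\<^sub>R (((y \<bullet> b) * mean_kernel r y) *\<^sub>R \<omega> (x + \<delta> *\<^sub>R y))"
    have cv: "continuous_on UNIV (\<lambda>y. v (x + \<delta> *\<^sub>R y))" and c\<omega>: "continuous_on UNIV (\<lambda>y. \<omega> (x + \<delta> *\<^sub>R y))"
      by (intro continuous_on_compose2[OF v(1)] continuous_on_compose2[OF \<omega>(1)] continuous_intros; simp)+
    have psi: "has_partial a (\<lambda>y. (y \<bullet> b) * mean_kernel r y) y (dpsi a b y)" for y
    proof -
      have "has_partial a (\<lambda>y. y \<bullet> b) y (a \<bullet> b)"
        unfolding has_partial_def inner_add_left inner_scaleR_left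
        by (auto intro!: derivative_eq_intros simp flip: has_real_derivative_iff_has_vector_derivative)
      from has_partial_bilinear[OF bounded_bilinear_mult this mean_kernel_has_partial[of a r y]]
      show ?thesis by (simp add: dpsi_def add.commute)
    qed
    have supp: "mean_kernel r y = 0" "dpsi a b y = 0" if "r \<le> norm y" for y
      using mean_kernel_zero[OF r(1) that] mean_kernel_deriv_zero[OF r(1) that] by (simp_all add: dpsi_def)
    have cg: "continuous_on UNIV ?g1" "continuous_on UNIV ?g2"
      unfolding dpsi_def by (intro continuous_intros cv c\<omega>)+
    have "integral UNIV (\<lambda>y. ?g1 y + ?g2 y) = 0"
    proof (rule integral_UNIV_partial_eq_0[where R = r and f = ?f and a = a])
      show "has_partial a ?f y (?g1 y + ?g2 y)" for y
      proof (cases "norm y < r")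
        case True
        have vu: "v (x + \<delta> *\<^sub>R y) = u (x + \<delta> *\<^sub>R y)" if "y \<in> ball 0 r" for y
          using v(2)[OF inB[of y]] that by simp
        have "x + \<delta> *\<^sub>R y \<in> U" using inB[of y] True r(2) by auto
        then have "has_partial (\<delta> *\<^sub>R a) u (x + \<delta> *\<^sub>R y) (\<delta> *\<^sub>R w (x + \<delta> *\<^sub>R y))"
          by (intro has_partial_scaleR_dir w(1))
        then have "has_partial a (\<lambda>y. u (x + \<delta> *\<^sub>R y)) y (\<delta> *\<^sub>R w (x + \<delta> *\<^sub>R y))"
          by (simp add: has_partial_def algebra_simps)
        then have "has_partial a (\<lambda>y. v (x + \<delta> *\<^sub>R y)) y (\<delta> *\<^sub>R w (x + \<delta> *\<^sub>R y))"
          using has_partial_cong[OF dir_open_open[OF open_ball], of y 0 r a "{a}"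
            "\<lambda>y. v (x + \<delta> *\<^sub>R y)" "\<lambda>y. u (x + \<delta> *\<^sub>R y)"] vu True by auto
        from has_partial_bilinear[OF bounded_bilinear_scaleR psi this] show ?thesis
          using \<omega>(2)[OF inB[of y]] True by (simp add: add.commute mult.commute)
      next
        case False
        then have "r \<le> norm y" by simp
        then show ?thesis
          using has_partial_scaleR_zero[OF _ _ cv, of a "\<lambda>y. (y \<bullet> b) * mean_kernel r y" y] psi[of y] supp[of y] by simp
      qed
      show "continuous_on UNIV ?f" "continuous_on UNIV (\<lambda>y. ?g1 y + ?g2 y)"
        by (intro continuous_intros cv cg)+
    qed (use supp[OF less_imp_le] in simp)
    moreover have "?g1 integrable_on UNIV" "?g2 integrable_on UNIV"
      using supp[OF less_imp_le] by (intro integrable_on_UNIV_compact_support[where R = r] cg; simp)+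
    ultimately have sum: "integral UNIV ?g1 + integral UNIV ?g2 = 0"
      by (simp only: integral_add)
    have "((y \<bullet> b) * mean_kernel r y) *\<^sub>R \<omega> (x + \<delta> *\<^sub>R y) = ((y \<bullet> b) * mean_kernel r y) *\<^sub>R w (x + \<delta> *\<^sub>R y)" for y
      using \<omega>(2)[OF inB[of y]] supp(1)[of y] by (cases "norm y \<le> r") auto
    then have "?g2 = (\<lambda>y. \<delta> *\<^sub>R (((y \<bullet> b) * mean_kernel r y) *\<^sub>R w (x + \<delta> *\<^sub>R y)))" by presburger
    then have "integral UNIV ?g2 = \<delta> *\<^sub>R integral UNIV (\<lambda>y. ((y \<bullet> b) * mean_kernel r y) *\<^sub>R w (x + \<delta> *\<^sub>R y))"
      by (simp only: integral_cmul)
    with sum show ?thesis by (simp only: eq_neg_iff_add_eq_0 add.commute)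
  qed
  have "dpsi a b = dpsi b a"
    by (simp add: fun_eq_iff dpsi_def mean_kernel_deriv_def inner_commute mult_ac)
  then have "\<delta> *\<^sub>R integral UNIV (\<lambda>y. ((y \<bullet> b) * mean_kernel r y) *\<^sub>R wa (x + \<delta> *\<^sub>R y)) =
      \<delta> *\<^sub>R integral UNIV (\<lambda>y. ((y \<bullet> a) * mean_kernel r y) *\<^sub>R wb (x + \<delta> *\<^sub>R y))"
    using parts[OF a, of b] parts[OF b, of a] by simp
  then show ?thesis using \<delta> by simp
qed

section \<open>Regularity of generalized Cauchy--Riemann systems\<close>

lemma bounded_bilinear_clifford_mult:
  "bounded_bilinear ((*) :: 'n::finite clifford \<Rightarrow> 'n clifford \<Rightarrow> 'n clifford)"
proof -
  have "bilinear ((*) :: 'n clifford \<Rightarrow> 'n clifford \<Rightarrow> 'n clifford)"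
    by (auto simp: bilinear_def algebra_simps intro!: linearI)
  then show ?thesis by (simp add: bilinear_conv_bounded_bilinear)
qed

lemma bounded_linear_clifford_mult:
  "bounded_linear (\<lambda>a :: 'n::finite clifford. c * a)" "bounded_linear (\<lambda>a :: 'n::finite clifford. a * c)"
  by (rule bounded_bilinear.bounded_linear_right[OF bounded_bilinear_clifford_mult]
      bounded_bilinear.bounded_linear_left[OF bounded_bilinear_clifford_mult])+

lemma cunit_Basis: "i \<le> CARD('n) \<Longrightarrow> (\<e> i :: 'n::finite clifford) \<in> Basis"
  by (auto simp: cunit_def Basis_clifford_def one_clifford_def)

lemma cunit_eq_iff:
  assumes "i \<le> CARD('n)" "j \<le> CARD('n)"
  shows "(\<e> i :: 'n::finite clifford) = \<e> j \<longleftrightarrow> i = j"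
proof
  let ?A = "\<lambda>i. if i = 0 then {} else {i::nat}"
  have *: "(\<e> i :: 'n clifford) = blade (?A i)" for i
    by (simp add: cunit_def one_clifford_def)
  assume "(\<e> i :: 'n clifford) = \<e> j"
  then have "coord (blade (?A i) :: 'n clifford) (?A j) = coord (blade (?A j) :: 'n clifford) (?A j)"
    by (simp only: *)
  then show "i = j" using assms by (auto simp: coord_blade split: if_splits)
qed simp

lemma inner_cunit:
  assumes "i \<le> CARD('n)" "j \<le> CARD('n)"
  shows "(\<e> i :: 'n::finite clifford) \<bullet> \<e> j = (if i = j then 1 else 0)"
  using inner_Basis[OF cunit_Basis[OF assms(1)] cunit_Basis[OF assms(2)]] cunit_eq_iff[OF assms] by simp

definition cunit_conj :: "nat \<Rightarrow> 'n::finite clifford" where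
  "cunit_conj i = (if i = 0 then 1 else - \<e> i)"

text \<open>Polarized forms of x x' = x' x = |x|^2 for a paravector x with conjugate x'. Both orders
  occur because the two stem equations carry the Dirac operator and its conjugate.\<close>

lemma cunit_conj_relations:
  assumes "i \<le> CARD('n)" "j \<le> CARD('n)"
  shows "cunit_conj j * \<e> i + cunit_conj i * \<e> j = (if i = j then 2 else (0 :: 'n::finite clifford))"
    "\<e> j * cunit_conj i + \<e> i * cunit_conj j = (if i = j then 2 else (0 :: 'n::finite clifford))"
proof -
  have "(\<e> i * \<e> j + \<e> j * \<e> i :: 'n clifford) = (if i = j then -2 else 0)" if "i \<noteq> 0" "j \<noteq> 0"
    using that assms by (intro clifford_relations) auto
  then have *: "(\<e> j * \<e> i :: 'n clifford) = (if i = j then -2 else 0) - \<e> i * \<e> j" if "i \<noteq> 0" "j \<noteq> 0"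
    using that by (simp add: eq_diff_eq add.commute)
  have 0: "\<e> 0 = (1 :: 'n clifford)" by (simp add: cunit_def)
  show "cunit_conj j * \<e> i + cunit_conj i * \<e> j = (if i = j then 2 else (0 :: 'n clifford))"
    using * by (cases "i = 0"; cases "j = 0") (auto simp: cunit_conj_def 0)
  show "\<e> j * cunit_conj i + \<e> i * cunit_conj j = (if i = j then 2 else (0 :: 'n clifford))"
    using * by (cases "i = 0"; cases "j = 0") (auto simp: cunit_conj_def 0)
qed

text \<open>Exchanging the summation indices and averaging leaves only the symmetrized coefficients.
  This is the factorization of the Laplacian as pure algebra; \<open>M\<close> is an arbitrary
  symmetric array because it stands for second derivatives, for moment integrals and for products of
  coordinates.\<close>

lemma clifford_trace:
  fixes c d :: "'i \<Rightarrow> 'n::finite clifford"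
  assumes "finite I" "\<And>i j. i \<in> I \<Longrightarrow> j \<in> I \<Longrightarrow> c j * d i + c i * d j = (if i = j then 2 else 0)"
    and "\<And>i j. i \<in> I \<Longrightarrow> j \<in> I \<Longrightarrow> M i j = M j i"
  shows "(\<Sum>j\<in>I. c j * (\<Sum>i\<in>I. d i * M i j)) = (\<Sum>i\<in>I. M i i)"
proof -
  let ?L = "\<Sum>j\<in>I. c j * (\<Sum>i\<in>I. d i * M i j)"
  have L: "?L = (\<Sum>j\<in>I. \<Sum>i\<in>I. c j * d i * M i j)"
    by (simp add: sum_distrib_left mult.assoc)
  also have "\<dots> = (\<Sum>i\<in>I. \<Sum>j\<in>I. c j * d i * M i j)"
    by (rule sum.swap)
  also have "\<dots> = (\<Sum>j\<in>I. \<Sum>i\<in>I. c i * d j * M i j)"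
    using assms(3) by (intro sum.cong refl) simp
  finally have "?L + ?L = (\<Sum>j\<in>I. \<Sum>i\<in>I. (c j * d i + c i * d j) * M i j)"
    using L by (simp add: sum.distrib distrib_right)
  also have "\<dots> = (\<Sum>j\<in>I. \<Sum>i\<in>I. if i = j then 2 * M j j else 0)"
    using assms(2) by (intro sum.cong refl) simp
  also have "\<dots> = (\<Sum>j\<in>I. 2 * M j j)"
    using assms(1) by simp
  finally have "2 *\<^sub>R ?L = 2 *\<^sub>R (\<Sum>i\<in>I. M i i)"
    by (simp add: scaleR_2 mult_2 sum.distrib)
  then show ?thesis by simp
qed

lemma dirac_conj_eq: "dirac_conj m f x = (\<Sum>i=0..m. cunit_conj i * partial (\<e> i) f x)"
proof -
  have "{0..m} = insert 0 {1..m}" by auto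
  then show ?thesis
    by (simp add: dirac_conj_def cunit_conj_def sum_negf)
qed

lemma coord_dirs_subset_Basis: "p \<le> CARD('n) \<Longrightarrow> (coord_dirs p :: ('n::finite clifford \<times> real) set) \<subseteq> Basis"
  by (auto simp: coord_dirs_def Basis_prod_def cunit_Basis)

lemma sum_coord_dirs:
  assumes "p \<le> CARD('n)"
  shows "sum h (coord_dirs p :: ('n::finite clifford \<times> real) set) = (\<Sum>i=0..p. h (\<e> i, 0)) + h (0, 1)"
proof -
  have "inj_on (\<lambda>i. (\<e> i :: 'n clifford, 0::real)) {0..p}"
    using assms by (auto simp: inj_on_def cunit_eq_iff)
  moreover have "(0, 1) \<notin> (\<lambda>i. (\<e> i :: 'n clifford, 0::real)) ` {0..p}" by auto
  ultimately show ?thesis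
    by (simp add: coord_dirs_def sum.union_disjoint sum.reindex o_def add.commute)
qed

lemma kernel_integrable:
  fixes w :: "'a::euclidean_space \<Rightarrow> 'b::euclidean_space"
  assumes "continuous_on U w" "0 < r" "cball x r \<subseteq> U" "0 < \<delta>" "\<delta> \<le> 1"
  shows "(\<lambda>y. ((y \<bullet> b) * mean_kernel r y) *\<^sub>R w (x + \<delta> *\<^sub>R y)) integrable_on UNIV"
proof -
  obtain v where v: "continuous_on UNIV v" "\<And>z. z \<in> cball x r \<Longrightarrow> v z = w z"
    using Tietze_unbounded[of "cball x r" w UNIV] continuous_on_subset[OF assms(1,3)] by auto
  have "((y \<bullet> b) * mean_kernel r y) *\<^sub>R w (x + \<delta> *\<^sub>R y) = ((y \<bullet> b) * mean_kernel r y) *\<^sub>R v (x + \<delta> *\<^sub>R y)" for y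
  proof (cases "norm y \<le> r")
    case True
    then have "\<bar>\<delta>\<bar> * norm y \<le> 1 * r" using assms by (intro mult_mono) auto
    then show ?thesis using v(2)[of "x + \<delta> *\<^sub>R y"] by (simp add: dist_norm)
  qed (use mean_kernel_zero[of r y] assms(2) in simp)
  moreover have "(\<lambda>y. ((y \<bullet> b) * mean_kernel r y) *\<^sub>R v (x + \<delta> *\<^sub>R y)) integrable_on UNIV"
    by (rule integrable_on_UNIV_compact_support[where R = r])
      (use mean_kernel_zero[OF assms(2) less_imp_le] in
        \<open>auto intro!: continuous_intros continuous_on_compose2[OF v(1)]\<close>)
  ultimately show ?thesis by presburger
qed

text \<open>
  The weighted integrals \<open>J a b\<close> of \<open>\<partial>\<^sub>a F\<close> against \<open>y\<^sub>b\<close> are symmetric in \<open>a\<close>, \<open>b\<close> and satisfy the same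
  first-order system_A_G as the second derivatives \<open>\<partial>\<^sub>a\<partial>\<^sub>b F\<close> would, so their traces vanish.  In this weak
  form the components are harmonic although they are only \<open>C\<^sup>1\<close>.
\<close>

lemma generalized_Cauchy_Riemann_smooth:
  fixes F1 F2 :: "'n::finite clifford \<times> real \<Rightarrow> 'n clifford"
  assumes p: "p \<le> CARD('n)" and U: "open U"
    and C1: "Ck_on 1 Basis U F1" "Ck_on 1 Basis U F2"
    and const: "\<And>b z. b \<in> Basis - coord_dirs p \<Longrightarrow> z \<in> U \<Longrightarrow> partial b F1 z = 0 \<and> partial b F2 z = 0"
    and eq1: "\<And>z. z \<in> U \<Longrightarrow> (\<Sum>i=0..p. \<e> i * partial (\<e> i, 0) F1 z) = partial (0, 1) F2 z"
    and eq2: "\<And>z. z \<in> U \<Longrightarrow> (\<Sum>i=0..p. cunit_conj i * partial (\<e> i, 0) F2 z) = - partial (0, 1) F1 z"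
  shows "smooth_on B U F1" "smooth_on B U F2"
proof -
  define J where "J x r \<delta> F a b = integral UNIV (\<lambda>y. ((y \<bullet> b) * mean_kernel r y) *\<^sub>R partial a F (x + \<delta> *\<^sub>R y))"
    for x :: "'n clifford \<times> real" and r \<delta> :: real and F :: "'n clifford \<times> real \<Rightarrow> 'n clifford" and a b
  have hp: "has_partial b F z (partial b F z)"
    if "b \<in> Basis" "z \<in> U" "Ck_on 1 Basis U F" for b z and F :: "'n clifford \<times> real \<Rightarrow> 'n clifford"
    using that by (auto simp: has_partial_partial_iff)
  have cp': "continuous_on U (partial b F)"
    if "b \<in> Basis" "Ck_on 1 Basis U F" for b and F :: "'n clifford \<times> real \<Rightarrow> 'n clifford"
    using that by auto
  have coord_dirs_mem: "(\<e> i :: 'n clifford, 0::real) \<in> Basis" if "i \<in> {0..p}" for i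
    using that p by (auto simp: Basis_prod_def cunit_Basis)
  have dir_r: "(0 :: 'n clifford, 1::real) \<in> Basis"
    by (auto simp: Basis_prod_def)
  have sym: "J x r \<delta> F a b = J x r \<delta> F b a"
    if "a \<in> Basis" "b \<in> Basis" "Ck_on 1 Basis U F" "0 < r" "cball x r \<subseteq> U" "0 < \<delta>" "\<delta> \<le> 1" for x r \<delta> F a b
    unfolding J_def
    by (rule kernel_weighted_partials_commute[OF U Ck_on_continuous[OF that(3)]
        hp[OF that(1) _ that(3)] cp'[OF that(1,3)] hp[OF that(2) _ that(3)] cp'[OF that(2,3)] that(4-7)])
  \<comment> \<open>A linear relation between first derivatives passes to the first index of
    \<open>J\<close> for every fixed second index, since that index enters only through the
    weight.\<close>
  have lin: "(\<Sum>i=0..p. c i * J x r \<delta> F (\<e> i, 0) b) = s *\<^sub>R J x r \<delta> G (0, 1) b"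
    if eq: "\<And>z. z \<in> U \<Longrightarrow> (\<Sum>i=0..p. c i * partial (\<e> i, 0) F z) = s *\<^sub>R partial (0, 1) G z"
      and FG: "Ck_on 1 Basis U F" "Ck_on 1 Basis U G"
      and r: "0 < r" "cball x r \<subseteq> U" and \<delta>: "0 < \<delta>" "\<delta> \<le> 1" for x r \<delta> F G c s b
  proof -
    let ?k = "\<lambda>y. (y \<bullet> b) * mean_kernel r y"
    have "((\<lambda>y. ?k y *\<^sub>R partial (\<e> i, 0) F (x + \<delta> *\<^sub>R y)) has_integral J x r \<delta> F (\<e> i, 0) b) UNIV"
      if "i \<in> {0..p}" for i
      unfolding J_def
      by (intro integrable_integral kernel_integrable[OF cp'[OF coord_dirs_mem[OF that] FG(1)] r \<delta>])
    from has_integral_linear[OF this bounded_linear_clifford_mult(1)]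
    have "((\<lambda>y. \<Sum>i=0..p. c i * (?k y *\<^sub>R partial (\<e> i, 0) F (x + \<delta> *\<^sub>R y))) has_integral
        (\<Sum>i=0..p. c i * J x r \<delta> F (\<e> i, 0) b)) UNIV"
      by (intro has_integral_sum) (auto simp: o_def)
    moreover have "(\<Sum>i=0..p. c i * (?k y *\<^sub>R partial (\<e> i, 0) F (x + \<delta> *\<^sub>R y))) =
        s *\<^sub>R (?k y *\<^sub>R partial (0, 1) G (x + \<delta> *\<^sub>R y))" for y
    proof (cases "norm y \<le> r")
      case True
      then have "\<bar>\<delta>\<bar> * norm y \<le> 1 * r" using r \<delta> by (intro mult_mono) auto
      then have "x + \<delta> *\<^sub>R y \<in> U" using r(2) by (auto simp: dist_norm)
      from eq[OF this] have "?k y *\<^sub>R (\<Sum>i=0..p. c i * partial (\<e> i, 0) F (x + \<delta> *\<^sub>R y)) =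
          ?k y *\<^sub>R (s *\<^sub>R partial (0, 1) G (x + \<delta> *\<^sub>R y))" by simp
      then show ?thesis by (simp add: scaleR_sum_right mult.commute)
    next
      case False
      then show ?thesis using mean_kernel_zero[of r y] r(1) by simp
    qed
    moreover have "((\<lambda>y. s *\<^sub>R (?k y *\<^sub>R partial (0, 1) G (x + \<delta> *\<^sub>R y))) has_integral s *\<^sub>R J x r \<delta> G (0, 1) b) UNIV"
      unfolding J_def
      by (intro has_integral_cmul integrable_integral kernel_integrable[OF cp'[OF dir_r FG(2)] r \<delta>])
    ultimately show ?thesis
      using has_integral_unique by (metis (no_types, lifting) has_integral_cong)
  qed
  \<comment> \<open>The equation for \<open>F\<close> acts on the first index of \<open>J\<close>,
    symmetry then exchanges the indices, and the equation for \<open>G\<close> acts in turn; the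
    radial entry appears with the factor - s * s = -1. The parameters \<open>c\<close>,
    \<open>c'\<close>, \<open>s\<close> let one argument serve both stem functions.\<close>
  have trace: "(\<Sum>b\<in>Basis. J x r \<delta> F b b) = 0"
    if c: "\<And>i j. i \<in> {0..p} \<Longrightarrow> j \<in> {0..p} \<Longrightarrow> c' j * c i + c' i * c j = (if i = j then 2 else 0)"
      and eqF: "\<And>z. z \<in> U \<Longrightarrow> (\<Sum>i=0..p. c i * partial (\<e> i, 0) F z) = s *\<^sub>R partial (0, 1) G z"
      and eqG: "\<And>z. z \<in> U \<Longrightarrow> (\<Sum>i=0..p. c' i * partial (\<e> i, 0) G z) = (- s) *\<^sub>R partial (0, 1) F z"
      and s: "s * s = 1"
      and FG: "Ck_on 1 Basis U F" "Ck_on 1 Basis U G"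
      and z: "\<And>b z. b \<in> Basis - coord_dirs p \<Longrightarrow> z \<in> U \<Longrightarrow> partial b F z = 0"
      and r: "0 < r" "cball x r \<subseteq> U" and \<delta>: "0 < \<delta>" "\<delta> \<le> 1" for x r \<delta> F G c c' s
  proof -
    have "(\<Sum>i=0..p. J x r \<delta> F (\<e> i, 0) (\<e> i, 0)) =
        (\<Sum>j=0..p. c' j * (\<Sum>i=0..p. c i * J x r \<delta> F (\<e> i, 0) (\<e> j, 0)))"
      by (rule clifford_trace[symmetric]) (use c sym[OF coord_dirs_mem coord_dirs_mem FG(1) r \<delta>] in auto)
    also have "\<dots> = (\<Sum>j=0..p. c' j * (s *\<^sub>R J x r \<delta> G (\<e> j, 0) (0, 1)))"
      using sym[OF dir_r coord_dirs_mem FG(2) r \<delta>] lin[OF eqF FG r \<delta>] by simp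
    also have "\<dots> = s *\<^sub>R (\<Sum>j=0..p. c' j * J x r \<delta> G (\<e> j, 0) (0, 1))"
      by (simp add: scaleR_sum_right)
    also have "\<dots> = - J x r \<delta> F (0, 1) (0, 1)"
      using lin[OF eqG FG(2,1) r \<delta>] s by simp
    finally have "(\<Sum>b\<in>coord_dirs p. J x r \<delta> F b b) = 0"
      by (simp add: sum_coord_dirs[OF p])
    \<comment> \<open>\<open>F\<close> does not vary in the remaining basis directions, so the trace
      over the whole \<open>Basis\<close>, which \<open>mean_valueI\<close> asks for, reduces to
      \<open>coord_dirs p\<close>.\<close>
    moreover have "J x r \<delta> F b b = 0" if b: "b \<in> Basis - coord_dirs p" for b
    proof -
      have "((y \<bullet> b) * mean_kernel r y) *\<^sub>R partial b F (x + \<delta> *\<^sub>R y) = 0" for y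
      proof (cases "norm y \<le> r")
        case True
        then have "\<bar>\<delta>\<bar> * norm y \<le> 1 * r" using r \<delta> by (intro mult_mono) auto
        then have "x + \<delta> *\<^sub>R y \<in> U" using r(2) by (auto simp: dist_norm)
        then show ?thesis using z[OF b] by simp
      qed (use mean_kernel_zero[of r y] r(1) in simp)
      then have "(\<lambda>y. ((y \<bullet> b) * mean_kernel r y) *\<^sub>R partial b F (x + \<delta> *\<^sub>R y)) = (\<lambda>y. 0)" by blast
      then show ?thesis unfolding J_def by (simp only: integral_0)
    qed
    ultimately show ?thesis
      using sum.mono_neutral_left[OF finite_Basis coord_dirs_subset_Basis[OF p], of "\<lambda>b. J x r \<delta> F b b"] by simp
  qed
  have rel: "cunit_conj j * \<e> i + cunit_conj i * \<e> j = (if i = j then 2 else (0 :: 'n clifford))"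
    "\<e> j * cunit_conj i + \<e> i * cunit_conj j = (if i = j then 2 else (0 :: 'n clifford))"
    if "i \<in> {0..p}" "j \<in> {0..p}" for i j
    using that p by (intro cunit_conj_relations; simp)+
  have "mean_value U F1"
  proof (rule mean_valueI[OF U, where w = "\<lambda>b. partial b F1"])
    show "(\<Sum>b\<in>Basis. integral UNIV (\<lambda>y. ((y \<bullet> b) * mean_kernel r y) *\<^sub>R partial b F1 (x + \<delta> *\<^sub>R y))) = 0"
      if "0 < r" "cball x r \<subseteq> U" "0 < \<delta>" "\<delta> \<le> 1" for x r \<delta>
      unfolding J_def[symmetric]
      by (rule trace[where c = \<e> and c' = cunit_conj and s = 1 and G = F2])
        (use that C1 const eq1 eq2 rel(1) in \<open>simp_all del: Ck_on.simps One_nat_def\<close>)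
  qed (use C1 hp in auto)
  moreover have "mean_value U F2"
  proof (rule mean_valueI[OF U, where w = "\<lambda>b. partial b F2"])
    show "(\<Sum>b\<in>Basis. integral UNIV (\<lambda>y. ((y \<bullet> b) * mean_kernel r y) *\<^sub>R partial b F2 (x + \<delta> *\<^sub>R y))) = 0"
      if "0 < r" "cball x r \<subseteq> U" "0 < \<delta>" "\<delta> \<le> 1" for x r \<delta>
      unfolding J_def[symmetric]
      by (rule trace[where c = cunit_conj and c' = \<e> and s = "-1" and G = F1])
        (use that C1 const eq1 eq2 rel(2) in \<open>simp_all del: Ck_on.simps One_nat_def\<close>)
  qed (use C1 hp in auto)
  ultimately show "smooth_on B U F1" "smooth_on B U F2"
    using C1 U by (auto intro: mean_value_smooth_on)
qed

section \<open>Division by the radial variable\<close>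

lemma has_partial_scale_snd:
  assumes "snd v = 0 \<and> c = 1 \<or> v = (0, 1) \<and> c = t"
    and "has_partial v G (fst z, t * snd z :: real) d"
  shows "has_partial v (\<lambda>z. G (fst z, t * snd z)) z (c *\<^sub>R d)"
proof -
  have "(fst (z + s *\<^sub>R v), t * snd (z + s *\<^sub>R v)) = (fst z, t * snd z) + s *\<^sub>R (c *\<^sub>R v)" for s
    using assms(1) by (cases v) (auto simp: algebra_simps)
  then show ?thesis
    using has_partial_scaleR_dir[OF assms(2), of c] by (simp add: has_partial_def)
qed

text \<open>Each derivative in the last variable produces a factor t, so the induction runs over all
  weights t^j; the exponent \<open>e v\<close> counts this factor.\<close>

lemma Ck_on_scaled_integral:
  fixes G :: "'a::real_normed_vector \<times> real \<Rightarrow> 'b::banach"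
  assumes "open T" "\<And>z t. z \<in> T \<Longrightarrow> t \<in> {0..1} \<Longrightarrow> (fst z, t * snd z) \<in> T"
    and "B \<subseteq> insert (0, 1) ((\<lambda>w. (w, 0)) ` W)" "smooth_on B T G"
  shows "Ck_on k B T (\<lambda>z. integral {0..1} (\<lambda>t. t ^ j *\<^sub>R G (fst z, t * snd z)))"
proof -
  have contG: "continuous_on (T \<times> {0..1}) (\<lambda>(z, t). t ^ j *\<^sub>R G (fst z, t * snd z))"
    if "smooth_on B T G" for j and G :: "'a \<times> real \<Rightarrow> 'b"
    unfolding split_beta
    by (intro continuous_intros continuous_on_compose2[OF smooth_on_continuous[OF that]]) (use assms(2) in auto)
  have cont: "continuous_on T (\<lambda>z. integral {0..1} (\<lambda>t. t ^ j *\<^sub>R G (fst z, t * snd z)))"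
    if "smooth_on B T G" for j and G :: "'a \<times> real \<Rightarrow> 'b"
    using integral_continuous_on_param[where U = T and a = "0::real" and b = 1 and
        f = "\<lambda>z t. t ^ j *\<^sub>R G (fst z, t * snd z)"] contG[OF that] by simp
  show ?thesis
    using assms(4)
  proof (induction k arbitrary: j G)
    case 0
    then show ?case using cont by simp
  next
    case (Suc k)
    define e :: "'a \<times> real \<Rightarrow> nat" where "e v = (if v = (0, 1) then 1 else 0)" for v
    show ?case
    proof (rule Ck_on_SucI[OF dir_open_open[OF assms(1)] cont[OF Suc.prems],
        where g = "\<lambda>v z. integral {0..1} (\<lambda>t. t ^ (j + e v) *\<^sub>R partial v G (fst z, t * snd z))"])
      fix v assume v: "v \<in> B"
      have Gv: "smooth_on B T (partial v G)" using smooth_on_partial[OF Suc.prems v] .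
      have "has_partial v (\<lambda>z. integral {0..1} (\<lambda>t. t ^ j *\<^sub>R G (fst z, t * snd z))) z
          (integral {0..1} (\<lambda>t. t ^ (j + e v) *\<^sub>R partial v G (fst z, t * snd z)))" if z: "z \<in> T" for z
      proof -
        have "open ((\<lambda>s. z + s *\<^sub>R v) -` T)"
          using assms(1) by (intro open_vimage continuous_intros)
        then obtain d where d: "d > 0" "ball 0 d \<subseteq> (\<lambda>s. z + s *\<^sub>R v) -` T"
          using z open_contains_ball[of "(\<lambda>s. z + s *\<^sub>R v) -` T"] by (metis (no_types, lifting) add.right_neutral scaleR_zero_left vimageI)
        let ?m = "\<lambda>s t. (fst (z + s *\<^sub>R v), t * snd (z + s *\<^sub>R v))"
        have "((\<lambda>s. integral (cbox 0 1) (\<lambda>t. t ^ j *\<^sub>R G (?m s t))) has_vector_derivative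
            integral (cbox 0 1) (\<lambda>t. t ^ (j + e v) *\<^sub>R partial v G (?m 0 t))) (at 0 within ball 0 d)"
        proof (rule leibniz_rule_vector_derivative)
          fix s t :: real assume s: "s \<in> ball 0 d" and t: "t \<in> cbox 0 1"
          have zs: "z + s *\<^sub>R v \<in> T" using s d(2) by auto
          have "has_partial v G (?m s t) (partial v G (?m s t))"
            using assms(2)[OF zs] t by (intro smooth_on_has_partial[OF Suc.prems v]) auto
          then have "has_partial v (\<lambda>z. G (fst z, t * snd z)) (z + s *\<^sub>R v) (t ^ e v *\<^sub>R partial v G (?m s t))"
            using v assms(3) by (intro has_partial_scale_snd) (auto simp: e_def)
          then have "((\<lambda>s. G (?m s t)) has_vector_derivative t ^ e v *\<^sub>R partial v G (?m s t)) (at s within ball 0 d)"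
            unfolding has_partial_at by (rule has_vector_derivative_at_within)
          then show "((\<lambda>s. t ^ j *\<^sub>R G (?m s t)) has_vector_derivative t ^ (j + e v) *\<^sub>R partial v G (?m s t))
              (at s within ball 0 d)"
            unfolding power_add scaleR_scaleR[symmetric]
            by (rule bounded_linear.has_vector_derivative[OF bounded_linear_scaleR_right])
        next
          fix s :: real assume s: "s \<in> ball 0 d"
          then have "continuous_on {0..1} (\<lambda>t. t ^ j *\<^sub>R G (?m s t))"
            using d(2) by (intro continuous_on_compose2[OF contG[OF Suc.prems, of j], of "{0..1}" "\<lambda>t. (z + s *\<^sub>R v, t)", unfolded prod.case]
                continuous_intros) auto
          then show "(\<lambda>t. t ^ j *\<^sub>R G (?m s t)) integrable_on cbox 0 1"
            by (simp add: integrable_continuous_real)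
        next
          show "continuous_on (ball 0 d \<times> cbox 0 1) (\<lambda>(s, t). t ^ (j + e v) *\<^sub>R partial v G (?m s t))"
            unfolding split_beta using d(2)
            by (intro continuous_on_compose2[OF contG[OF Gv, of "j + e v"], of _ "\<lambda>x. (z + fst x *\<^sub>R v, snd x)", unfolded prod.case]
                continuous_intros) auto
        qed (use d(1) in auto)
        then show ?thesis
          using d(1) by (simp add: has_partial_def at_within_open[of "0::real" "ball 0 d"])
      qed
      then show "(\<forall>z\<in>T. has_partial v (\<lambda>z. integral {0..1} (\<lambda>t. t ^ j *\<^sub>R G (fst z, t * snd z))) z
            (integral {0..1} (\<lambda>t. t ^ (j + e v) *\<^sub>R partial v G (fst z, t * snd z)))) \<and>
          Ck_on k B T (\<lambda>z. integral {0..1} (\<lambda>t. t ^ (j + e v) *\<^sub>R partial v G (fst z, t * snd z)))"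
        using Suc.IH[OF Gv] by blast
    qed
  qed
qed

text \<open>The family of all c / r^j is closed under differentiation, which is why \<open>c\<close>
  and \<open>j\<close> are general.\<close>

lemma Ck_on_inverse_snd:
  assumes "open S" "\<And>z. z \<in> S \<Longrightarrow> snd z \<noteq> 0"
  shows "Ck_on k B S (\<lambda>z :: 'a::real_normed_vector \<times> real. c * inverse (snd z) ^ j)"
proof (induction k arbitrary: j c)
  case 0
  then show ?case using assms by (auto intro!: continuous_intros)
next
  case (Suc k)
  show ?case
  proof (rule Ck_on_SucI[OF dir_open_open[OF assms(1)],
      where g = "\<lambda>v z. (- c * of_nat j * snd v) * inverse (snd z) ^ (j + 1)"])
    show "continuous_on S (\<lambda>z. c * inverse (snd z) ^ j)"
      using assms by (auto intro!: continuous_intros)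
    have "has_partial v (\<lambda>z. c * inverse (snd z) ^ j) z ((- c * of_nat j * snd v) * inverse (snd z) ^ (j + 1))"
      if "z \<in> S" for v z
    proof -
      have "((\<lambda>t. inverse (snd z + t * snd v)) has_real_derivative - snd v * (inverse (snd z))\<^sup>2) (at 0)"
        using assms(2)[OF that] by (auto intro!: derivative_eq_intros simp: power2_eq_square)
      from DERIV_cmult[OF DERIV_power[OF this, of j], of c]
      have "((\<lambda>t. c * inverse (snd z + t * snd v) ^ j) has_real_derivative
          (- c * of_nat j * snd v) * inverse (snd z) ^ (j + 1)) (at 0)"
        by (cases j) (simp_all add: power2_eq_square mult_ac)
      then show ?thesis by (simp add: has_partial_def has_real_derivative_iff_has_vector_derivative)
    qed
    then show "(\<forall>z\<in>S. has_partial v (\<lambda>z. c * inverse (snd z) ^ j) z ((- c * of_nat j * snd v) * inverse (snd z) ^ (j + 1))) \<and>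
        Ck_on k B S (\<lambda>z. (- c * of_nat j * snd v) * inverse (snd z) ^ (j + 1))" for v
      using Suc by blast
  qed
qed

text \<open>\<open>H(y, r) / r\<close>, with the value that makes it continuous at \<open>r = 0\<close> if \<open>H\<close> vanishes there.\<close>

definition quot_snd :: "('a::real_normed_vector \<times> real \<Rightarrow> 'b::real_normed_vector) \<Rightarrow> 'a \<times> real \<Rightarrow> 'b" where
  "quot_snd H z = (if snd z = 0 then partial (0, 1) H z else H z /\<^sub>R snd z)"

text \<open>Hadamard's lemma: near the hyperplane \<open>r = 0\<close>, \<open>H(y, r) / r = \<integral>\<^sub>0\<^sup>1 \<partial>\<^sub>r H(y, t r) dt\<close>.\<close>

lemma smooth_on_quot_snd:
  fixes H :: "'a::real_normed_vector \<times> real \<Rightarrow> 'b::banach"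
  assumes "open U" "B \<subseteq> insert (0, 1) ((\<lambda>w. (w, 0)) ` W)" "(0, 1) \<in> B" "smooth_on B U H"
    and "\<And>z. z \<in> U \<Longrightarrow> snd z = 0 \<Longrightarrow> H z = 0"
  shows "smooth_on B U (quot_snd H)"
proof (rule smooth_on_local)
  fix x assume x: "x \<in> U"
  show "\<exists>T. open T \<and> x \<in> T \<and> T \<subseteq> U \<and> smooth_on B T (quot_snd H)"
  proof (cases "snd x = 0")
    case False
    let ?T = "U \<inter> {z. snd z \<noteq> 0}"
    have "open {z :: 'a \<times> real. snd z \<noteq> 0}"
      by (intro open_Collect_neq continuous_intros)
    then have T: "open ?T" using assms(1) by auto
    have "smooth_on B ?T (\<lambda>z. (1 * inverse (snd z) ^ 1) *\<^sub>R H z)"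
      by (rule smooth_on_bilinear[OF dir_open_open[OF T] bounded_bilinear_scaleR])
        (use T Ck_on_inverse_snd[OF T, of _ B 1 1] smooth_on_subset[OF assms(4), of ?T B] in \<open>auto simp: smooth_on_def\<close>)
    then have "smooth_on B ?T (quot_snd H)"
      by (rule smooth_on_cong[OF dir_open_open[OF T], THEN iffD1, rotated]) (simp add: quot_snd_def)
    then show ?thesis using T x False by blast
  next
    case True
    obtain e where e: "e > 0" "ball x e \<subseteq> U" using assms(1) x open_contains_ball by blast
    let ?T = "ball x e"
    \<comment> \<open>The centre lies on the hyperplane r = 0, so shrinking r does not increase the
      distance to it.\<close>
    have star: "(fst z, t * snd z) \<in> ?T" if "z \<in> ?T" "t \<in> {0..1}" for z t
    proof -
      have "(t * snd z)\<^sup>2 \<le> (snd z)\<^sup>2"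
        using that(2) by (auto simp: power_mult_distrib power_le_one mult_left_le_one_le)
      then have "dist x (fst z, t * snd z) \<le> dist x z"
        using True by (cases z) (simp add: dist_prod_def dist_real_def)
      then show ?thesis using that(1) by simp
    qed
    have Hr: "smooth_on B ?T (partial (0, 1) H)"
      using smooth_on_subset[OF smooth_on_partial[OF assms(4,3)] e(2)] by blast
    have eq: "integral {0..1} (\<lambda>t. t ^ 0 *\<^sub>R partial (0, 1) H (fst z, t * snd z)) = quot_snd H z" if z: "z \<in> ?T" for z
    proof (cases "snd z = 0")
      case True
      then show ?thesis by (cases z) (simp add: quot_snd_def)
    next
      case False
      have "((\<lambda>t. H (fst z, t * snd z)) has_vector_derivative snd z *\<^sub>R partial (0, 1) H (fst z, t * snd z)) (at t within {0..1})"
        if t: "t \<in> {0..1}" for t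
      proof -
        have "has_partial (0, 1) H (fst z, t * snd z) (partial (0, 1) H (fst z, t * snd z))"
          using star[OF z t] e(2) by (intro smooth_on_has_partial[OF assms(4,3)]) auto
        from has_partial_scaleR_dir[OF this, of "snd z"]
        have "has_partial (0, snd z) H ((fst z, 0) + t *\<^sub>R (0, snd z)) (snd z *\<^sub>R partial (0, 1) H (fst z, t * snd z))"
          by simp
        then show ?thesis unfolding has_partial_at by (simp add: has_vector_derivative_at_within)
      qed
      then have "((\<lambda>t. snd z *\<^sub>R partial (0, 1) H (fst z, t * snd z)) has_integral
          (H (fst z, 1 * snd z) - H (fst z, 0 * snd z))) {0..1}"
        by (intro fundamental_theorem_of_calculus) auto
      moreover have "H (fst z, 0 * snd z) = 0"
        using star[OF z, of 0] e(2) by (intro assms(5)) auto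
      ultimately have "snd z *\<^sub>R integral {0..1} (\<lambda>t. partial (0, 1) H (fst z, t * snd z)) = H z"
        by (simp add: integral_unique flip: integral_cmul)
      then have "inverse (snd z) *\<^sub>R (snd z *\<^sub>R integral {0..1} (\<lambda>t. partial (0, 1) H (fst z, t * snd z))) = inverse (snd z) *\<^sub>R H z"
        by simp
      then show ?thesis using False by (simp add: quot_snd_def)
    qed
    have "smooth_on B ?T (\<lambda>z. integral {0..1} (\<lambda>t. t ^ 0 *\<^sub>R partial (0, 1) H (fst z, t * snd z)))"
      unfolding smooth_on_def using Ck_on_scaled_integral[OF open_ball star assms(2) Hr] by blast
    then have "smooth_on B ?T (quot_snd H)"
      by (rule smooth_on_cong[OF dir_open_open[OF open_ball], THEN iffD1, rotated]) (rule eq)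
    then show ?thesis using e by (intro exI[of _ ?T]) auto
  qed
qed

section \<open>Dirac and Laplace operators\<close>

abbreviation cunits :: "nat \<Rightarrow> 'n::finite clifford set" where
  "cunits m \<equiv> \<e> ` {0..m}"

lemma partial_scaleR:
  "has_partial v f x d \<Longrightarrow> partial v (\<lambda>x. c *\<^sub>R f x) x = c *\<^sub>R d"
  by (intro has_partial_imp_partial has_partial_linear[OF bounded_linear_scaleR_right])

lemma laplace_cong:
  assumes "dir_open (cunits m) S" "\<And>y. y \<in> S \<Longrightarrow> f y = g y" "x \<in> S"
  shows "laplace m f x = laplace m g x"
  unfolding laplace_def using assms
  by (intro sum.cong refl partial_cong[OF assms(1)] partial_cong[OF assms(1) _ _ assms(2)]) auto

lemma laplace_funpow_cong:
  assumes "dir_open (cunits m) S" "\<And>y. y \<in> S \<Longrightarrow> f y = g y" "x \<in> S"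
  shows "(laplace m ^^ k) f x = (laplace m ^^ k) g x"
  using assms(3)
proof (induction k arbitrary: x)
  case (Suc k)
  then show ?case using laplace_cong[OF assms(1), of "(laplace m ^^ k) f" "(laplace m ^^ k) g" x] by simp
qed (simp add: assms(2))

lemma dirac_cong:
  assumes "dir_open (cunits m) S" "\<And>y. y \<in> S \<Longrightarrow> f y = g y" "x \<in> S"
  shows "dirac m f x = dirac m g x"
  unfolding dirac_def using assms
  by (intro sum.cong refl arg_cong2[where f = "(*)"] partial_cong[OF assms(1) _ _ assms(2)]) auto

context
  fixes m :: nat and S :: "'n::finite clifford set"
  assumes S: "open S"
begin

lemma smooth_on_laplace:
  assumes "smooth_on (cunits m) S f"
  shows "smooth_on (cunits m) S (laplace m f)"
  unfolding laplace_def[abs_def] using assms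
  by (intro smooth_on_sum[OF dir_open_open[OF S]] smooth_on_partial) auto

lemma smooth_on_laplace_funpow:
  assumes "smooth_on (cunits m) S f"
  shows "smooth_on (cunits m) S ((laplace m ^^ k) f)"
  using assms by (induction k) (auto intro: smooth_on_laplace)

lemma laplace_scaleR:
  assumes "smooth_on (cunits m) S f" "x \<in> S"
  shows "laplace m (\<lambda>x. c *\<^sub>R f x) x = c *\<^sub>R laplace m f x"
proof -
  have "partial v (partial v (\<lambda>x. c *\<^sub>R f x)) x = c *\<^sub>R partial v (partial v f) x" if v: "v \<in> cunits m" for v
  proof -
    have "partial v (\<lambda>x. c *\<^sub>R f x) y = c *\<^sub>R partial v f y" if "y \<in> S" for y
      using smooth_on_has_partial[OF assms(1) v that] by (rule partial_scaleR)
    then have "partial v (partial v (\<lambda>x. c *\<^sub>R f x)) x = partial v (\<lambda>x. c *\<^sub>R partial v f x) x"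
      by (intro partial_cong[OF dir_open_open[OF S] assms(2) v])
    also have "\<dots> = c *\<^sub>R partial v (partial v f) x"
      using smooth_on_has_partial[OF smooth_on_partial[OF assms(1) v] v assms(2)] by (rule partial_scaleR)
    finally show ?thesis .
  qed
  then show ?thesis by (simp add: laplace_def scaleR_sum_right)
qed

lemma laplace_funpow_scaleR:
  assumes "smooth_on (cunits m) S f" "x \<in> S"
  shows "(laplace m ^^ k) (\<lambda>x. c *\<^sub>R f x) x = c *\<^sub>R (laplace m ^^ k) f x"
  using assms(2)
proof (induction k arbitrary: x)
  case (Suc k)
  have "laplace m ((laplace m ^^ k) (\<lambda>x. c *\<^sub>R f x)) x = laplace m (\<lambda>x. c *\<^sub>R (laplace m ^^ k) f x) x"
    by (rule laplace_cong[OF dir_open_open[OF S] Suc.IH Suc.prems])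
  also have "\<dots> = c *\<^sub>R laplace m ((laplace m ^^ k) f) x"
    by (rule laplace_scaleR[OF smooth_on_laplace_funpow[OF assms(1)] Suc.prems])
  finally show ?case by simp
qed simp

lemma partial_dirac:
  assumes "smooth_on (cunits m) S f" "v \<in> cunits m" "x \<in> S"
  shows "partial v (dirac m f) x = (\<Sum>i=0..m. \<e> i * partial v (partial (\<e> i) f) x)"
  unfolding dirac_def[abs_def] using assms
  by (intro has_partial_imp_partial has_partial_sum has_partial_linear[OF bounded_linear_clifford_mult(1)]
      smooth_on_has_partial[OF smooth_on_partial]) auto

lemma partial_laplace:
  assumes "smooth_on (cunits m) S f" "v \<in> cunits m" "x \<in> S"
  shows "partial v (laplace m f) x = laplace m (partial v f) x"
proof -
  have "partial v (laplace m f) x = (\<Sum>i=0..m. partial v (partial (\<e> i) (partial (\<e> i) f)) x)"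
    unfolding laplace_def[abs_def] using assms
    by (intro has_partial_imp_partial has_partial_sum smooth_on_has_partial[OF smooth_on_partial[OF smooth_on_partial]]) auto
  also have "\<dots> = (\<Sum>i=0..m. partial (\<e> i) (partial (\<e> i) (partial v f)) x)"
  proof (intro sum.cong refl)
    fix i assume "i \<in> {0..m}"
    then have i: "\<e> i \<in> (cunits m :: 'n clifford set)" by blast
    have "partial v (partial (\<e> i) (partial (\<e> i) f)) x = partial (\<e> i) (partial v (partial (\<e> i) f)) x"
      using partial_commute[OF S assms(3) smooth_on_partial[OF assms(1) i] assms(2) i] .
    also have "\<dots> = partial (\<e> i) (partial (\<e> i) (partial v f)) x"
      using partial_commute[OF S _ assms(1) assms(2) i] by (intro partial_cong[OF dir_open_open[OF S] assms(3) i])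
    finally show "partial v (partial (\<e> i) (partial (\<e> i) f)) x = partial (\<e> i) (partial (\<e> i) (partial v f)) x" .
  qed
  finally show ?thesis by (simp add: laplace_def)
qed

text \<open>The coefficients are constant and multiply from the left, so commuting partial
  derivatives suffice.\<close>

lemma dirac_laplace_commute:
  assumes "smooth_on (cunits m) S f" "x \<in> S"
  shows "dirac m (laplace m f) x = laplace m (dirac m f) x"
proof -
  have eq: "partial v (partial v (dirac m f)) x = (\<Sum>i=0..m. \<e> i * partial v (partial v (partial (\<e> i) f)) x)"
    if v: "v \<in> cunits m" for v
  proof -
    have "partial v (partial v (dirac m f)) x = partial v (\<lambda>x. \<Sum>i=0..m. \<e> i * partial v (partial (\<e> i) f) x) x"
      using partial_dirac[OF assms(1) v] by (intro partial_cong[OF dir_open_open[OF S] assms(2) v])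
    also have "\<dots> = (\<Sum>i=0..m. \<e> i * partial v (partial v (partial (\<e> i) f)) x)"
      using assms v by (intro has_partial_imp_partial has_partial_sum
        has_partial_linear[OF bounded_linear_clifford_mult(1)] smooth_on_has_partial[OF smooth_on_partial[OF smooth_on_partial]]) auto
    finally show ?thesis .
  qed
  have "dirac m (laplace m f) x = (\<Sum>i=0..m. \<e> i * laplace m (partial (\<e> i) f) x)"
    unfolding dirac_def using partial_laplace[OF assms(1) _ assms(2)] by (intro sum.cong refl) simp
  also have "\<dots> = (\<Sum>i=0..m. \<Sum>j=0..m. \<e> i * partial (\<e> j) (partial (\<e> j) (partial (\<e> i) f)) x)"
    by (simp add: laplace_def sum_distrib_left)
  also have "\<dots> = (\<Sum>j=0..m. \<Sum>i=0..m. \<e> i * partial (\<e> j) (partial (\<e> j) (partial (\<e> i) f)) x)"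
    by (rule sum.swap)
  also have "\<dots> = laplace m (dirac m f) x"
    unfolding laplace_def using eq by (intro sum.cong refl) simp
  finally show ?thesis .
qed

lemma dirac_laplace_funpow_commute:
  assumes "smooth_on (cunits m) S f" "x \<in> S"
  shows "dirac m ((laplace m ^^ k) f) x = (laplace m ^^ k) (dirac m f) x"
  using assms(2)
proof (induction k arbitrary: x)
  case (Suc k)
  have "dirac m (laplace m ((laplace m ^^ k) f)) x = laplace m (dirac m ((laplace m ^^ k) f)) x"
    by (rule dirac_laplace_commute[OF smooth_on_laplace_funpow[OF assms(1)] Suc.prems])
  also have "\<dots> = laplace m ((laplace m ^^ k) (dirac m f)) x"
    by (rule laplace_cong[OF dir_open_open[OF S] Suc.IH Suc.prems])
  finally show ?case by simp
qed simp

text \<open>\<open>clifford_trace\<close> for the array of second derivatives, which is symmetric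
  because \<open>f\<close> is smooth on an open set.\<close>

lemma dirac_conj_dirac:
  assumes "smooth_on (cunits m) S f" "x \<in> S" "m \<le> CARD('n)"
  shows "dirac_conj m (dirac m f) x = laplace m f x"
proof -
  have "dirac_conj m (dirac m f) x =
      (\<Sum>j=0..m. cunit_conj j * (\<Sum>i=0..m. \<e> i * partial (\<e> j) (partial (\<e> i) f) x))"
    unfolding dirac_conj_eq using partial_dirac[OF assms(1) _ assms(2)] by (intro sum.cong refl) simp
  also have "\<dots> = laplace m f x"
    unfolding laplace_def
    by (rule clifford_trace)
      (use cunit_conj_relations(1)[where 'n = 'n] partial_commute[OF S assms(2,1)] assms(3) in auto)
  finally show ?thesis .
qed

end

section \<open>Axially symmetric functions\<close>

text \<open>The reflection maps \<open>v\<close> to \<open>s *\<^sub>R v\<close> with s = 1 or s =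
  -1; differentiating the symmetry of \<open>E\<close> gives \<open>s\<close> times the reflected
  derivative on the left, and s * s = 1 moves \<open>s\<close> to the right.\<close>

lemma partial_reflect_snd:
  fixes E :: "'a::real_normed_vector \<times> real \<Rightarrow> 'b::real_normed_vector"
  assumes "open U" "\<And>z. z \<in> U \<Longrightarrow> (fst z, - snd z) \<in> U"
    and "\<And>z. z \<in> U \<Longrightarrow> E (fst z, - snd z) = c *\<^sub>R E z"
    and "smooth_on B U E" "v \<in> B" "snd v = 0 \<and> s = 1 \<or> v = (0, 1) \<and> s = -1" "z \<in> U"
  shows "partial v E (fst z, - snd z) = (c * s) *\<^sub>R partial v E z"
proof -
  let ?m = "\<lambda>z::'a \<times> real. (fst z, - snd z)"
  have m: "?m (z + t *\<^sub>R v) = ?m z + t *\<^sub>R (s *\<^sub>R v)" for t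
    using assms(6) by (cases v) auto
  have "has_partial (s *\<^sub>R v) E (?m z) (s *\<^sub>R partial v E (?m z))"
    using assms by (intro has_partial_scaleR_dir smooth_on_has_partial) auto
  then have "has_partial v (\<lambda>z. E (?m z)) z (s *\<^sub>R partial v E (?m z))"
    unfolding has_partial_def by (simp only: m)
  then have "has_partial v (\<lambda>z. c *\<^sub>R E z) z (s *\<^sub>R partial v E (?m z))"
    using has_partial_cong[OF dir_open_open[OF assms(1)] assms(7), of v "{v}" "\<lambda>z. E (?m z)" "\<lambda>z. c *\<^sub>R E z"] assms(3) by auto
  moreover have "has_partial v (\<lambda>z. c *\<^sub>R E z) z (c *\<^sub>R partial v E z)"
    using assms by (intro has_partial_linear[OF bounded_linear_scaleR_right] smooth_on_has_partial)
  ultimately have "s *\<^sub>R partial v E (?m z) = c *\<^sub>R partial v E z"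
    using has_partial_imp_partial by metis
  then have "s *\<^sub>R (s *\<^sub>R partial v E (?m z)) = s *\<^sub>R (c *\<^sub>R partial v E z)" by simp
  moreover have "s * s = 1" using assms(6) by auto
  ultimately show ?thesis by (simp add: mult.commute)
qed

locale symmetric_slice_domain =
  fixes p q :: nat and D :: "('n::finite clifford \<times> real) set"
  assumes card: "CARD('n) = p + q" and sym: "symmetric_domain p D"
begin

text \<open>
  To differentiate on open sets of the whole algebra, everything is extended so as to be constant in the directions
  orthogonal to the paravectors.
\<close>

definition D_ext :: "('n clifford \<times> real) set" where
  "D_ext = {z. (part_p p (fst z), snd z) \<in> D}"

definition \<Omega>_ext :: "'n clifford set" where
  "\<Omega>_ext = {x. (part_p p x, norm (part_q p q x)) \<in> D}"

definition lift :: "('n clifford \<times> real \<Rightarrow> 'n clifford) \<Rightarrow> 'n clifford \<Rightarrow> 'n clifford" where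
  "lift E x = E (part_p p x, norm (part_q p q x))"

text \<open>Evenness makes d_r E odd, hence divisible by r, and it hides the kink of |x_q| at x_q =
  0.\<close>

definition even_smooth :: "('n clifford \<times> real \<Rightarrow> 'n clifford) \<Rightarrow> bool" where
  "even_smooth E \<longleftrightarrow> smooth_on (coord_dirs p) D_ext E \<and> (\<forall>z\<in>D_ext. E (fst z, - snd z) = E z)"

text \<open>At r = 0 this is the second derivative d_r d_r E, the limit of (1/r) d_r E.\<close>

definition radial_deriv :: "('n clifford \<times> real \<Rightarrow> 'n clifford) \<Rightarrow> 'n clifford \<times> real \<Rightarrow> 'n clifford" where
  "radial_deriv E = quot_snd (partial (0, 1) E)"

lemma bounded_linear_part_p: "bounded_linear (part_p p :: 'n clifford \<Rightarrow> 'n clifford)"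
  unfolding part_p_def[abs_def] linear_conv_bounded_linear[symmetric]
  by (auto intro!: linearI simp: inner_add_left algebra_simps sum.distrib scaleR_sum_right)

lemma bounded_linear_part_q: "bounded_linear (part_q p q :: 'n clifford \<Rightarrow> 'n clifford)"
  unfolding part_q_def[abs_def] linear_conv_bounded_linear[symmetric]
  by (auto intro!: linearI simp: inner_add_left algebra_simps sum.distrib scaleR_sum_right)

lemma inner_cunit': "i \<le> p + q \<Longrightarrow> j \<le> p + q \<Longrightarrow> (\<e> i :: 'n clifford) \<bullet> \<e> j = (if i = j then 1 else 0)"
  using inner_cunit[where 'n = 'n] card by simp

lemma part_cunit:
  "i \<le> p \<Longrightarrow> part_p p (\<e> i :: 'n clifford) = \<e> i"
  "i \<in> {p+1..p+q} \<Longrightarrow> part_p p (\<e> i :: 'n clifford) = 0"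
  "i \<le> p \<Longrightarrow> part_q p q (\<e> i :: 'n clifford) = 0"
  "i \<in> {p+1..p+q} \<Longrightarrow> part_q p q (\<e> i :: 'n clifford) = \<e> i"
proof -
  have *: "(\<Sum>j\<in>I. ((\<e> i :: 'n clifford) \<bullet> \<e> j) *\<^sub>R \<e> j) = (if i \<in> I then \<e> i else 0)"
    if "I \<subseteq> {0..p+q}" "i \<le> p + q" "finite I" for I i
  proof -
    have "(\<Sum>j\<in>I. ((\<e> i :: 'n clifford) \<bullet> \<e> j) *\<^sub>R \<e> j) = (\<Sum>j\<in>I. if i = j then \<e> j else 0)"
      using that by (intro sum.cong refl) (auto simp: inner_cunit')
    then show ?thesis using that(3) by simp
  qed
  show "i \<le> p \<Longrightarrow> part_p p (\<e> i :: 'n clifford) = \<e> i"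
    "i \<in> {p+1..p+q} \<Longrightarrow> part_p p (\<e> i :: 'n clifford) = 0"
    "i \<le> p \<Longrightarrow> part_q p q (\<e> i :: 'n clifford) = 0"
    "i \<in> {p+1..p+q} \<Longrightarrow> part_q p q (\<e> i :: 'n clifford) = \<e> i"
    unfolding part_p_def part_q_def by (subst *; force)+
qed

lemma part_add_scale:
  "i \<le> p \<Longrightarrow> part_p p (x + t *\<^sub>R \<e> i :: 'n clifford) = part_p p x + t *\<^sub>R \<e> i"
  "i \<in> {p+1..p+q} \<Longrightarrow> part_p p (x + t *\<^sub>R \<e> i :: 'n clifford) = part_p p x"
  "i \<le> p \<Longrightarrow> part_q p q (x + t *\<^sub>R \<e> i :: 'n clifford) = part_q p q x"
  "i \<in> {p+1..p+q} \<Longrightarrow> part_q p q (x + t *\<^sub>R \<e> i :: 'n clifford) = part_q p q x + t *\<^sub>R \<e> i"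
  using part_cunit[of i]
  by (simp_all add: linear_add[OF bounded_linear.linear[OF bounded_linear_part_p]]
    linear_scale[OF bounded_linear.linear[OF bounded_linear_part_p]]
    linear_add[OF bounded_linear.linear[OF bounded_linear_part_q]]
    linear_scale[OF bounded_linear.linear[OF bounded_linear_part_q]])

lemma part_p_space_p: "x \<in> space_p p \<Longrightarrow> part_p p x = (x :: 'n clifford)"
  unfolding space_p_def
proof (induction rule: span_induct_alt)
  case base
  then show ?case by (simp add: part_p_def)
next
  case (step c x y)
  then obtain i where i: "i \<le> p" "x = \<e> i" by auto
  have "part_p p (y + c *\<^sub>R x) = part_p p y + c *\<^sub>R x"
    unfolding i(2) by (rule part_add_scale(1)[OF i(1)])
  then show ?case using step by (simp add: add.commute)
qed

lemma part_p_in_space_p: "part_p p x \<in> (space_p p :: 'n clifford set)"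
  unfolding part_p_def space_p_def by (intro span_sum span_scale span_base) auto

lemma part_p_idem [simp]: "part_p p (part_p p x) = (part_p p x :: 'n clifford)"
  by (intro part_p_space_p part_p_in_space_p)

lemma continuous_on_part [continuous_intros]:
  "continuous_on S g \<Longrightarrow> continuous_on S (\<lambda>x. part_p p (g x) :: 'n clifford)"
  "continuous_on S g \<Longrightarrow> continuous_on S (\<lambda>x. part_q p q (g x) :: 'n clifford)"
  by (intro bounded_linear.continuous_on[OF bounded_linear_part_p]
      bounded_linear.continuous_on[OF bounded_linear_part_q]; assumption)+

lemma open_D_ext: "open D_ext"
proof -
  obtain T where T: "open T" "D = (space_p p \<times> UNIV) \<inter> T"
    using sym unfolding symmetric_domain_def openin_open by blast
  have "(part_p p a, b) \<in> D \<longleftrightarrow> (part_p p a, b) \<in> T" for a b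
    using T(2) part_p_in_space_p by blast
  then have "D_ext = (\<lambda>z. (part_p p (fst z), snd z)) -` T"
    by (auto simp: D_ext_def)
  moreover have "open ((\<lambda>z :: 'n clifford \<times> real. (part_p p (fst z), snd z)) -` T)"
    by (intro open_vimage T(1) continuous_intros)
  ultimately show ?thesis by simp
qed

lemma \<Omega>_ext_iff: "x \<in> \<Omega>_ext \<longleftrightarrow> (part_p p x, norm (part_q p q x)) \<in> D_ext"
  by (simp add: \<Omega>_ext_def D_ext_def)

lemma open_\<Omega>_ext: "open \<Omega>_ext"
proof -
  have "\<Omega>_ext = (\<lambda>x. (part_p p x, norm (part_q p q x))) -` D_ext"
    by (auto simp: \<Omega>_ext_iff)
  also have "open \<dots>"
    by (intro open_vimage open_D_ext continuous_intros)
  finally show ?thesis .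
qed

lemma D_ext_reflect: "z \<in> D_ext \<Longrightarrow> (fst z, - snd z) \<in> D_ext"
  using sym by (auto simp: D_ext_def symmetric_domain_def)

lemma coord_dirs_mem: "i \<le> p \<Longrightarrow> (\<e> i :: 'n clifford, 0) \<in> coord_dirs p" "(0 :: 'n clifford, 1) \<in> coord_dirs p"
  by (auto simp: coord_dirs_def)

lemma coord_dirs_subset: "coord_dirs p \<subseteq> insert (0, 1) ((\<lambda>w :: 'n clifford. (w, 0)) ` UNIV)"
  by (auto simp: coord_dirs_def)

lemma even_smooth_smooth: "even_smooth E \<Longrightarrow> smooth_on (coord_dirs p) D_ext E"
  by (simp add: even_smooth_def)

lemma even_smooth_partial_p:
  assumes "even_smooth E" "i \<le> p"
  shows "even_smooth (partial (\<e> i, 0) E)"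
  unfolding even_smooth_def
proof (intro conjI ballI)
  show "smooth_on (coord_dirs p) D_ext (partial (\<e> i, 0) E)"
    using assms coord_dirs_mem(1) by (intro smooth_on_partial even_smooth_smooth)
  fix z assume "z \<in> D_ext"
  then show "partial (\<e> i, 0) E (fst z, - snd z) = partial (\<e> i, 0) E z"
    using partial_reflect_snd[OF open_D_ext D_ext_reflect, where E = E and c = 1 and s = 1 and v = "(\<e> i, 0)" and z = z and B = "coord_dirs p"]
      assms coord_dirs_mem(1)[of i] by (simp add: even_smooth_def)
qed

lemma partial_r_odd:
  assumes "even_smooth E" "z \<in> D_ext"
  shows "partial (0, 1) E (fst z, - snd z) = - partial (0, 1) E z"
  using partial_reflect_snd[OF open_D_ext D_ext_reflect, where E = E and c = 1 and s = "-1" and v = "(0, 1)" and z = z and B = "coord_dirs p"]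
    assms coord_dirs_mem(2) by (simp add: even_smooth_def)

lemma odd_zero:
  fixes H :: "'n clifford \<times> real \<Rightarrow> 'n clifford"
  assumes "\<And>z. z \<in> D_ext \<Longrightarrow> H (fst z, - snd z) = - H z" "z \<in> D_ext" "snd z = 0"
  shows "H z = 0"
proof -
  have "(fst z, - snd z) = z" using assms(3) by (cases z) simp
  then have "H z = - H z" using assms(1)[OF assms(2)] by simp
  then have "2 *\<^sub>R H z = 0" by (simp add: scaleR_2 eq_neg_iff_add_eq_0)
  then show ?thesis by simp
qed

lemma even_smooth_quot_snd:
  assumes "smooth_on (coord_dirs p) D_ext H" "\<And>z. z \<in> D_ext \<Longrightarrow> H (fst z, - snd z) = - H z"
  shows "even_smooth (quot_snd H)" "z \<in> D_ext \<Longrightarrow> H z = snd z *\<^sub>R quot_snd H z"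
proof -
  show "even_smooth (quot_snd H)"
    unfolding even_smooth_def
  proof (intro conjI ballI)
    show "smooth_on (coord_dirs p) D_ext (quot_snd H)"
      using odd_zero[of H] assms
      by (intro smooth_on_quot_snd[OF open_D_ext coord_dirs_subset coord_dirs_mem(2)]) auto
    fix z assume "z \<in> D_ext"
    then show "quot_snd H (fst z, - snd z) = quot_snd H z"
      using assms(2)[of z] by (cases z) (auto simp: quot_snd_def)
  qed
  show "z \<in> D_ext \<Longrightarrow> H z = snd z *\<^sub>R quot_snd H z"
    using odd_zero[of H z] assms by (auto simp: quot_snd_def)
qed

lemma even_smooth_radial_deriv: "even_smooth E \<Longrightarrow> even_smooth (radial_deriv E)"
  unfolding radial_deriv_def
  by (rule even_smooth_quot_snd(1)) (auto simp: partial_r_odd intro: smooth_on_partial even_smooth_smooth coord_dirs_mem)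

lemma partial_r_eq: "even_smooth E \<Longrightarrow> z \<in> D_ext \<Longrightarrow> partial (0, 1) E z = snd z *\<^sub>R radial_deriv E z"
  unfolding radial_deriv_def
  by (rule even_smooth_quot_snd(2)) (auto simp: partial_r_odd intro: smooth_on_partial even_smooth_smooth coord_dirs_mem)

lemma continuous_on_lift: "continuous_on D_ext E \<Longrightarrow> continuous_on \<Omega>_ext (lift E)"
  unfolding lift_def[abs_def]
  by (rule continuous_on_compose2[where f = "\<lambda>x. (part_p p x, norm (part_q p q x))"])
    (auto simp: \<Omega>_ext_iff intro!: continuous_intros)

lemma lift_partial_p:
  assumes "even_smooth E" "i \<le> p" "x \<in> \<Omega>_ext"
  shows "has_partial (\<e> i) (lift E) x (lift (partial (\<e> i, 0) E) x)"
proof -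
  have "has_partial (\<e> i, 0) E (part_p p x, norm (part_q p q x)) (partial (\<e> i, 0) E (part_p p x, norm (part_q p q x)))"
    using assms by (intro smooth_on_has_partial[OF even_smooth_smooth] coord_dirs_mem) (auto simp: \<Omega>_ext_iff)
  then show ?thesis
    unfolding has_partial_def lift_def by (simp add: part_add_scale assms(2))
qed

text \<open>The chain rule for |x_q| gives the factor x_i / |x_q|, whose denominator
  \<open>radial_deriv\<close> absorbs. At x_q = 0 the norm along e_i is |t|; evenness replaces it by
  t, and the odd function d_r E vanishes at r = 0.\<close>

lemma lift_partial_q:
  assumes "even_smooth E" "i \<in> {p+1..p+q}" "x \<in> \<Omega>_ext"
  shows "has_partial (\<e> i) (lift E) x ((x \<bullet> \<e> i) *\<^sub>R lift (radial_deriv E) x)"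
proof -
  define y where "y = part_q p q x"
  define xp where "xp = part_p p x"
  define r where "r = norm y"
  have z: "(xp, r) \<in> D_ext" using assms(3) by (simp add: \<Omega>_ext_iff xp_def r_def y_def)
  have yi: "y \<bullet> \<e> i = x \<bullet> \<e> i"
  proof -
    have "y \<bullet> \<e> i = (\<Sum>j=p+1..p+q. if j = i then x \<bullet> \<e> i else 0)"
      unfolding y_def part_q_def inner_sum_left using assms(2)
      by (intro sum.cong refl) (auto simp: inner_cunit')
    then show ?thesis using assms(2) by simp
  qed
  have Er: "((\<lambda>s. E (xp, s)) has_vector_derivative partial (0, 1) E (xp, r)) (at r)"
  proof -
    have "has_partial (0, 1) E ((xp, 0) + r *\<^sub>R (0, 1)) (partial (0, 1) E (xp, r))"
      using smooth_on_has_partial[OF even_smooth_smooth[OF assms(1)] coord_dirs_mem(2) z] by simp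
    then show ?thesis unfolding has_partial_at by simp
  qed
  have "((\<lambda>t. E (xp, norm (y + t *\<^sub>R \<e> i))) has_vector_derivative (x \<bullet> \<e> i) *\<^sub>R radial_deriv E (xp, r)) (at 0)"
  proof (cases "y = 0")
    case False
    then have "r > 0" by (simp add: r_def)
    have "((\<lambda>t. (y + t *\<^sub>R \<e> i) \<bullet> (y + t *\<^sub>R \<e> i)) has_real_derivative 2 * (y \<bullet> \<e> i)) (at 0)"
      unfolding inner_add inner_scaleR_left inner_scaleR_right
      by (auto intro!: derivative_eq_intros simp: inner_commute)
    then have "((\<lambda>t. norm (y + t *\<^sub>R \<e> i)) has_real_derivative (y \<bullet> \<e> i) / r) (at 0)"
      unfolding norm_eq_sqrt_inner using False
      by (auto intro!: derivative_eq_intros simp: r_def norm_eq_sqrt_inner divide_simps leD[OF inner_ge_zero])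
    then have "((\<lambda>s. E (xp, s)) \<circ> (\<lambda>t. norm (y + t *\<^sub>R \<e> i)) has_vector_derivative
        ((y \<bullet> \<e> i) / r) *\<^sub>R partial (0, 1) E (xp, r)) (at 0)"
      using Er by (intro vector_diff_chain_at) (simp_all add: has_real_derivative_iff_has_vector_derivative r_def)
    then show ?thesis
      using partial_r_eq[OF assms(1) z] \<open>r > 0\<close> by (simp add: o_def yi)
  next
    case True
    then have r0: "r = 0" by (simp add: r_def)
    have "norm (\<e> i :: 'n clifford) = 1"
      using inner_cunit'[of i i] assms(2) by (simp add: norm_eq_sqrt_inner)
    then have norm: "norm (y + t *\<^sub>R \<e> i) = \<bar>t\<bar>" for t using True by simp
    have "open ((\<lambda>t. (xp, t)) -` D_ext)"
      by (intro open_vimage open_D_ext continuous_intros)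
    then have "((\<lambda>t. E (xp, norm (y + t *\<^sub>R \<e> i))) has_vector_derivative partial (0, 1) E (xp, r)) (at 0)"
    proof (rule has_vector_derivative_transform_within_open[rotated])
      show "E (xp, t) = E (xp, norm (y + t *\<^sub>R \<e> i))" if "t \<in> (\<lambda>t. (xp, t)) -` D_ext" for t
        using that assms(1) unfolding norm even_smooth_def by (cases "t \<ge> 0") auto
    qed (use z Er r0 in auto)
    moreover have "partial (0, 1) E (xp, r) = 0"
      using partial_r_eq[OF assms(1) z] r0 by simp
    moreover have "x \<bullet> \<e> i = 0" using True by (simp flip: yi)
    ultimately show ?thesis by simp
  qed
  then show ?thesis
    unfolding has_partial_def lift_def
    by (simp only: part_add_scale(2,4)[OF assms(2)] xp_def y_def r_def)
qed

text \<open>Every derivative of a lift is a lift of an even smooth function, or a coordinate times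
  such a lift, so induction on the order closes.\<close>

lemma smooth_on_lift:
  assumes "even_smooth E"
  shows "smooth_on (cunits (p + q)) \<Omega>_ext (lift E)"
proof -
  have "Ck_on k (cunits (p + q)) \<Omega>_ext (lift E)" for k
    using assms
  proof (induction k arbitrary: E)
    case 0
    then show ?case
      by (simp add: continuous_on_lift smooth_on_continuous[OF even_smooth_smooth])
  next
    case (Suc k)
    show ?case
    proof (rule Ck_on_SucI[OF dir_open_open[OF open_\<Omega>_ext], where
        g = "\<lambda>v. if v \<in> cunits p then lift (partial (v, 0) E) else (\<lambda>x. (x \<bullet> v) *\<^sub>R lift (radial_deriv E) x)"])
      show "continuous_on \<Omega>_ext (lift E)"
        using Suc.prems by (simp add: continuous_on_lift smooth_on_continuous[OF even_smooth_smooth])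
      fix v :: "'n clifford" assume v: "v \<in> cunits (p + q)"
      show "(\<forall>x\<in>\<Omega>_ext. has_partial v (lift E) x
          ((if v \<in> cunits p then lift (partial (v, 0) E) else (\<lambda>x. (x \<bullet> v) *\<^sub>R lift (radial_deriv E) x)) x)) \<and>
        Ck_on k (cunits (p + q)) \<Omega>_ext (if v \<in> cunits p then lift (partial (v, 0) E) else (\<lambda>x. (x \<bullet> v) *\<^sub>R lift (radial_deriv E) x))"
      proof (cases "v \<in> cunits p")
        case True
        then obtain i where "i \<le> p" "v = \<e> i" by auto
        then show ?thesis
          using True lift_partial_p[OF Suc.prems] Suc.IH[OF even_smooth_partial_p[OF Suc.prems]] by simp
      next
        case False
        obtain i where "i \<le> p + q" "v = \<e> i" using v by auto
        with False have i: "i \<in> {p+1..p+q}" "v = \<e> i" by (auto simp: not_le[symmetric])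
        have "Ck_on k (cunits (p + q)) \<Omega>_ext (\<lambda>x. (x \<bullet> v) *\<^sub>R lift (radial_deriv E) x)"
          by (intro Ck_on_bilinear[OF dir_open_open[OF open_\<Omega>_ext] bounded_bilinear_scaleR]
              Ck_on_bounded_linear[OF dir_open_open[OF open_\<Omega>_ext]] bounded_linear_inner_left
              Suc.IH even_smooth_radial_deriv Suc.prems)
        then show ?thesis
          using False lift_partial_q[OF Suc.prems i(1)] i(2) by simp
      qed
    qed
  qed
  then show ?thesis by (simp add: smooth_on_def)
qed

end

section \<open>Weinstein operators, the Laplacian of lifts, and the Dirac operator on slice
  functions\<close>

context symmetric_slice_domain
begin

text \<open>
  On functions \<open>E(x\<^sub>p, |x\<^sub>q|)\<close> the Laplacian acts as \<open>weinstein (q - 1)\<close>.  Writing \<open>S\<close> for \<open>radial_deriv\<close>, that is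
  \<open>(1/r) \<partial>\<^sub>r\<close>, the operators \<open>L\<^sub>a = \<Delta> + a S\<close> satisfy \<open>S L\<^sub>a = L\<^sub>a\<^sub>+\<^sub>2 S\<close>.
\<close>

definition weinstein :: "real \<Rightarrow> ('n clifford \<times> real \<Rightarrow> 'n clifford) \<Rightarrow> 'n clifford \<times> real \<Rightarrow> 'n clifford" where
  "weinstein a E z = (\<Sum>i=0..p. partial (\<e> i, 0) (partial (\<e> i, 0) E) z) +
     partial (0, 1) (partial (0, 1) E) z + a *\<^sub>R radial_deriv E z"

lemma partial_snd_scaleR:
  assumes "smooth_on (coord_dirs p) D_ext G" "v \<in> coord_dirs p" "z \<in> D_ext"
    and "\<And>z. z \<in> D_ext \<Longrightarrow> H z = snd z *\<^sub>R G z"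
  shows "partial v H z = snd z *\<^sub>R partial v G z + snd v *\<^sub>R G z"
proof -
  have "has_partial v snd z (snd v)"
    unfolding has_partial_def by (auto intro!: derivative_eq_intros)
  from has_partial_bilinear[OF bounded_bilinear_scaleR this smooth_on_has_partial[OF assms(1-3)]]
  have "partial v (\<lambda>z. snd z *\<^sub>R G z) z = snd z *\<^sub>R partial v G z + snd v *\<^sub>R G z"
    by (rule has_partial_imp_partial)
  then show ?thesis
    using partial_cong[OF dir_open_open[OF open_D_ext] assms(3), of v "{v}", OF _ assms(4)] by simp
qed

text \<open>Product rule applied to d_r E = r S E, followed by d_r (S E) = r S (S E).\<close>

lemma partial_rr_eq:
  assumes "even_smooth E" "z \<in> D_ext"
  shows "partial (0, 1) (partial (0, 1) E) z = radial_deriv E z + (snd z)\<^sup>2 *\<^sub>R radial_deriv (radial_deriv E) z"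
  using partial_snd_scaleR[OF even_smooth_smooth[OF even_smooth_radial_deriv[OF assms(1)]] coord_dirs_mem(2) assms(2) partial_r_eq[OF assms(1)]]
    partial_r_eq[OF even_smooth_radial_deriv[OF assms(1)] assms(2)]
  by (simp add: power2_eq_square add.commute)

text \<open>By continuity, equations multiplied by \<open>r\<close> can be divided by \<open>r\<close> even at \<open>r = 0\<close>.\<close>

lemma cancel_snd:
  fixes G :: "'n clifford \<times> real \<Rightarrow> 'n clifford"
  assumes "continuous_on D_ext G" "\<And>z. z \<in> D_ext \<Longrightarrow> snd z *\<^sub>R G z = 0" "z \<in> D_ext"
  shows "G z = 0"
proof (cases "snd z = 0")
  case True
  have "isCont G z" using assms(1,3) open_D_ext by (simp add: continuous_on_eq_continuous_at)
  then have "((\<lambda>t. G (z + t *\<^sub>R (0, 1))) \<longlongrightarrow> G z) (at 0)"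
    by (rule isCont_tendsto_compose) (auto intro!: tendsto_eq_intros simp flip: zero_prod_def)
  moreover have "\<forall>\<^sub>F t in at 0. z + t *\<^sub>R (0, 1) \<in> D_ext"
    using dir_open_open[OF open_D_ext, of "{(0, 1)}"] assms(3) by (simp add: dir_open_def)
  then have "\<forall>\<^sub>F t in at 0. G (z + t *\<^sub>R (0, 1)) = 0"
    using eventually_neq_at_within[of 0 0 UNIV]
  proof eventually_elim
    case (elim t)
    then show ?case using assms(2)[OF elim(1)] True by simp
  qed
  ultimately show ?thesis
    using tendsto_eventually tendsto_unique by (metis at_neq_bot)
next
  case False
  then show ?thesis using assms(2)[OF assms(3)] by simp
qed

lemma continuous_on_weinstein:
  assumes "even_smooth E"
  shows "continuous_on D_ext (weinstein a E)"
proof -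
  note sE = even_smooth_smooth[OF assms]
  have "smooth_on (coord_dirs p) D_ext (partial v (partial v E))" if "v \<in> coord_dirs p" for v
    using sE that by (intro smooth_on_partial)
  from smooth_on_continuous[OF this] show ?thesis
    unfolding weinstein_def[abs_def]
    using coord_dirs_mem smooth_on_continuous[OF even_smooth_smooth[OF even_smooth_radial_deriv[OF assms]]]
    by (intro continuous_on_add continuous_on_sum continuous_on_scaleR continuous_on_const) auto
qed

lemma weinstein_add: "weinstein (a + b) E z = weinstein a E z + b *\<^sub>R radial_deriv E z"
  by (simp add: weinstein_def scaleR_add_left)

text \<open>From d_r d_r (r B) = r d_r d_r B + 2 d_r B and d_r B = r S B, the equation for H = r B
  is r times the equation for B with index a + 2. It serves twice: for F2 = r B with a = 0, and for
  d_r E = r S E.\<close>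

lemma weinstein_quotient:
  assumes B: "even_smooth B" and H: "\<And>z. z \<in> D_ext \<Longrightarrow> H z = snd z *\<^sub>R B z"
    and eq: "\<And>z. z \<in> D_ext \<Longrightarrow> (\<Sum>i=0..p. partial (\<e> i, 0) (partial (\<e> i, 0) H) z) +
      partial (0, 1) (partial (0, 1) H) z + a *\<^sub>R partial (0, 1) B z = 0"
    and "z \<in> D_ext"
  shows "weinstein (a + 2) B z = 0"
proof (rule cancel_snd[OF continuous_on_weinstein[OF B] _ assms(4)])
  fix z assume z: "z \<in> D_ext"
  have sB: "smooth_on (coord_dirs p) D_ext B" using even_smooth_smooth[OF B] .
  have 1: "partial (\<e> i, 0) (partial (\<e> i, 0) H) z = snd z *\<^sub>R partial (\<e> i, 0) (partial (\<e> i, 0) B) z" if "i \<le> p" for i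
  proof -
    have v: "(\<e> i :: 'n clifford, 0) \<in> coord_dirs p" using coord_dirs_mem(1)[OF that] .
    have "partial (\<e> i, 0) H y = snd y *\<^sub>R partial (\<e> i, 0) B y" if "y \<in> D_ext" for y
      using partial_snd_scaleR[OF sB v that H] by simp
    from partial_snd_scaleR[OF smooth_on_partial[OF sB v] v z this] show ?thesis by simp
  qed
  have r: "partial (0, 1) H y = snd y *\<^sub>R partial (0, 1) B y + B y" if "y \<in> D_ext" for y
    using partial_snd_scaleR[OF sB coord_dirs_mem(2) that H] by simp
  have 2: "partial (0, 1) (partial (0, 1) H) z = snd z *\<^sub>R partial (0, 1) (partial (0, 1) B) z + 2 *\<^sub>R partial (0, 1) B z"
  proof -
    have s: "smooth_on (coord_dirs p) D_ext (partial (0, 1) B)" using smooth_on_partial[OF sB coord_dirs_mem(2)] .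
    have "has_partial (0, 1) (\<lambda>z. snd z) z (1::real)"
      unfolding has_partial_def by (auto intro!: derivative_eq_intros)
    from has_partial_add[OF has_partial_bilinear[OF bounded_bilinear_scaleR this smooth_on_has_partial[OF s coord_dirs_mem(2) z]]
        smooth_on_has_partial[OF sB coord_dirs_mem(2) z]]
    have "partial (0, 1) (\<lambda>y. snd y *\<^sub>R partial (0, 1) B y + B y) z =
        snd z *\<^sub>R partial (0, 1) (partial (0, 1) B) z + 2 *\<^sub>R partial (0, 1) B z"
      by (simp add: has_partial_imp_partial scaleR_2)
    then show ?thesis
      using partial_cong[OF dir_open_open[OF open_D_ext] z, of "(0, 1)" "{(0, 1)}", OF _ r] by simp
  qed
  have "(\<Sum>i=0..p. partial (\<e> i, 0) (partial (\<e> i, 0) H) z) =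
      snd z *\<^sub>R (\<Sum>i=0..p. partial (\<e> i, 0) (partial (\<e> i, 0) B) z)"
    using 1 by (simp add: scaleR_sum_right)
  then show "snd z *\<^sub>R weinstein (a + 2) B z = 0"
    using eq[OF z] 2 partial_r_eq[OF B z] by (simp add: weinstein_def algebra_simps)
qed

text \<open>The r-derivative of L_a E = 0 is the hypothesis of \<open>weinstein_quotient\<close> for
  H = d_r E and B = S E. Only this consequence of S L_a = L_(a+2) S on null solutions is
  used.\<close>

lemma weinstein_radial_deriv:
  assumes E: "even_smooth E" and L: "\<And>z. z \<in> D_ext \<Longrightarrow> weinstein a E z = 0" and "z \<in> D_ext"
  shows "weinstein (a + 2) (radial_deriv E) z = 0"
proof (rule weinstein_quotient[OF even_smooth_radial_deriv[OF E] partial_r_eq[OF E] _ assms(3)])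
  fix z assume z: "z \<in> D_ext"
  note sE = even_smooth_smooth[OF E]
  note U = dir_open_open[OF open_D_ext]
  have c: "partial (0, 1) (partial (\<e> i, 0) (partial (\<e> i, 0) E)) z =
      partial (\<e> i, 0) (partial (\<e> i, 0) (partial (0, 1) E)) z" if "i \<le> p" for i
  proof -
    have v: "(\<e> i :: 'n clifford, 0) \<in> coord_dirs p" using coord_dirs_mem(1)[OF that] .
    have "partial (0, 1) (partial (\<e> i, 0) (partial (\<e> i, 0) E)) z = partial (\<e> i, 0) (partial (0, 1) (partial (\<e> i, 0) E)) z"
      using partial_commute[OF open_D_ext z smooth_on_partial[OF sE v] coord_dirs_mem(2) v] .
    also have "\<dots> = partial (\<e> i, 0) (partial (\<e> i, 0) (partial (0, 1) E)) z"
      using partial_commute[OF open_D_ext _ sE coord_dirs_mem(2) v] by (intro partial_cong[OF U z v])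
    finally show ?thesis .
  qed
  have "partial (0, 1) (weinstein a E) z = 0"
  proof -
    have "partial (0, 1) (weinstein a E) z = partial (0, 1) (\<lambda>z. 0 :: 'n clifford) z"
      by (rule partial_cong[OF U z coord_dirs_mem(2) L])
    also have "\<dots> = 0" by (rule has_partial_imp_partial) (simp add: has_partial_def)
    finally show ?thesis .
  qed
  moreover have "partial (0, 1) (weinstein a E) z =
      (\<Sum>i=0..p. partial (0, 1) (partial (\<e> i, 0) (partial (\<e> i, 0) E)) z) +
      partial (0, 1) (partial (0, 1) (partial (0, 1) E)) z + a *\<^sub>R partial (0, 1) (radial_deriv E) z"
    unfolding weinstein_def[abs_def]
    by (intro has_partial_imp_partial has_partial_add has_partial_sum has_partial_linear[OF bounded_linear_scaleR_right]
        smooth_on_has_partial[OF _ coord_dirs_mem(2) z] smooth_on_partial sE even_smooth_smooth[OF even_smooth_radial_deriv[OF E]] coord_dirs_mem) simp_all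
  ultimately show "(\<Sum>i=0..p. partial (\<e> i, 0) (partial (\<e> i, 0) (partial (0, 1) E)) z) +
      partial (0, 1) (partial (0, 1) (partial (0, 1) E)) z + a *\<^sub>R partial (0, 1) (radial_deriv E) z = 0"
    using c by simp
qed

lemma sum_cunit_split: "(\<Sum>i=0..p+q. h i) = (\<Sum>i=0..p. h i) + (\<Sum>i=p+1..p+q. h i)"
  for h :: "nat \<Rightarrow> 'c::comm_monoid_add"
  using sum.ub_add_nat[of 0 p h q] by simp

lemma norm_part_q_square: "(norm (part_q p q x :: 'n clifford))\<^sup>2 = (\<Sum>i=p+1..p+q. (x \<bullet> \<e> i)\<^sup>2)"
proof -
  have "part_q p q x \<bullet> part_q p q x = (\<Sum>i=p+1..p+q. \<Sum>j=p+1..p+q. if j = i then (x \<bullet> \<e> i) * (x \<bullet> \<e> i) else 0)"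
    unfolding part_q_def inner_sum_left inner_sum_right
    by (intro sum.cong refl) (auto simp: inner_cunit')
  then show ?thesis unfolding power2_norm_eq_inner by (simp add: power2_eq_square)
qed

lemma cunit_mult_neg:
  assumes "i \<in> {1..p+q}" "j \<in> {1..p+q}"
  shows "(\<e> i * \<e> j + \<e> j * \<e> i :: 'n clifford) = (if i = j then -2 else 0)"
  using clifford_relations[where 'n = 'n] assms card by auto

text \<open>\<open>clifford_trace\<close> for the products x_i x_j, with - e_i as the conjugate of
  e_i.\<close>

lemma part_q_mult_self: "part_q p q x * part_q p q x = - ((norm (part_q p q x))\<^sup>2 *\<^sub>R (1 :: 'n clifford))"
proof -
  let ?I = "{p+1..p+q}"
  let ?M = "\<lambda>i j. ((x \<bullet> \<e> i) * (x \<bullet> \<e> j)) *\<^sub>R (1 :: 'n clifford)"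
  have rel: "\<e> j * - \<e> i + \<e> i * - \<e> j = (if i = j then 2 else (0 :: 'n clifford))"
    if "i \<in> ?I" "j \<in> ?I" for i j
  proof -
    have "\<e> j * - \<e> i + \<e> i * - \<e> j = - (\<e> i * \<e> j + \<e> j * \<e> i :: 'n clifford)" by simp
    also have "\<dots> = (if i = j then 2 else 0)"
      using that by (subst cunit_mult_neg) auto
    finally show ?thesis .
  qed
  have "(\<Sum>j\<in>?I. \<e> j * (\<Sum>i\<in>?I. - \<e> i * ?M i j)) = (\<Sum>i\<in>?I. ?M i i)"
    by (rule clifford_trace) (use rel in \<open>auto simp: mult.commute\<close>)
  moreover have "part_q p q x * part_q p q x = - (\<Sum>j\<in>?I. \<e> j * (\<Sum>i\<in>?I. - \<e> i * ?M i j))"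
    unfolding part_q_def by (simp add: sum_distrib_left sum_distrib_right sum_negf scaleR_sum_right)
      (rule sum.swap)
  moreover have "(\<Sum>i\<in>?I. ?M i i) = (norm (part_q p q x))\<^sup>2 *\<^sub>R 1"
    unfolding norm_part_q_square by (simp add: scaleR_sum_left power2_eq_square)
  ultimately show ?thesis by simp
qed

text \<open>The unit e_0 commutes with e_j for j > p, whereas e_1, ..., e_p anticommute with it.
  Moving the x_p units past x_q thus produces the conjugate operator, the one in the equation for
  F2.\<close>

lemma cunit_mult_part_q:
  assumes "i \<le> p"
  shows "\<e> i * part_q p q x = part_q p q x * (cunit_conj i :: 'n clifford)"
proof -
  have "\<e> i * \<e> j = \<e> j * (cunit_conj i :: 'n clifford)" if "j \<in> {p+1..p+q}" for j
    using cunit_mult_neg[of i j] that assms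
    by (cases "i = 0") (auto simp: cunit_conj_def cunit_def[of 0] eq_neg_iff_add_eq_0)
  then show ?thesis
    unfolding part_q_def by (simp add: sum_distrib_left sum_distrib_right)
qed

text \<open>Each direction e_i with i > p contributes x_i^2 S S E + S E. Their sum is r^2 S S E + q
  S E, and r^2 S S E = d_r d_r E - S E, so one unit of q is used up.\<close>

lemma laplace_lift:
  assumes E: "even_smooth E" and x: "x \<in> \<Omega>_ext"
  shows "laplace (p + q) (lift E) x = lift (weinstein (real q - 1) E) x"
proof -
  let ?z = "(part_p p x, norm (part_q p q x))"
  have z: "?z \<in> D_ext" using x by (simp add: \<Omega>_ext_iff)
  note U = dir_open_open[OF open_\<Omega>_ext]
  have 1: "partial (\<e> i) (partial (\<e> i) (lift E)) x = lift (partial (\<e> i, 0) (partial (\<e> i, 0) E)) x" if "i \<le> p" for i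
  proof -
    have "partial (\<e> i) (partial (\<e> i) (lift E)) x = partial (\<e> i) (lift (partial (\<e> i, 0) E)) x"
      using lift_partial_p[OF E that] by (intro partial_cong[OF U x, of _ "{\<e> i}"] has_partial_imp_partial) auto
    also have "\<dots> = lift (partial (\<e> i, 0) (partial (\<e> i, 0) E)) x"
      by (intro has_partial_imp_partial lift_partial_p even_smooth_partial_p E that x)
    finally show ?thesis .
  qed
  have 2: "partial (\<e> i) (partial (\<e> i) (lift E)) x =
      (x \<bullet> \<e> i)\<^sup>2 *\<^sub>R lift (radial_deriv (radial_deriv E)) x + lift (radial_deriv E) x" if i: "i \<in> {p+1..p+q}" for i
  proof -
    have "partial (\<e> i) (partial (\<e> i) (lift E)) x = partial (\<e> i) (\<lambda>x. (x \<bullet> \<e> i) *\<^sub>R lift (radial_deriv E) x) x"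
      using lift_partial_q[OF E i] by (intro partial_cong[OF U x, of _ "{\<e> i}"] has_partial_imp_partial) auto
    also have "has_partial (\<e> i) (\<lambda>x. x \<bullet> \<e> i) x ((\<e> i :: 'n clifford) \<bullet> \<e> i)"
      unfolding has_partial_def inner_add_left inner_scaleR_left
      by (auto intro!: derivative_eq_intros simp flip: has_real_derivative_iff_has_vector_derivative)
    from has_partial_bilinear[OF bounded_bilinear_scaleR this lift_partial_q[OF even_smooth_radial_deriv[OF E] i x]]
    have "partial (\<e> i) (\<lambda>x. (x \<bullet> \<e> i) *\<^sub>R lift (radial_deriv E) x) x =
        (x \<bullet> \<e> i)\<^sup>2 *\<^sub>R lift (radial_deriv (radial_deriv E)) x + lift (radial_deriv E) x"
      using i inner_cunit'[of i i] by (simp add: has_partial_imp_partial power2_eq_square)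
    finally show ?thesis .
  qed
  have "laplace (p + q) (lift E) x = (\<Sum>i=0..p. lift (partial (\<e> i, 0) (partial (\<e> i, 0) E)) x) +
      (\<Sum>i=p+1..p+q. (x \<bullet> \<e> i)\<^sup>2 *\<^sub>R lift (radial_deriv (radial_deriv E)) x + lift (radial_deriv E) x)"
    unfolding laplace_def sum_cunit_split using 1 2 by (intro arg_cong2[where f = "(+)"] sum.cong refl) auto
  also have "(\<Sum>i=p+1..p+q. (x \<bullet> \<e> i)\<^sup>2 *\<^sub>R lift (radial_deriv (radial_deriv E)) x + lift (radial_deriv E) x) =
      (norm (part_q p q x))\<^sup>2 *\<^sub>R lift (radial_deriv (radial_deriv E)) x + real q *\<^sub>R lift (radial_deriv E) x"
    by (simp add: sum.distrib norm_part_q_square scaleR_sum_left sum_constant_scaleR del: sum_constant)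
  finally show ?thesis
    using partial_rr_eq[OF E z] by (simp add: lift_def[abs_def] weinstein_def algebra_simps)
qed

text \<open>The function S^j B is annihilated by L_(2 + 2 j); since L_(q - 1) = L_(2 + 2 j) + (q - 3
  - 2 j) S, each Laplacian just applies S and contributes one scalar factor.\<close>

lemma laplace_funpow_lift:
  assumes B: "even_smooth B" and L: "\<And>z. z \<in> D_ext \<Longrightarrow> weinstein 2 B z = 0" and "x \<in> \<Omega>_ext"
  shows "(laplace (p + q) ^^ j) (lift B) x = (\<Prod>k<j. real q - 3 - 2 * real k) *\<^sub>R lift ((radial_deriv ^^ j) B) x"
proof -
  have ev: "even_smooth ((radial_deriv ^^ j) B)" for j
    using B by (induction j) (auto intro: even_smooth_radial_deriv)
  have LS: "weinstein (2 + 2 * real j) ((radial_deriv ^^ j) B) z = 0" if "z \<in> D_ext" for j z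
    using that
  proof (induction j arbitrary: z)
    case (Suc j)
    have "weinstein (2 + 2 * real j + 2) (radial_deriv ((radial_deriv ^^ j) B)) z = 0"
      by (rule weinstein_radial_deriv[OF ev Suc.IH Suc.prems])
    then show ?case by (simp add: algebra_simps)
  qed (simp add: L)
  show ?thesis using assms(3)
  proof (induction j arbitrary: x)
    case (Suc j)
    let ?c = "\<Prod>k<j. real q - 3 - 2 * real k" and ?E = "(radial_deriv ^^ j) B"
    let ?z = "(part_p p x, norm (part_q p q x))"
    have z: "?z \<in> D_ext" using Suc.prems by (simp add: \<Omega>_ext_iff)
    have "(laplace (p + q) ^^ Suc j) (lift B) x = laplace (p + q) (\<lambda>x. ?c *\<^sub>R lift ?E x) x"
      using laplace_cong[OF dir_open_open[OF open_\<Omega>_ext] Suc.IH Suc.prems] by simp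
    also have "\<dots> = ?c *\<^sub>R lift (weinstein (real q - 1) ?E) x"
      using laplace_scaleR[OF open_\<Omega>_ext smooth_on_lift[OF ev] Suc.prems] laplace_lift[OF ev Suc.prems] by simp
    also have "weinstein (real q - 1) ?E ?z = weinstein (2 + 2 * real j) ?E ?z + (real q - 3 - 2 * real j) *\<^sub>R radial_deriv ?E ?z"
      using weinstein_add[of "2 + 2 * real j" "real q - 3 - 2 * real j"] by simp
    then have "lift (weinstein (real q - 1) ?E) x = (real q - 3 - 2 * real j) *\<^sub>R lift (radial_deriv ?E) x"
      using LS[OF z] by (simp add: lift_def)
    finally show ?case by simp
  qed simp
qed

text \<open>The x_p directions give B + r^2 S B - x_q S A by the two equations. The x_q directions
  give x_q S A - q B + x_q x_q S B, where - q B comes from e_i e_i = -1. Since x_q x_q = - r^2, only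
  (1 - q) B survives.\<close>

lemma dirac_lift:
  assumes A: "even_smooth A" and B: "even_smooth B"
    and E1: "\<And>z. z \<in> D_ext \<Longrightarrow> (\<Sum>i=0..p. \<e> i * partial (\<e> i, 0) A z) = B z + (snd z)\<^sup>2 *\<^sub>R radial_deriv B z"
    and E2: "\<And>z. z \<in> D_ext \<Longrightarrow> (\<Sum>i=0..p. cunit_conj i * partial (\<e> i, 0) B z) = - radial_deriv A z"
    and x: "x \<in> \<Omega>_ext"
  shows "dirac (p + q) (\<lambda>x. lift A x + part_q p q x * lift B x) x = (1 - real q) *\<^sub>R lift B x"
proof -
  let ?f = "\<lambda>x. lift A x + part_q p q x * lift B x" and ?y = "part_q p q x"
  have z: "(part_p p x, norm ?y) \<in> D_ext" using x by (simp add: \<Omega>_ext_iff)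
  have hq: "has_partial v (part_q p q) x (part_q p q v)" for v :: "'n clifford"
  proof -
    have "((\<lambda>t. part_q p q x + t *\<^sub>R part_q p q v) has_vector_derivative part_q p q v) (at 0)"
      by (auto intro!: derivative_eq_intros)
    then show ?thesis
      by (simp add: has_partial_def linear_add[OF bounded_linear.linear[OF bounded_linear_part_q]]
          linear_scale[OF bounded_linear.linear[OF bounded_linear_part_q]])
  qed
  have 1: "\<e> i * partial (\<e> i) ?f x = \<e> i * lift (partial (\<e> i, 0) A) x +
      ?y * (cunit_conj i * lift (partial (\<e> i, 0) B) x)" if "i \<le> p" for i
  proof -
    have "partial (\<e> i) ?f x = lift (partial (\<e> i, 0) A) x + ?y * lift (partial (\<e> i, 0) B) x"
      using has_partial_add[OF lift_partial_p[OF A that x]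
          has_partial_bilinear[OF bounded_bilinear_clifford_mult hq lift_partial_p[OF B that x]]]
        part_cunit(3)[OF that] by (simp add: has_partial_imp_partial)
    then show ?thesis
      using cunit_mult_part_q[OF that, of x] by (simp add: distrib_left flip: mult.assoc)
  qed
  have 2: "\<e> i * partial (\<e> i) ?f x = ((x \<bullet> \<e> i) *\<^sub>R \<e> i) * lift (radial_deriv A) x - lift B x +
      ((x \<bullet> \<e> i) *\<^sub>R \<e> i) * (?y * lift (radial_deriv B) x)" if i: "i \<in> {p+1..p+q}" for i
  proof -
    have "partial (\<e> i) ?f x = (x \<bullet> \<e> i) *\<^sub>R lift (radial_deriv A) x + (?y * ((x \<bullet> \<e> i) *\<^sub>R lift (radial_deriv B) x) + \<e> i * lift B x)"
      using has_partial_add[OF lift_partial_q[OF A i x]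
          has_partial_bilinear[OF bounded_bilinear_clifford_mult hq lift_partial_q[OF B i x]]]
        part_cunit(4)[OF i] by (simp add: has_partial_imp_partial)
    moreover have "\<e> i * \<e> i = (- 1 :: 'n clifford)"
    proof -
      have "2 *\<^sub>R (\<e> i * \<e> i) = 2 *\<^sub>R (- 1 :: 'n clifford)"
        using cunit_mult_neg[of i i] i by (simp add: scaleR_2)
      then show ?thesis by (simp only: scaleR_cancel_left) simp
    qed
    then have "\<e> i * (\<e> i * lift B x) = - lift B x" by (simp flip: mult.assoc)
    ultimately show ?thesis by (simp add: distrib_left)
  qed
  have "dirac (p + q) ?f x = (\<Sum>i=0..p. \<e> i * lift (partial (\<e> i, 0) A) x + ?y * (cunit_conj i * lift (partial (\<e> i, 0) B) x)) +
      (\<Sum>i=p+1..p+q. ((x \<bullet> \<e> i) *\<^sub>R \<e> i) * lift (radial_deriv A) x - lift B x + ((x \<bullet> \<e> i) *\<^sub>R \<e> i) * (?y * lift (radial_deriv B) x))"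
    unfolding dirac_def sum_cunit_split using 1 2 by (intro arg_cong2[where f = "(+)"] sum.cong refl) auto
  also have "(\<Sum>i=0..p. \<e> i * lift (partial (\<e> i, 0) A) x + ?y * (cunit_conj i * lift (partial (\<e> i, 0) B) x)) =
      lift B x + (norm ?y)\<^sup>2 *\<^sub>R lift (radial_deriv B) x - ?y * lift (radial_deriv A) x"
    using E1[OF z] E2[OF z] by (simp add: lift_def sum.distrib flip: sum_distrib_left)
  also have "(\<Sum>i=p+1..p+q. ((x \<bullet> \<e> i) *\<^sub>R \<e> i) * lift (radial_deriv A) x - lift B x + ((x \<bullet> \<e> i) *\<^sub>R \<e> i) * (?y * lift (radial_deriv B) x)) =
      ?y * lift (radial_deriv A) x - real q *\<^sub>R lift B x + ?y * (?y * lift (radial_deriv B) x)"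
  proof -
    have "?y * h = (\<Sum>i=p+1..p+q. ((x \<bullet> \<e> i) *\<^sub>R \<e> i) * h)" for h
      unfolding part_q_def by (rule sum_distrib_right)
    then show ?thesis by (simp only: sum.distrib sum_subtractf sum_constant_scaleR) simp
  qed
  also have "?y * (?y * lift (radial_deriv B) x) = - ((norm ?y)\<^sup>2 *\<^sub>R lift (radial_deriv B) x)"
    by (simp add: part_q_mult_self flip: mult.assoc)
  finally show ?thesis by (simp add: algebra_simps)
qed

end

section \<open>Extension of stem functions to open sets\<close>

context symmetric_slice_domain
begin

definition ext :: "('n clifford \<times> real \<Rightarrow> 'n clifford) \<Rightarrow> 'n clifford \<times> real \<Rightarrow> 'n clifford" where
  "ext F z = F (part_p p (fst z), snd z)"

lemma continuous_on_ext: "continuous_on D F \<Longrightarrow> continuous_on D_ext (ext F)"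
  unfolding ext_def[abs_def]
  by (rule continuous_on_compose2[where f = "\<lambda>z. (part_p p (fst z), snd z)"])
    (auto simp: D_ext_def intro!: continuous_intros)

lemma has_partial_ext:
  assumes "Ck_on 1 (coord_dirs p) D F" "z \<in> D_ext" "b \<in> coord_dirs p"
  shows "has_partial b (ext F) z (ext (partial b F) z)"
proof -
  have "part_p p (fst z + t *\<^sub>R fst b) = part_p p (fst z) + t *\<^sub>R fst b" for t
    using assms(3) part_add_scale(1) by (auto simp: coord_dirs_def)
  then have "ext F (z + t *\<^sub>R b) = F ((part_p p (fst z), snd z) + t *\<^sub>R b)" for t
    by (cases b) (simp add: ext_def)
  moreover have "has_partial b F (part_p p (fst z), snd z) (partial b F (part_p p (fst z), snd z))"
    using assms by (simp add: has_partial_partial_iff D_ext_def)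
  ultimately show ?thesis
    by (simp add: has_partial_def ext_def)
qed

lemma has_partial_ext_0:
  assumes "b \<in> Basis - coord_dirs p"
  shows "has_partial b (ext F) z 0"
proof -
  obtain u where u: "b = (u, 0)" "u \<in> Basis"
    using assms by (auto simp: Basis_prod_def coord_dirs_def)
  have "u \<bullet> \<e> i = 0" if "i \<in> {0..p}" for i
  proof (rule inner_not_same_Basis[OF u(2) cunit_Basis])
    show "u \<noteq> \<e> i" using assms u(1) that by (auto simp: coord_dirs_def)
  qed (use that card in auto)
  then have "part_p p u = 0" by (simp add: part_p_def)
  then have "ext F (z + t *\<^sub>R b) = ext F z" for t
    using u(1) by (simp add: ext_def linear_add[OF bounded_linear.linear[OF bounded_linear_part_p]]
      linear_scale[OF bounded_linear.linear[OF bounded_linear_part_p]])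
  then show ?thesis by (simp add: has_partial_def)
qed

lemma Ck_on_ext:
  assumes "Ck_on 1 (coord_dirs p) D F"
  shows "Ck_on 1 Basis D_ext (ext F)"
  unfolding One_nat_def
proof (rule Ck_on_SucI[OF dir_open_open[OF open_D_ext],
    where g = "\<lambda>b. if b \<in> coord_dirs p then ext (partial b F) else (\<lambda>z. 0)"])
  show "continuous_on D_ext (ext F)"
    using assms by (intro continuous_on_ext) simp
  fix b :: "'n clifford \<times> real" assume b: "b \<in> Basis"
  show "(\<forall>z\<in>D_ext. has_partial b (ext F) z ((if b \<in> coord_dirs p then ext (partial b F) else (\<lambda>z. 0)) z)) \<and>
      Ck_on 0 Basis D_ext (if b \<in> coord_dirs p then ext (partial b F) else (\<lambda>z. 0))"
    using assms b has_partial_ext[OF assms] has_partial_ext_0[of b F]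
    by (auto intro!: continuous_on_ext)
qed

end

section \<open>Stem functions\<close>

locale slice_stem = symmetric_slice_domain p q D
  for p q :: nat and D :: "('n::finite clifford \<times> real) set" +
  fixes F1 F2 :: "'n clifford \<times> real \<Rightarrow> 'n clifford"
  assumes C1: "Ck_on 1 (coord_dirs p) D F1" "Ck_on 1 (coord_dirs p) D F2"
    and parity: "\<And>xp r. (xp, r) \<in> D \<Longrightarrow> F1 (xp, - r) = F1 (xp, r) \<and> F2 (xp, - r) = - F2 (xp, r)"
    and Cauchy_Riemann: "\<And>xp r. (xp, r) \<in> D \<Longrightarrow>
      dirac p (\<lambda>y. F1 (y, r)) xp - partial 1 (\<lambda>s. F2 (xp, s)) r = 0 \<and>
      dirac_conj p (\<lambda>y. F2 (y, r)) xp + partial 1 (\<lambda>s. F1 (xp, s)) r = 0"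
begin

definition "A = ext F1"
definition "G = ext F2"
definition "B = quot_snd G"

lemma partial_A_G:
  assumes "z \<in> D_ext" "b \<in> coord_dirs p"
  shows "partial b A z = ext (partial b F1) z" "partial b G z = ext (partial b F2) z"
  unfolding A_def G_def using has_partial_ext assms C1 by (blast intro: has_partial_imp_partial)+

lemma system_A_G:
  assumes "z \<in> D_ext"
  shows "(\<Sum>i=0..p. \<e> i * partial (\<e> i, 0) A z) = partial (0, 1) G z"
    "(\<Sum>i=0..p. cunit_conj i * partial (\<e> i, 0) G z) = - partial (0, 1) A z"
proof -
  let ?x = "part_p p (fst z)" and ?r = "snd z"
  have D: "(?x, ?r) \<in> D" using assms by (simp add: D_ext_def)
  have 1: "partial (\<e> i) (\<lambda>y. F (y, ?r)) ?x = partial (\<e> i, 0) F (?x, ?r)" for i F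
    by (simp add: partial_def)
  have 2: "partial 1 (\<lambda>s. F (?x, s)) ?r = partial (0, 1) F (?x, ?r)" for F
    by (simp add: partial_def)
  have A: "partial b A z = partial b F1 (?x, ?r)" and G: "partial b G z = partial b F2 (?x, ?r)"
    if "b \<in> coord_dirs p" for b
    using partial_A_G[OF assms that] by (simp_all add: ext_def)
  show "(\<Sum>i=0..p. \<e> i * partial (\<e> i, 0) A z) = partial (0, 1) G z"
    using Cauchy_Riemann[OF D] by (simp add: dirac_def 1 2 A G coord_dirs_mem)
  show "(\<Sum>i=0..p. cunit_conj i * partial (\<e> i, 0) G z) = - partial (0, 1) A z"
    using Cauchy_Riemann[OF D] by (simp add: dirac_conj_eq 1 2 A G coord_dirs_mem eq_neg_iff_add_eq_0)
qed

text \<open>Here C1 becomes smooth: the extensions live on an open set and are constant in the basis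
  directions outside \<open>coord_dirs p\<close>, so the mean value argument applies to
  them.\<close>

lemma smooth_A_G: "smooth_on (coord_dirs p) D_ext A" "smooth_on (coord_dirs p) D_ext G"
proof -
  have const: "partial b A z = 0 \<and> partial b G z = 0" if "b \<in> Basis - coord_dirs p" for b z
    using has_partial_ext_0[OF that] unfolding A_def G_def by (blast intro: has_partial_imp_partial)
  have p: "p \<le> CARD('n)" using card by simp
  have C: "Ck_on 1 Basis D_ext A" "Ck_on 1 Basis D_ext G"
    unfolding A_def G_def by (intro Ck_on_ext C1)+
  show "smooth_on (coord_dirs p) D_ext A"
    by (rule generalized_Cauchy_Riemann_smooth(1)[OF p open_D_ext C const system_A_G])
  show "smooth_on (coord_dirs p) D_ext G"
    by (rule generalized_Cauchy_Riemann_smooth(2)[OF p open_D_ext C const system_A_G])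
qed

lemma even_smooth_A: "even_smooth A"
  using smooth_A_G(1) parity by (simp add: even_smooth_def A_def ext_def D_ext_def)

lemma G_odd: "z \<in> D_ext \<Longrightarrow> G (fst z, - snd z) = - G z"
  using parity by (simp add: G_def ext_def D_ext_def)

lemma even_smooth_B: "even_smooth B"
  unfolding B_def by (rule even_smooth_quot_snd(1)[where H = G, OF smooth_A_G(2)]) (rule G_odd)

lemma G_eq: "z \<in> D_ext \<Longrightarrow> G z = snd z *\<^sub>R B z"
  unfolding B_def by (rule even_smooth_quot_snd(2)[where H = G, OF smooth_A_G(2)]) (rule G_odd)

text \<open>The stem equations with F2 = r B inserted. The second one acquires a common factor r,
  removed by \<open>cancel_snd\<close>.\<close>

lemma system_A_B:
  assumes z: "z \<in> D_ext"
  shows "(\<Sum>i=0..p. \<e> i * partial (\<e> i, 0) A z) = B z + (snd z)\<^sup>2 *\<^sub>R radial_deriv B z"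
    and "(\<Sum>i=0..p. cunit_conj i * partial (\<e> i, 0) B z) = - radial_deriv A z"
proof -
  note sB = even_smooth_smooth[OF even_smooth_B]
  show "(\<Sum>i=0..p. \<e> i * partial (\<e> i, 0) A z) = B z + (snd z)\<^sup>2 *\<^sub>R radial_deriv B z"
    using system_A_G(1)[OF z] partial_snd_scaleR[OF sB coord_dirs_mem(2) z G_eq] partial_r_eq[OF even_smooth_B z]
    by (simp add: power2_eq_square add.commute)
  have "(\<Sum>i=0..p. cunit_conj i * partial (\<e> i, 0) B z) + radial_deriv A z = 0"
  proof (rule cancel_snd[OF _ _ z])
    have "smooth_on (coord_dirs p) D_ext (\<lambda>z. (\<Sum>i=0..p. cunit_conj i * partial (\<e> i, 0) B z) + radial_deriv A z)"
      using coord_dirs_mem even_smooth_smooth[OF even_smooth_radial_deriv[OF even_smooth_A]]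
      by (intro smooth_on_add smooth_on_sum smooth_on_linear[OF _ bounded_linear_clifford_mult(1)]
          smooth_on_partial sB dir_open_open[OF open_D_ext]) auto
    then show "continuous_on D_ext (\<lambda>z. (\<Sum>i=0..p. cunit_conj i * partial (\<e> i, 0) B z) + radial_deriv A z)"
      by (rule smooth_on_continuous)
    fix z assume z: "z \<in> D_ext"
    have "partial (\<e> i, 0) G z = snd z *\<^sub>R partial (\<e> i, 0) B z" if "i \<le> p" for i
      using partial_snd_scaleR[OF sB coord_dirs_mem(1)[OF that] z G_eq] by simp
    then have "(\<Sum>i=0..p. cunit_conj i * partial (\<e> i, 0) G z) =
        snd z *\<^sub>R (\<Sum>i=0..p. cunit_conj i * partial (\<e> i, 0) B z)"
      by (simp add: scaleR_sum_right)
    then show "snd z *\<^sub>R ((\<Sum>i=0..p. cunit_conj i * partial (\<e> i, 0) B z) + radial_deriv A z) = 0"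
      using system_A_G(2)[OF z] partial_r_eq[OF even_smooth_A z]
      by (simp only: scaleR_add_right) (simp add: neg_eq_iff_add_eq_0 add.commute)
  qed
  then show "(\<Sum>i=0..p. cunit_conj i * partial (\<e> i, 0) B z) = - radial_deriv A z"
    by (simp add: eq_neg_iff_add_eq_0)
qed

text \<open>Applying the Dirac operator in x_p to the equation for G gives - d_r of the equation for
  A, hence - d_r d_r G. These second derivatives exist because smoothness has already been
  established.\<close>

lemma harmonic_G:
  assumes z: "z \<in> D_ext"
  shows "(\<Sum>i=0..p. partial (\<e> i, 0) (partial (\<e> i, 0) G) z) + partial (0, 1) (partial (0, 1) G) z = 0"
proof -
  note U = dir_open_open[OF open_D_ext] and sA = smooth_A_G(1) and sG = smooth_A_G(2)
  have part: "partial v (\<lambda>z. \<Sum>i=0..p. c i * partial (\<e> i, 0) F z) z = (\<Sum>i=0..p. c i * partial v (partial (\<e> i, 0) F) z)"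
    if "v \<in> coord_dirs p" "smooth_on (coord_dirs p) D_ext F" for c v and F :: "'n clifford \<times> real \<Rightarrow> 'n clifford"
    using that z coord_dirs_mem(1)
    by (intro has_partial_imp_partial has_partial_sum has_partial_linear[OF bounded_linear_clifford_mult(1)]
        smooth_on_has_partial[OF smooth_on_partial]) auto
  have "(\<Sum>i=0..p. partial (\<e> i, 0) (partial (\<e> i, 0) G) z) =
      (\<Sum>j=0..p. \<e> j * (\<Sum>i=0..p. cunit_conj i * partial (\<e> j, 0) (partial (\<e> i, 0) G) z))"
  proof (rule clifford_trace[symmetric])
    show "\<e> j * cunit_conj i + \<e> i * cunit_conj j = (if i = j then 2 else (0 :: 'n clifford))"
      if "i \<in> {0..p}" "j \<in> {0..p}" for i j
      using that card by (intro cunit_conj_relations(2)) auto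
    show "partial (\<e> j, 0) (partial (\<e> i, 0) G) z = partial (\<e> i, 0) (partial (\<e> j, 0) G) z"
      if "i \<in> {0..p}" "j \<in> {0..p}" for i j
      using that by (intro partial_commute[OF open_D_ext z sG] coord_dirs_mem(1)) auto
  qed simp
  also have "\<dots> = (\<Sum>j=0..p. \<e> j * - partial (0, 1) (partial (\<e> j, 0) A) z)"
  proof (intro sum.cong refl arg_cong2[where f = "(*)"])
    fix j assume "j \<in> {0..p}"
    then have v: "(\<e> j :: 'n clifford, 0) \<in> coord_dirs p" by (intro coord_dirs_mem(1)) simp
    have "(\<Sum>i=0..p. cunit_conj i * partial (\<e> j, 0) (partial (\<e> i, 0) G) z) =
        partial (\<e> j, 0) (\<lambda>z. \<Sum>i=0..p. cunit_conj i * partial (\<e> i, 0) G z) z"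
      by (rule part[OF v sG, symmetric])
    also have "\<dots> = partial (\<e> j, 0) (\<lambda>z. (-1) *\<^sub>R partial (0, 1) A z) z"
      by (rule partial_cong[OF U z v]) (simp add: system_A_G(2))
    also have "\<dots> = (-1) *\<^sub>R partial (\<e> j, 0) (partial (0, 1) A) z"
      by (rule partial_scaleR[OF smooth_on_has_partial[OF smooth_on_partial[OF sA coord_dirs_mem(2)] v z]])
    also have "\<dots> = - partial (0, 1) (partial (\<e> j, 0) A) z"
      using partial_commute[OF open_D_ext z sA v coord_dirs_mem(2)] by simp
    finally show "(\<Sum>i=0..p. cunit_conj i * partial (\<e> j, 0) (partial (\<e> i, 0) G) z) =
        - partial (0, 1) (partial (\<e> j, 0) A) z" .
  qed
  also have "\<dots> = - partial (0, 1) (\<lambda>z. \<Sum>i=0..p. \<e> i * partial (\<e> i, 0) A z) z"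
    unfolding part[OF coord_dirs_mem(2) sA] by (simp add: sum_negf)
  also have "partial (0, 1) (\<lambda>z. \<Sum>i=0..p. \<e> i * partial (\<e> i, 0) A z) z = partial (0, 1) (partial (0, 1) G) z"
    by (rule partial_cong[OF U z coord_dirs_mem(2) system_A_G(1)])
  finally show ?thesis by simp
qed

lemma weinstein_B: "z \<in> D_ext \<Longrightarrow> weinstein 2 B z = 0"
  using weinstein_quotient[OF even_smooth_B G_eq, of 0 z] harmonic_G by simp

definition "f_ext = (\<lambda>x. lift A x + part_q p q x * lift B x)"

lemma smooth_on_f_ext: "smooth_on (cunits (p + q)) \<Omega>_ext f_ext"
  unfolding f_ext_def
  by (intro smooth_on_add smooth_on_bilinear[OF _ bounded_bilinear_clifford_mult] smooth_on_lift
      smooth_on_bounded_linear bounded_linear_part_q dir_open_open[OF open_\<Omega>_ext] even_smooth_A even_smooth_B)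

lemma dirac_f_ext: "x \<in> \<Omega>_ext \<Longrightarrow> dirac (p + q) f_ext x = (1 - real q) *\<^sub>R lift B x"
  unfolding f_ext_def by (rule dirac_lift[OF even_smooth_A even_smooth_B system_A_B])

text \<open>For q = 1 the prefactor 1 - q is zero. For q = 2 m + 1 with m > 0 the factor of index m
  - 1 in the product is q - 3 - 2 (m - 1) = 0.\<close>

lemma laplace_funpow_lift_B:
  assumes "odd q" "x \<in> \<Omega>_ext"
  shows "(1 - real q) *\<^sub>R (laplace (p + q) ^^ ((q - 1) div 2)) (lift B) x = 0"
proof -
  obtain m where m: "q = 2 * m + 1" using assms(1) by (auto elim: oddE)
  show ?thesis
  proof (cases m)
    case 0
    then show ?thesis using m by simp
  next
    case (Suc k)
    then have "(\<Prod>i<m. real q - 3 - 2 * real i) = 0"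
      using m by (intro prod_zero) (auto intro!: bexI[of _ k])
    then show ?thesis
      using laplace_funpow_lift[OF even_smooth_B weinstein_B assms(2), of m] m by simp
  qed
qed

lemma dirac_laplace_f_ext:
  assumes "odd q" "x \<in> \<Omega>_ext"
  shows "dirac (p + q) ((laplace (p + q) ^^ ((q - 1) div 2)) f_ext) x = 0"
proof -
  let ?m = "(q - 1) div 2"
  have "dirac (p + q) ((laplace (p + q) ^^ ?m) f_ext) x = (laplace (p + q) ^^ ?m) (dirac (p + q) f_ext) x"
    by (rule dirac_laplace_funpow_commute[OF open_\<Omega>_ext smooth_on_f_ext assms(2)])
  also have "\<dots> = (laplace (p + q) ^^ ?m) (\<lambda>x. (1 - real q) *\<^sub>R lift B x) x"
    by (rule laplace_funpow_cong[OF dir_open_open[OF open_\<Omega>_ext] dirac_f_ext assms(2)])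
  also have "\<dots> = (1 - real q) *\<^sub>R (laplace (p + q) ^^ ?m) (lift B) x"
    by (rule laplace_funpow_scaleR[OF open_\<Omega>_ext smooth_on_lift[OF even_smooth_B] assms(2)])
  finally show ?thesis using laplace_funpow_lift_B[OF assms] by simp
qed

text \<open>The last of the Laplacians is split off as conjugate Dirac after Dirac; the inner Dirac
  image vanishes on all of \<open>\<Omega>_ext\<close>, so its derivatives vanish as well.\<close>

lemma laplace_funpow_f_ext:
  assumes "odd q" "x \<in> \<Omega>_ext"
  shows "(laplace (p + q) ^^ ((q + 1) div 2)) f_ext x = 0"
proof -
  let ?g = "(laplace (p + q) ^^ ((q - 1) div 2)) f_ext"
  have "(q + 1) div 2 = Suc ((q - 1) div 2)" using assms(1) by (auto elim: oddE)
  then have "(laplace (p + q) ^^ ((q + 1) div 2)) f_ext x = laplace (p + q) ?g x" by simp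
  also have "\<dots> = dirac_conj (p + q) (dirac (p + q) ?g) x"
    using card by (intro dirac_conj_dirac[OF open_\<Omega>_ext, symmetric]
      smooth_on_laplace_funpow[OF open_\<Omega>_ext] smooth_on_f_ext assms(2)) simp
  also have "\<dots> = 0"
  proof -
    have "partial v (dirac (p + q) ?g) x = 0" if v: "v \<in> cunits (p + q)" for v
    proof -
      have "partial v (dirac (p + q) ?g) x = partial v (\<lambda>x. 0 :: 'n clifford) x"
        by (rule partial_cong[OF dir_open_open[OF open_\<Omega>_ext] assms(2) v dirac_laplace_f_ext[OF assms(1)]])
      also have "\<dots> = 0" by (rule has_partial_imp_partial) (simp add: has_partial_def)
      finally show ?thesis .
    qed
    then show ?thesis by (simp add: dirac_conj_eq)
  qed
  finally show ?thesis .
qed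

end

section \<open>Geometry of the partially symmetric completion\<close>

context symmetric_slice_domain
begin

abbreviation "\<Omega> \<equiv> slice_completion p q D"

lemma space_q_part:
  assumes "w \<in> space_q p q"
  shows "part_p p w = (0 :: 'n clifford)" "part_q p q w = (w :: 'n clifford)"
proof -
  have "part_p p w = 0 \<and> part_q p q w = w"
    using assms unfolding space_q_def
  proof (induction rule: span_induct_alt)
    case base
    then show ?case by (simp add: part_p_def part_q_def)
  next
    case (step c x y)
    then obtain i where i: "i \<in> {p+1..p+q}" "x = \<e> i" by auto
    then show ?case
      using step part_add_scale(2,4)[OF i(1), of y c] by (simp add: add.commute)
  qed
  then show "part_p p w = 0" "part_q p q w = w" by auto
qed

lemma part_q_in_space_q: "part_q p q x \<in> (space_q p q :: 'n clifford set)"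
  unfolding part_q_def space_q_def by (intro span_sum span_scale span_base) auto

lemma part_q_space_p:
  assumes "x \<in> space_p p"
  shows "part_q p q x = (0 :: 'n clifford)"
  using assms unfolding space_p_def
proof (induction rule: span_induct_alt)
  case base
  then show ?case by (simp add: part_q_def)
next
  case (step c x y)
  then obtain i where i: "i \<le> p" "x = \<e> i" by auto
  then show ?case
    using step part_add_scale(3)[OF i(1), of y c] by (simp add: add.commute)
qed

text \<open>The sphere is defined algebraically by w w = -1; comparison with w w = - |w|^2 yields
  the Euclidean norm.\<close>

lemma norm_sphere_q:
  assumes "w \<in> sphere_q p q"
  shows "norm (w :: 'n clifford) = 1"
proof -
  have "w * w = - 1" "part_q p q w = w"
    using assms space_q_part(2) by (auto simp: sphere_q_def)
  then have "(norm w)\<^sup>2 *\<^sub>R (1 :: 'n clifford) = 1 *\<^sub>R 1"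
    using part_q_mult_self[of w] by simp
  then have "(norm w)\<^sup>2 = 1" by (simp only: scaleR_cancel_right) simp
  then show ?thesis using norm_ge_zero[of w] by (simp add: power2_eq_1_iff)
qed

lemma sphere_q_point:
  assumes "(xp, r) \<in> D" "w \<in> sphere_q p q" "r \<ge> 0"
  shows "part_p p (xp + r *\<^sub>R w) = xp" "part_q p q (xp + r *\<^sub>R w) = r *\<^sub>R w"
    "norm (r *\<^sub>R w :: 'n clifford) = r"
proof -
  have "D \<subseteq> space_p p \<times> UNIV"
    using sym by (auto simp: symmetric_domain_def dest: openin_imp_subset)
  then have xp: "xp \<in> space_p p" using assms(1) by auto
  have w: "w \<in> space_q p q" using assms(2) by (simp add: sphere_q_def)
  show "part_p p (xp + r *\<^sub>R w) = xp" "part_q p q (xp + r *\<^sub>R w) = r *\<^sub>R w"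
    using part_p_space_p[OF xp] part_q_space_p[OF xp] space_q_part[OF w]
    by (simp_all add: linear_add[OF bounded_linear.linear[OF bounded_linear_part_p]]
      linear_scale[OF bounded_linear.linear[OF bounded_linear_part_p]]
      linear_add[OF bounded_linear.linear[OF bounded_linear_part_q]]
      linear_scale[OF bounded_linear.linear[OF bounded_linear_part_q]])
  show "norm (r *\<^sub>R w) = r" using norm_sphere_q[OF assms(2)] assms(3) by simp
qed

lemma polar_form:
  assumes "q \<ge> 1"
  obtains w where "w \<in> sphere_q p q" "part_q p q x = norm (part_q p q x) *\<^sub>R (w :: 'n clifford)"
proof (cases "part_q p q x = 0")
  \<comment> \<open>Any unit serves when x_q = 0; e_(p+1) is available because q >= 1.\<close>
  case True
  have "\<e> (p + 1) \<in> (space_q p q :: 'n clifford set)"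
    using assms by (auto simp: space_q_def intro!: span_base)
  moreover have "\<e> (p + 1) * \<e> (p + 1) = (- 1 :: 'n clifford)"
  proof -
    have "2 *\<^sub>R (\<e> (p + 1) * \<e> (p + 1)) = 2 *\<^sub>R (- 1 :: 'n clifford)"
      using cunit_mult_neg[of "p + 1" "p + 1"] assms by (simp add: scaleR_2)
    then show ?thesis by (simp only: scaleR_cancel_left) simp
  qed
  ultimately show ?thesis using that[of "\<e> (p + 1)"] True by (simp add: sphere_q_def)
next
  case False
  let ?w = "part_q p q x /\<^sub>R norm (part_q p q x)"
  have "?w \<in> space_q p q"
    unfolding space_q_def using part_q_in_space_q[of x] by (intro span_scale) (simp add: space_q_def)
  moreover have "?w * ?w = - 1"
    using False by (simp add: part_q_mult_self power2_eq_square field_simps)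
  ultimately show ?thesis using that[of ?w] False by (simp add: sphere_q_def)
qed

text \<open>Polar decomposition of x_q removes the quantified unit. Thus Omega is the trace of the
  open set \<open>\<Omega>_ext\<close> on the paravectors.\<close>

lemma mem_slice_completion_iff:
  assumes "q \<ge> 1"
  shows "x \<in> \<Omega> \<longleftrightarrow> x \<in> \<Omega>_ext \<and> part_p p x + part_q p q x = x"
proof
  assume "x \<in> \<Omega>"
  then obtain xp r w where "x = xp + r *\<^sub>R w" "w \<in> sphere_q p q" "r \<ge> 0" "(xp, r) \<in> D"
    by (auto simp: slice_completion_def)
  then show "x \<in> \<Omega>_ext \<and> part_p p x + part_q p q x = x"
    using sphere_q_point[of xp r w] norm_sphere_q[of w] by (simp add: \<Omega>_ext_def)
next
  assume x: "x \<in> \<Omega>_ext \<and> part_p p x + part_q p q x = x"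
  obtain w where "w \<in> sphere_q p q" "part_q p q x = norm (part_q p q x) *\<^sub>R w"
    using polar_form[OF assms] .
  then show "x \<in> \<Omega>"
    using x unfolding slice_completion_def \<Omega>_ext_def by (metis (mono_tags, lifting) mem_Collect_eq norm_ge_zero)
qed

text \<open>Steps along e_0, ..., e_(p+q) do not leave the paravectors. This is what allows
  \<open>f\<close> to be replaced by its extension under iterated derivatives on Omega.\<close>

lemma dir_open_slice_completion:
  assumes "q \<ge> 1"
  shows "dir_open (cunits (p + q)) \<Omega>"
  unfolding dir_open_def
proof (intro ballI)
  fix x v assume x: "x \<in> \<Omega>" and v: "v \<in> (cunits (p + q) :: 'n clifford set)"
  have "\<forall>\<^sub>F t in at 0. x + t *\<^sub>R v \<in> \<Omega>_ext"
    using dir_open_open[OF open_\<Omega>_ext] x v mem_slice_completion_iff[OF assms] by (auto simp: dir_open_def)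
  moreover have "part_p p (x + t *\<^sub>R v) + part_q p q (x + t *\<^sub>R v) = x + t *\<^sub>R v" for t
  proof -
    obtain i where i: "i \<le> p + q" "v = \<e> i" using v by auto
    have "part_p p x + part_q p q x = x" using x mem_slice_completion_iff[OF assms] by blast
    then show ?thesis
      using part_add_scale[of i x t] i by (cases "i \<le> p") (auto simp: algebra_simps)
  qed
  ultimately show "\<forall>\<^sub>F t in at 0. x + t *\<^sub>R v \<in> \<Omega>"
    using mem_slice_completion_iff[OF assms] by simp
qed

lemma cinverse_part_q:
  assumes "part_q p q x \<noteq> (0 :: 'n clifford)"
  shows "cinverse (part_q p q x) * part_q p q x = 1"
proof -
  define y where "y = part_q p q x"
  \<comment> \<open>The inverse - y / |y|^2 comes from y y = - |y|^2; two-sided inverses are unique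
    by associativity, so the description in \<open>cinverse\<close> denotes it.\<close>
  define b where "b = - ((1 / (norm y)\<^sup>2) *\<^sub>R y)"
  have yb: "y * b = 1" "b * y = 1"
    using assms by (simp_all add: y_def b_def part_q_mult_self)
  have "c = b" if "y * c = 1 \<and> c * y = 1" for c
  proof -
    have "c = c * (y * b)" using yb by simp
    also have "\<dots> = (c * y) * b" by (simp only: mult.assoc)
    finally show ?thesis using that by simp
  qed
  then have "cinverse y = b"
    unfolding cinverse_def using yb by - (rule the_equality, blast+)
  then show ?thesis using yb by (simp add: y_def)
qed

end

section \<open>Identification of f and its spherical derivative\<close>

context slice_stem
begin

context
  fixes f :: "'n clifford \<Rightarrow> 'n clifford"
  assumes f: "\<And>xp r \<omega>. (xp, r) \<in> D \<Longrightarrow> r \<ge> 0 \<Longrightarrow> \<omega> \<in> sphere_q p q \<Longrightarrow>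
      f (xp + r *\<^sub>R \<omega>) = F1 (xp, r) + \<omega> * F2 (xp, r)"
    and q: "q \<ge> 1"
begin

text \<open>With F2 = r B the term w F2 becomes (r w) B = x_q B, which no longer depends on the
  choice of w when r = 0.\<close>

lemma f_eq_f_ext:
  assumes "x \<in> \<Omega>"
  shows "f x = f_ext x"
proof -
  obtain xp r w where x: "x = xp + r *\<^sub>R w" "w \<in> sphere_q p q" "r \<ge> 0" "(xp, r) \<in> D"
    using assms by (auto simp: slice_completion_def)
  note [simp] = sphere_q_point(1,2)[OF x(4,2,3)] norm_sphere_q[OF x(2)]
  have "part_p p xp = xp" using sphere_q_point(1)[OF x(4,2,3)] part_p_idem by metis
  moreover from this have "(xp, r) \<in> D_ext" using x(4) by (simp add: D_ext_def)
  ultimately have "F2 (xp, r) = r *\<^sub>R B (xp, r)" "F1 (xp, r) = A (xp, r)"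
    using G_eq[of "(xp, r)"] by (simp_all add: G_def A_def ext_def)
  then show ?thesis
    using f[OF x(4,3,2)] x(3) unfolding x(1) f_ext_def lift_def by simp
qed

text \<open>The reflected point has the same x_p and |x_q|, so the lift of A cancels and x_q B is
  doubled; the inverse and the factor 1/2 remove x_q and 2.\<close>

lemma spherical_quotient_eq:
  assumes "x \<in> \<Omega>" "part_q p q x \<noteq> 0"
  shows "spherical_quotient p q f x = lift B x"
proof -
  let ?y = "part_q p q x"
  let ?x' = "part_p p x - ?y"
  note lin = linear_diff[OF bounded_linear.linear[OF bounded_linear_part_p]]
    linear_diff[OF bounded_linear.linear[OF bounded_linear_part_q]]
  have x': "part_p p ?x' = part_p p x" "part_q p q ?x' = - ?y"
    using space_q_part[OF part_q_in_space_q[of x]] part_q_space_p[OF part_p_in_space_p[of x]]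
    by (simp_all add: lin)
  have "?x' \<in> \<Omega>"
    using assms(1) unfolding mem_slice_completion_iff[OF q] \<Omega>_ext_def by (simp add: x')
  then have "f x - f ?x' = 2 *\<^sub>R (?y * lift B x)"
    using assms(1) f_eq_f_ext by (simp add: f_ext_def lift_def x' scaleR_2)
  then show ?thesis
    using cinverse_part_q[OF assms(2)] by (simp add: spherical_quotient_def flip: mult.assoc)
qed

text \<open>Off x_q = 0 this is the quotient formula; at x_q = 0 the limit is identified by
  continuity of the lift of B.\<close>

lemma spherical_derivative_eq:
  assumes x: "x \<in> \<Omega>"
  shows "spherical_derivative p q \<Omega> f x = lift B x"
proof (cases "part_q p q x = 0")
  case False
  then show ?thesis using spherical_quotient_eq[OF x] by (simp add: spherical_derivative_def)
next
  case True
  let ?S = "{y \<in> \<Omega>. part_q p q y \<noteq> 0}"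
  have "isCont (lift B) x"
    using smooth_on_continuous[OF smooth_on_lift[OF even_smooth_B]] open_\<Omega>_ext x mem_slice_completion_iff[OF q]
    by (auto simp: continuous_on_eq_continuous_at)
  then have "(lift B \<longlongrightarrow> lift B x) (at x within ?S)"
    by (intro tendsto_within_subset[of _ _ _ UNIV ?S]) (auto simp: isCont_def)
  moreover have "\<forall>\<^sub>F y in at x within ?S. lift B y = spherical_quotient p q f y"
    using spherical_quotient_eq by (auto simp: eventually_at_filter intro!: always_eventually)
  ultimately have "(spherical_quotient p q f \<longlongrightarrow> lift B x) (at x within ?S)"
    by (rule Lim_transform_eventually)
  \<comment> \<open>\<open>Lim\<close> has a determined value only at a limit point of the set;
    points x + t e_(p+1) with small t different from 0 approach x.\<close>
  moreover have "at x within ?S \<noteq> bot"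
  proof -
    let ?v = "\<e> (p + 1) :: 'n clifford"
    have v: "?v \<in> cunits (p + q)" using q by auto
    have "norm ?v = 1" using inner_cunit'[of "p + 1" "p + 1"] q by (simp add: norm_eq_sqrt_inner)
    have "\<exists>y\<in>?S. y \<noteq> x \<and> dist y x < e" if "e > 0" for e
    proof -
      have "\<forall>\<^sub>F t in at 0. x + t *\<^sub>R ?v \<in> \<Omega>"
        using dir_open_slice_completion[OF q] x v by (auto simp: dir_open_def)
      moreover have "\<forall>\<^sub>F t in at 0. t \<noteq> (0::real) \<and> \<bar>t\<bar> < e"
        using \<open>e > 0\<close> by (auto simp: eventually_at intro!: exI[of _ e])
      ultimately have "\<forall>\<^sub>F t in at 0. x + t *\<^sub>R ?v \<in> \<Omega> \<and> t \<noteq> 0 \<and> \<bar>t\<bar> < e"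
        by (rule eventually_conj)
      then obtain t where t: "x + t *\<^sub>R ?v \<in> \<Omega>" "t \<noteq> 0" "\<bar>t\<bar> < e"
        using eventually_happens'[OF at_neq_bot] by blast
      have "part_q p q (x + t *\<^sub>R ?v) = t *\<^sub>R ?v"
        using True part_add_scale(4)[of "p + 1" x t] q by simp
      then show ?thesis
        using t \<open>norm ?v = 1\<close> by (intro bexI[of _ "x + t *\<^sub>R ?v"]) (auto simp: dist_norm)
    qed
    then show ?thesis
      unfolding trivial_limit_within islimpt_approachable by blast
  qed
  ultimately show ?thesis
    using True by (simp add: spherical_derivative_def tendsto_Lim)
qed

end

end

text \<open>Since \<open>partial\<close> and \<open>Lim\<close> are total, the two
  \<open>Ck_on\<close> clauses certify that the iterated derivatives are genuine and that the
  spherical derivative is the continuous extension. The highest derivatives that occur have order q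
  + 1 for f and q - 1 for its spherical derivative.\<close>

theorem theorem3p7:
  fixes p q :: nat
    and D :: "('n::finite clifford \<times> real) set"
    and f :: "'n clifford \<Rightarrow> 'n clifford"
  assumes "CARD('n) = p + q"
    and "odd q"
    and "symmetric_domain p D"
    and "partial_slice_regular p q D f"
  shows "let \<Omega> = slice_completion p q D; f\<^sub>s = spherical_derivative p q \<Omega> f; m = (q - 1) div 2 in
     Ck_on (q + 1) (\<e> ` {0..p+q}) \<Omega> f \<and> Ck_on (q - 1) (\<e> ` {0..p+q}) \<Omega> f\<^sub>s \<and>
     (\<forall>x\<in>\<Omega>.
        dirac (p + q) ((laplace (p + q) ^^ m) f) x = (1 - real q) *\<^sub>R (laplace (p + q) ^^ m) f\<^sub>s x \<and>
        (1 - real q) *\<^sub>R (laplace (p + q) ^^ m) f\<^sub>s x = 0) \<and>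
     (\<forall>x\<in>\<Omega>. (laplace (p + q) ^^ ((q + 1) div 2)) f x = 0)"
proof -
  obtain F1 F2 where F: "Ck_on 1 (coord_dirs p) D F1" "Ck_on 1 (coord_dirs p) D F2"
    "\<forall>(xp, r)\<in>D. F1 (xp, - r) = F1 (xp, r) \<and> F2 (xp, - r) = - F2 (xp, r)"
    "\<forall>(xp, r)\<in>D. dirac p (\<lambda>y. F1 (y, r)) xp - partial 1 (\<lambda>s. F2 (xp, s)) r = 0 \<and>
        dirac_conj p (\<lambda>y. F2 (y, r)) xp + partial 1 (\<lambda>s. F1 (xp, s)) r = 0"
    "\<forall>xp r \<omega>. (xp, r) \<in> D \<and> r \<ge> 0 \<and> \<omega> \<in> sphere_q p q \<longrightarrow>
        f (xp + r *\<^sub>R \<omega>) = F1 (xp, r) + \<omega> * F2 (xp, r)"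
    using assms(4) unfolding partial_slice_regular_def by blast
  interpret slice_stem p q D F1 F2
    by unfold_locales (use assms(1,3) F(1-4) in auto)
  have q: "q \<ge> 1" using assms(2) by (cases q) auto
  let ?fs = "spherical_derivative p q \<Omega> f" and ?m = "(q - 1) div 2"
  note dirO = dir_open_slice_completion[OF q]
  have f: "f x = f_ext x" and fs: "?fs x = lift B x" if "x \<in> \<Omega>" for x
    using that F(5) q f_eq_f_ext[of f x] spherical_derivative_eq[of f x] by blast+
  have sub: "\<Omega> \<subseteq> \<Omega>_ext" using mem_slice_completion_iff[OF q] by blast
  have "Ck_on (q + 1) (cunits (p + q)) \<Omega> f"
    by (rule Ck_on_cong[OF dirO, THEN iffD2, OF f], assumption)
      (rule Ck_on_subset[OF smooth_on_imp_Ck[OF smooth_on_f_ext] sub order_refl])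
  moreover have "Ck_on (q - 1) (cunits (p + q)) \<Omega> ?fs"
    by (rule Ck_on_cong[OF dirO, THEN iffD2, OF fs], assumption)
      (rule Ck_on_subset[OF smooth_on_imp_Ck[OF smooth_on_lift[OF even_smooth_B]] sub order_refl])
  moreover have "dirac (p + q) ((laplace (p + q) ^^ ?m) f) x = 0" if x: "x \<in> \<Omega>" for x
  proof -
    have "dirac (p + q) ((laplace (p + q) ^^ ?m) f) x = dirac (p + q) ((laplace (p + q) ^^ ?m) f_ext) x"
      by (rule dirac_cong[OF dirO laplace_funpow_cong[OF dirO f] x])
    then show ?thesis using dirac_laplace_f_ext[OF assms(2)] sub x by auto
  qed
  moreover have "(1 - real q) *\<^sub>R (laplace (p + q) ^^ ?m) ?fs x = 0" if x: "x \<in> \<Omega>" for x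
    using laplace_funpow_cong[OF dirO fs x] laplace_funpow_lift_B[OF assms(2)] sub x by auto
  moreover have "(laplace (p + q) ^^ ((q + 1) div 2)) f x = 0" if x: "x \<in> \<Omega>" for x
    using laplace_funpow_cong[OF dirO f x] laplace_funpow_f_ext[OF assms(2)] sub x by auto
  ultimately show ?thesis by (simp add: Let_def)
qed

end
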